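(* Let $V$ be a non-degenerate space of quasi-polynomials and $U$ a non-degenerate space of quasi-exponentials which are bispectral dual to each other (with respect to the Mellin-type and Fourier-type integral transforms). Let $X\subset\mathbb C[u]$ be the Gaudin admissible subspace corresponding to $V$ and $Y\subset\mathbb C[x]$ the XXX admissible subspace corresponding to $U$. Then $X$ and $Y$ are bispectral correspondent, i.e. their stationary Baker–Akhiezer functions coincide: $\Psi_X(x,u)=\Phi_Y(u,x)$.
   Context: **Quasi-polynomials.** $N_1,\dots,N_n$ positive integers, $N=\sum N_i$; for each $i$, integers $0<n_{i1}<\dots<n_{iN_i}$ and $p_{ij}\in\mathbb C[x]$ of degree $n_{ij}$; $\lambda_1,\dots,\lambda_n\in\mathbb C$ with $\lambda_i-\lambda_j\notin\mathbb Z$ for $i\ne j$. $V$ is the $N$-dimensional span of the multivalued functions $x^{\lambda_i}p_{ij}(x)$. It is non-degenerate if for all $i$ and $j=1,\dots,N_i$ some linear combination of $p_{i1},\dots,p_{iN_i}$ has a root at $0$ of multiplicity exactly $j-1$, and $x^{\lambda_i+n_{ij}}\notin V$. The exponents of $V$ at $z\in\mathbb C^*$ are the integers $e_1<\dots<e_N$ occurring as multiplicities at $z$ of roots of nonzero elements of $V$; $z$ is singular if they are not $0,\dots,N-1$. Let $z_1,\dots,z_m$ be all singular points in $\mathbb C^*$, with exponents at $z_a$ written $0<\dots<N-M_a-1<N-M_a+m_{a1}<\dots<N-M_a+m_{aM_a}$, $1\le M_a\le N$, $0<m_{a1}<\dots<m_{aM_a}$. $V$ then has data $\{n,N_i,n_{ij},\lambda_i,m,M_a,m_{ab},z_a\}$.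 $\bar D_V$ is the monic linear differential operator of order $N$ annihilating $V$. $V^\star$ is the span of $\mathrm{Wr}(f_1,\dots,f_{N-1})/\mathrm{Wr}_V$, $f_i\in V$ ($\mathrm{Wr}$ = Wronskian, $\mathrm{Wr}_V$ = Wronskian of a basis), and $V^\dagger=x^{-N}\prod_a(x-z_a)^{-M_a}V^\star$. **Quasi-exponentials.** $(\tau_uf)(u)=f(u+1)$, $z^u=e^{u\ln z}$ for $z\neq0$ with fixed argument. $U$ is the $M$-dimensional span of $z_a^uq_{ab}(u)$, $a=1,\dots,m$, $b=1,\dots,M_a$, $M=\sum M_a$, where $z_1,\dots,z_m$ are distinct nonzero numbers with fixed arguments and $q_{ab}\in\mathbb C[u]$ has degree $m_{ab}$, $0<m_{a1}<\dots<m_{aM_a}$. The discrete exponents of $U$ at $\mu$ are the unique nonnegative integers $c_1<\dots<c_M$ for which there is a basis $f_1,\dots,f_M$ with $f_i(\mu+j)=0$ for $0\le j<c_i$, $f_i(\mu+c_i)\ne0$. $U$ has data $\{m,M_a,m_{ab},z_a,n,N_i,n_{ij},\mu_i\}$ if $\mu_i-\mu_j\notin\mathbb Z$ ($i\ne j$) and the discrete exponents at $\mu_i$ are $0<\dots<M-N_i-1<M-N_i+n_{i1}<\dots<M-N_i+n_{iN_i}$, $1\le N_i\le M$, $0<n_{i1}<\dots<n_{iN_i}$. $D_U=B_0(u)\tau_u^M+\dots+B_M(u)$ denotes the operator of order $M$ with polynomial coefficients annihilating $U$ with $B_0$ monic of minimal degree; $\bar D_U=B_0^{-1}D_U$ is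 the monic fundamental difference operator. $U$ is non-degenerate (with the given data) if $\sum_{a,b}(m_{ab}+1-b)=\sum_{i,j}(n_{ij}+1-j)$ and $\deg B_0=\sum_iN_i$. $U^\ddagger$ is the span of $\tau_u(\mathrm{Wr}^{(d)}(f_1,\dots,f_{M-1}))/(B_M\mathrm{Wr}^{(d)}_U)$, $f_i\in U$, where $\mathrm{Wr}^{(d)}(f_1,\dots,f_k)=\det(f_j(u+l-1))_{j,l=1}^k$ and $\mathrm{Wr}_U^{(d)}$ is the discrete Wronskian of a basis. **Bispectral duality.** $U$ is bispectral dual to $V$ if $U$ is the span of the functions $\int_{\gamma_a}x^uf(x)\,dx$, $a=1,\dots,m$, $f\in V^\dagger$, with $\gamma_a$ a small counterclockwise circle around $z_a$ (branch of $\ln x$ near $z_a$ given by the fixed argument of $z_a$). $V$ is bispectral dual to $U$ if $V$ is the span of the functions $\int_{\gamma_i}x^uf(u)\,du$, $i=1,\dots,n$, $f\in U^\ddagger$, with $\gamma_i$ a simple closed counterclockwise curve enclosing $\mu_i-N_i,\mu_i-N_i+1,\dots,\mu_i-N_i+n_{iN_i}$ and leaving outside the analogous points for other indices. The paper shows these two relations are equivalent (and $\mu_i=\lambda_i+N_i$). **Gaudin admissible subspaces.** Writing $p_{ij}(x)=\sum_{a=0}^{n_{ij}}c_{i,j,a}x^a$, the subspace $X\subset\mathbb C[u]$ corresponding to $V$ consists of all $r\in\mathbb C[u]$ with $\sum_{a=0}^{n_{ij}}c_{i,j,a}\,r(\lambda_i+a)=0$ for all $i,j$. Its stationary Baker–Akhiezer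 function is $$\Psi_X(x,u)=\prod_{i=1}^n\prod_{j=1}^{N_i}\frac{x}{u-\lambda_i-n_{ij}}\ \bar D_V\,x^u .$$ **XXX admissible subspaces.** Writing $z_a^uq_{ab}(u)=\sum_{i=0}^{m_{ab}}d_{a,b,i}\frac{d^i}{dx^i}x^u\big|_{x=z_a}$, the subspace $Y\subset\mathbb C[x]$ corresponding to $U$ consists of all $r\in\mathbb C[x]$ with $\sum_{i=0}^{m_{ab}}d_{a,b,i}\,r^{(i)}(z_a)=0$ for all $a,b$. Its stationary Baker–Akhiezer function is $$\Phi_Y(u,x)=\prod_{a=1}^m(x-z_a)^{-M_a}\ \bar D_U\,x^u ,$$ where $\bar D_U$ acts on $x^u$ as a function of $u$. *)

theory Defs
  imports
    "HOL-Complex_Analysis.Complex_Analysis"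
    "HOL-Library.Function_Algebras"
    "Jordan_Normal_Form.Determinant"
begin

text \<open>
  Multivalued functions of \<open>x \<in> \<complex> - {0}\<close> are functions on the universal cover: \<open>f :: complex \<Rightarrow> complex\<close>
  is a function of \<open>t = ln x\<close>, so that \<open>x = exp t\<close> and \<open>x\<^sup>u\<close> is \<open>\<lambda>t. exp (u * t)\<close>.
  A nonzero number with a fixed argument is given by its logarithm \<open>l\<close>, so that \<open>z = exp l\<close> and
  \<open>z\<^sup>u\<close> is \<open>\<lambda>u. exp (u * l)\<close>.
  All families are indexed from 1, as in \<open>i \<in> {1..n}\<close>, \<open>j \<in> {1..N i}\<close>.
\<close>

interpretation cfun: vector_space "\<lambda>(c::complex) (f::complex \<Rightarrow> complex) t. c * f t"
  by unfold_locales (auto simp: fun_eq_iff algebra_simps)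

definition basis_of :: "nat \<Rightarrow> (nat \<Rightarrow> complex \<Rightarrow> complex) \<Rightarrow> (complex \<Rightarrow> complex) set \<Rightarrow> bool" where
  "basis_of k f W \<longleftrightarrow>
     inj_on f {1..k} \<and> cfun.independent (f ` {1..k}) \<and> cfun.span (f ` {1..k}) = W"

text \<open>The derivative \<open>d/dx\<close>, written in the coordinate \<open>t\<close>.\<close>

definition xderiv :: "(complex \<Rightarrow> complex) \<Rightarrow> complex \<Rightarrow> complex" where
  "xderiv f t = deriv f t / exp t"

text \<open>The branch of \<open>ln x\<close> near \<open>exp s\<close> with value \<open>s\<close> at \<open>exp s\<close>, used only in the disc
  \<open>\<bar>x - exp s\<bar> < \<bar>exp s\<bar>\<close>, where it is holomorphic. The corresponding branch of a multivalued \<open>f\<close>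
  is \<open>\<lambda>x. f (ln_branch s x)\<close>.\<close>

definition ln_branch :: "complex \<Rightarrow> complex \<Rightarrow> complex" where
  "ln_branch s x = s + Ln (x / exp s)"

definition wronskian :: "nat \<Rightarrow> (nat \<Rightarrow> complex \<Rightarrow> complex) \<Rightarrow> complex \<Rightarrow> complex" where
  "wronskian k f t = Determinant.det (Matrix.mat k k (\<lambda>(i, j). (xderiv ^^ j) (f (Suc i)) t))"

definition discrete_wronskian :: "nat \<Rightarrow> (nat \<Rightarrow> complex \<Rightarrow> complex) \<Rightarrow> complex \<Rightarrow> complex" where
  "discrete_wronskian k f u = Determinant.det (Matrix.mat k k (\<lambda>(i, j). f (Suc i) (u + of_nat j)))"


definition qpoly_data ::
  "nat \<Rightarrow> (nat \<Rightarrow> nat) \<Rightarrow> (nat \<Rightarrow> nat \<Rightarrow> nat) \<Rightarrow> (nat \<Rightarrow> complex) \<Rightarrow> (nat \<Rightarrow> nat \<Rightarrow> complex poly) \<Rightarrow> bool" where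
  "qpoly_data n N nn lam p \<longleftrightarrow>
     1 \<le> n \<and>
     (\<forall>i\<in>{1..n}. 1 \<le> N i \<and> strict_mono_on {1..N i} (nn i) \<and>
        (\<forall>j\<in>{1..N i}. 0 < nn i j \<and> Polynomial.degree (p i j) = nn i j)) \<and>
     (\<forall>i\<in>{1..n}. \<forall>i'\<in>{1..n}. i \<noteq> i' \<longrightarrow> lam i - lam i' \<notin> \<int>)"

definition qpoly_space ::
  "nat \<Rightarrow> (nat \<Rightarrow> nat) \<Rightarrow> (nat \<Rightarrow> complex) \<Rightarrow> (nat \<Rightarrow> nat \<Rightarrow> complex poly) \<Rightarrow> (complex \<Rightarrow> complex) set" where
  "qpoly_space n N lam p =
     cfun.span {(\<lambda>t. exp (lam i * t) * poly (p i j) (exp t)) | i j. i \<in> {1..n} \<and> j \<in> {1..N i}}"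

definition qpoly_nondegenerate ::
  "nat \<Rightarrow> (nat \<Rightarrow> nat) \<Rightarrow> (nat \<Rightarrow> nat \<Rightarrow> nat) \<Rightarrow> (nat \<Rightarrow> complex) \<Rightarrow> (nat \<Rightarrow> nat \<Rightarrow> complex poly) \<Rightarrow> bool" where
  "qpoly_nondegenerate n N nn lam p \<longleftrightarrow>
     (\<forall>i\<in>{1..n}. \<forall>j\<in>{1..N i}.
        (\<exists>c. (\<Sum>k=1..N i. Polynomial.smult (c k) (p i k)) \<noteq> 0 \<and>
             Polynomial.order 0 (\<Sum>k=1..N i. Polynomial.smult (c k) (p i k)) = j - 1) \<and>
        (\<lambda>t. exp ((lam i + of_nat (nn i j)) * t)) \<notin> qpoly_space n N lam p)"

text \<open>Multiplicities of roots at \<open>x = z\<close> of (any branch of) nonzero elements of \<open>V\<close>.\<close>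

definition exponents :: "(complex \<Rightarrow> complex) set \<Rightarrow> complex \<Rightarrow> nat set" where
  "exponents V z =
     {e. \<exists>f\<in>V. \<exists>s. f \<noteq> 0 \<and> exp s = z \<and> zorder (\<lambda>x. f (ln_branch s x)) z = int e}"

text \<open>Here and below \<open>d\<close> is the dimension of \<open>V\<close>.\<close>

definition singular_points :: "nat \<Rightarrow> (complex \<Rightarrow> complex) set \<Rightarrow> complex set" where
  "singular_points d V = {z. z \<noteq> 0 \<and> exponents V z \<noteq> {..<d}}"

text \<open>\<open>l a\<close> is the logarithm of the singular point \<open>z\<^sub>a\<close> given by its fixed argument.\<close>

definition singular_data ::
  "nat \<Rightarrow> (complex \<Rightarrow> complex) set \<Rightarrow> nat \<Rightarrow> (nat \<Rightarrow> complex) \<Rightarrow> (nat \<Rightarrow> nat) \<Rightarrow> (nat \<Rightarrow> nat \<Rightarrow> nat) \<Rightarrow> bool" where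
  "singular_data d V m l M mm \<longleftrightarrow>
     inj_on (\<lambda>a. exp (l a)) {1..m} \<and>
     singular_points d V = (\<lambda>a. exp (l a)) ` {1..m} \<and>
     (\<forall>a\<in>{1..m}. 1 \<le> M a \<and> M a \<le> d \<and>
        strict_mono_on {1..M a} (mm a) \<and> (\<forall>b\<in>{1..M a}. 0 < mm a b) \<and>
        exponents V (exp (l a)) = {..<d - M a} \<union> (\<lambda>b. d - M a + mm a b) ` {1..M a})"

text \<open>The monic operator \<open>(d/dx)\<^sup>d + \<Sum>k<d. b\<^sub>k (d/dx)\<^sup>k\<close>. Its coefficients are considered (and, for the
  operator annihilating \<open>V\<close>, are determined) away from the singular points only.\<close>

definition monic_diff_op ::
  "nat \<Rightarrow> (nat \<Rightarrow> complex \<Rightarrow> complex) \<Rightarrow> (complex \<Rightarrow> complex) \<Rightarrow> complex \<Rightarrow> complex" where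
  "monic_diff_op d b f t = (xderiv ^^ d) f t + (\<Sum>k<d. b k t * (xderiv ^^ k) f t)"

definition fundamental_diff_op ::
  "nat \<Rightarrow> (complex \<Rightarrow> complex) set \<Rightarrow> (nat \<Rightarrow> complex \<Rightarrow> complex) \<Rightarrow> bool" where
  "fundamental_diff_op d V b \<longleftrightarrow>
     (\<forall>k<d. b k holomorphic_on {t. exp t \<notin> singular_points d V}) \<and>
     (\<forall>f\<in>V. \<forall>t. exp t \<notin> singular_points d V \<longrightarrow> monic_diff_op d b f t = 0)"

text \<open>\<open>V\<^sup>\<star>\<close> and \<open>V\<^sup>\<dagger>\<close>. Letting \<open>g\<close> range over all bases does not change the span, since the
  Wronskians of two bases are proportional.\<close>

definition star_space :: "nat \<Rightarrow> (complex \<Rightarrow> complex) set \<Rightarrow> (complex \<Rightarrow> complex) set" where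
  "star_space d V =
     cfun.span {(\<lambda>t. wronskian (d - 1) f t / wronskian d g t) | f g.
       (\<forall>i\<in>{1..d - 1}. f i \<in> V) \<and> basis_of d g V}"

definition dagger_space ::
  "nat \<Rightarrow> (complex \<Rightarrow> complex) set \<Rightarrow> nat \<Rightarrow> (nat \<Rightarrow> complex) \<Rightarrow> (nat \<Rightarrow> nat) \<Rightarrow> (complex \<Rightarrow> complex) set" where
  "dagger_space d V m l M =
     (\<lambda>f t. f t / (exp t ^ d * (\<Prod>a=1..m. (exp t - exp (l a)) ^ M a))) ` star_space d V"


definition qexp_data ::
  "nat \<Rightarrow> (nat \<Rightarrow> complex) \<Rightarrow> (nat \<Rightarrow> nat) \<Rightarrow> (nat \<Rightarrow> nat \<Rightarrow> nat) \<Rightarrow> (nat \<Rightarrow> nat \<Rightarrow> complex poly) \<Rightarrow> bool" where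
  "qexp_data m l M mm q \<longleftrightarrow>
     1 \<le> m \<and> inj_on (\<lambda>a. exp (l a)) {1..m} \<and>
     (\<forall>a\<in>{1..m}. 1 \<le> M a \<and> strict_mono_on {1..M a} (mm a) \<and>
        (\<forall>b\<in>{1..M a}. 0 < mm a b \<and> Polynomial.degree (q a b) = mm a b))"

definition qexp_space ::
  "nat \<Rightarrow> (nat \<Rightarrow> complex) \<Rightarrow> (nat \<Rightarrow> nat) \<Rightarrow> (nat \<Rightarrow> nat \<Rightarrow> complex poly) \<Rightarrow> (complex \<Rightarrow> complex) set" where
  "qexp_space m l M q =
     cfun.span {(\<lambda>u. exp (u * l a) * poly (q a b) u) | a b. a \<in> {1..m} \<and> b \<in> {1..M a}}"

definition discrete_exponents :: "nat \<Rightarrow> (complex \<Rightarrow> complex) set \<Rightarrow> complex \<Rightarrow> nat set \<Rightarrow> bool" where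
  "discrete_exponents d U mu C \<longleftrightarrow>
     (\<exists>c f. strict_mono_on {1..d} c \<and> C = c ` {1..d} \<and> basis_of d f U \<and>
        (\<forall>i\<in>{1..d}. (\<forall>j<c i. f i (mu + of_nat j) = 0) \<and> f i (mu + of_nat (c i)) \<noteq> 0))"

definition discrete_data ::
  "nat \<Rightarrow> (complex \<Rightarrow> complex) set \<Rightarrow> nat \<Rightarrow> (nat \<Rightarrow> nat) \<Rightarrow> (nat \<Rightarrow> nat \<Rightarrow> nat) \<Rightarrow> (nat \<Rightarrow> complex) \<Rightarrow> bool" where
  "discrete_data d U n N nn mu \<longleftrightarrow>
     (\<forall>i\<in>{1..n}. \<forall>i'\<in>{1..n}. i \<noteq> i' \<longrightarrow> mu i - mu i' \<notin> \<int>) \<and>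
     (\<forall>i\<in>{1..n}. 1 \<le> N i \<and> N i \<le> d \<and>
        strict_mono_on {1..N i} (nn i) \<and> (\<forall>j\<in>{1..N i}. 0 < nn i j) \<and>
        discrete_exponents d U (mu i) ({..<d - N i} \<union> (\<lambda>j. d - N i + nn i j) ` {1..N i}))"

text \<open>\<open>B\<^sub>0 \<tau>\<^sup>d + \<dots> + B\<^sub>d\<close> annihilates \<open>U\<close>.\<close>

definition annihilates_shift ::
  "nat \<Rightarrow> (nat \<Rightarrow> complex poly) \<Rightarrow> (complex \<Rightarrow> complex) set \<Rightarrow> bool" where
  "annihilates_shift d B U \<longleftrightarrow>
     (\<forall>f\<in>U. \<forall>u. (\<Sum>k\<le>d. poly (B k) u * f (u + of_nat (d - k))) = 0)"

definition fundamental_shift_op ::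
  "nat \<Rightarrow> (complex \<Rightarrow> complex) set \<Rightarrow> (nat \<Rightarrow> complex poly) \<Rightarrow> bool" where
  "fundamental_shift_op d U B \<longleftrightarrow>
     annihilates_shift d B U \<and> lead_coeff (B 0) = 1 \<and>
     (\<forall>B'. annihilates_shift d B' U \<and> B' 0 \<noteq> 0 \<longrightarrow> Polynomial.degree (B 0) \<le> Polynomial.degree (B' 0))"

definition monic_shift_op ::
  "nat \<Rightarrow> (nat \<Rightarrow> complex poly) \<Rightarrow> (complex \<Rightarrow> complex) \<Rightarrow> complex \<Rightarrow> complex" where
  "monic_shift_op d B f u = (\<Sum>k\<le>d. poly (B k) u / poly (B 0) u * f (u + of_nat (d - k)))"

definition qexp_nondegenerate ::
  "nat \<Rightarrow> (nat \<Rightarrow> nat) \<Rightarrow> (nat \<Rightarrow> nat \<Rightarrow> nat) \<Rightarrow> nat \<Rightarrow> (nat \<Rightarrow> nat) \<Rightarrow> (nat \<Rightarrow> nat \<Rightarrow> nat) \<Rightarrow>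
   (nat \<Rightarrow> complex poly) \<Rightarrow> bool" where
  "qexp_nondegenerate m M mm n N nn B \<longleftrightarrow>
     (\<Sum>a=1..m. \<Sum>b=1..M a. int (mm a b) + 1 - int b) =
     (\<Sum>i=1..n. \<Sum>j=1..N i. int (nn i j) + 1 - int j) \<and>
     Polynomial.degree (B 0) = (\<Sum>i=1..n. N i)"

definition ddagger_space ::
  "nat \<Rightarrow> (complex \<Rightarrow> complex) set \<Rightarrow> (nat \<Rightarrow> complex poly) \<Rightarrow> (complex \<Rightarrow> complex) set" where
  "ddagger_space d U B =
     cfun.span {(\<lambda>u. discrete_wronskian (d - 1) f (u + 1) /
                     (poly (B d) u * discrete_wronskian d g u)) | f g.
       (\<forall>i\<in>{1..d - 1}. f i \<in> U) \<and> basis_of d g U}"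


text \<open>\<open>U\<close> is bispectral dual to \<open>V\<close>, where \<open>W = V\<^sup>\<dagger>\<close>. The circles are so small that they lie in the
  domain of the branch of \<open>ln x\<close> and separate \<open>z\<^sub>a\<close> from the other singular points.\<close>

definition mellin_dual ::
  "nat \<Rightarrow> (nat \<Rightarrow> complex) \<Rightarrow> (complex \<Rightarrow> complex) set \<Rightarrow> (complex \<Rightarrow> complex) set \<Rightarrow> bool" where
  "mellin_dual m l W U \<longleftrightarrow>
     (\<exists>r. (\<forall>a\<in>{1..m}. 0 < r a \<and> r a < norm (exp (l a)) \<and>
             (\<forall>a'\<in>{1..m}. a' \<noteq> a \<longrightarrow> exp (l a') \<notin> cball (exp (l a)) (r a))) \<and>
          U = cfun.span {(\<lambda>u. contour_integral (circlepath (exp (l a)) (r a))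
                            (\<lambda>x. exp (u * ln_branch (l a) x) * f (ln_branch (l a) x))) | a f.
                a \<in> {1..m} \<and> f \<in> W})"

definition encl_points :: "(nat \<Rightarrow> nat) \<Rightarrow> (nat \<Rightarrow> nat \<Rightarrow> nat) \<Rightarrow> (nat \<Rightarrow> complex) \<Rightarrow> nat \<Rightarrow> complex set" where
  "encl_points N nn mu i = (\<lambda>k. mu i - of_nat (N i) + of_nat k) ` {0..nn i (N i)}"

text \<open>\<open>V\<close> is bispectral dual to \<open>U\<close>, where \<open>W = U\<^sup>\<ddagger>\<close>.\<close>

definition fourier_dual ::
  "nat \<Rightarrow> (nat \<Rightarrow> nat) \<Rightarrow> (nat \<Rightarrow> nat \<Rightarrow> nat) \<Rightarrow> (nat \<Rightarrow> complex) \<Rightarrow>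
   (complex \<Rightarrow> complex) set \<Rightarrow> (complex \<Rightarrow> complex) set \<Rightarrow> bool" where
  "fourier_dual n N nn mu W V \<longleftrightarrow>
     (\<exists>\<gamma>. (\<forall>i\<in>{1..n}.
             valid_path (\<gamma> i) \<and> simple_path (\<gamma> i) \<and> pathfinish (\<gamma> i) = pathstart (\<gamma> i) \<and>
             (\<forall>w\<in>inside (path_image (\<gamma> i)). winding_number (\<gamma> i) w = 1) \<and>
             encl_points N nn mu i \<subseteq> inside (path_image (\<gamma> i)) \<and>
             (\<forall>i'\<in>{1..n}. i' \<noteq> i \<longrightarrow> encl_points N nn mu i' \<subseteq> outside (path_image (\<gamma> i)))) \<and>
          V = cfun.span {(\<lambda>t. contour_integral (\<gamma> i) (\<lambda>u. exp (u * t) * f u)) | i f.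
                i \<in> {1..n} \<and> f \<in> W})"


definition gaudin_subspace ::
  "nat \<Rightarrow> (nat \<Rightarrow> nat) \<Rightarrow> (nat \<Rightarrow> nat \<Rightarrow> nat) \<Rightarrow> (nat \<Rightarrow> complex) \<Rightarrow> (nat \<Rightarrow> nat \<Rightarrow> complex poly) \<Rightarrow>
   complex poly set" where
  "gaudin_subspace n N nn lam p =
     {r. \<forall>i\<in>{1..n}. \<forall>j\<in>{1..N i}.
           (\<Sum>a=0..nn i j. Polynomial.coeff (p i j) a * poly r (lam i + of_nat a)) = 0}"

definition gaudin_BA ::
  "nat \<Rightarrow> (nat \<Rightarrow> nat) \<Rightarrow> (nat \<Rightarrow> nat \<Rightarrow> nat) \<Rightarrow> (nat \<Rightarrow> complex) \<Rightarrow> (nat \<Rightarrow> complex \<Rightarrow> complex) \<Rightarrow>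
   complex \<Rightarrow> complex \<Rightarrow> complex" where
  "gaudin_BA n N nn lam b t u =
     (\<Prod>i=1..n. \<Prod>j=1..N i. exp t / (u - lam i - of_nat (nn i j))) *
     monic_diff_op (\<Sum>i=1..n. N i) b (\<lambda>s. exp (u * s)) t"

text \<open>In \<open>xxx_subspace\<close>, \<open>dd a b i\<close> are the (unique) coefficients with
  \<open>z\<^sub>a\<^sup>u q\<^sub>a\<^sub>b(u) = \<Sum>i. dd a b i * (d/dx)\<^sup>i x\<^sup>u\<close> at \<open>x = z\<^sub>a\<close>, that is, at \<open>t = l a\<close>.\<close>

definition xxx_subspace ::
  "nat \<Rightarrow> (nat \<Rightarrow> complex) \<Rightarrow> (nat \<Rightarrow> nat) \<Rightarrow> (nat \<Rightarrow> nat \<Rightarrow> nat) \<Rightarrow> (nat \<Rightarrow> nat \<Rightarrow> complex poly) \<Rightarrow>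
   complex poly set \<Rightarrow> bool" where
  "xxx_subspace m l M mm q Y \<longleftrightarrow>
     (\<exists>dd :: nat \<Rightarrow> nat \<Rightarrow> nat \<Rightarrow> complex.
        (\<forall>a\<in>{1..m}. \<forall>b\<in>{1..M a}. \<forall>u.
           exp (u * l a) * poly (q a b) u =
           (\<Sum>i=0..mm a b. dd a b i * (xderiv ^^ i) (\<lambda>t. exp (u * t)) (l a))) \<and>
        Y = {r. \<forall>a\<in>{1..m}. \<forall>b\<in>{1..M a}.
               (\<Sum>i=0..mm a b. dd a b i * poly ((pderiv ^^ i) r) (exp (l a))) = 0})"

definition xxx_BA ::
  "nat \<Rightarrow> (nat \<Rightarrow> complex) \<Rightarrow> (nat \<Rightarrow> nat) \<Rightarrow> (nat \<Rightarrow> complex poly) \<Rightarrow> complex \<Rightarrow> complex \<Rightarrow> complex" where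
  "xxx_BA m l M B u t =
     (\<Prod>a=1..m. 1 / (exp t - exp (l a)) ^ M a) *
     monic_shift_op (\<Sum>a=1..m. M a) B (\<lambda>v. exp (v * t)) u"

text \<open>\<open>is_gaudin_BA X \<Psi>\<close>: \<open>\<Psi>\<close> is the stationary Baker--Akhiezer function of the Gaudin admissible
  subspace \<open>X\<close>, through a non-degenerate space \<open>V\<close> to which \<open>X\<close> corresponds.
  Similarly \<open>is_xxx_BA Y \<Phi>\<close>. Values at the poles are irrelevant.\<close>

definition is_gaudin_BA :: "complex poly set \<Rightarrow> (complex \<Rightarrow> complex \<Rightarrow> complex) \<Rightarrow> bool" where
  "is_gaudin_BA X \<Psi> \<longleftrightarrow>
     (\<exists>n N nn lam p b.
        qpoly_data n N nn lam p \<and> qpoly_nondegenerate n N nn lam p \<and>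
        X = gaudin_subspace n N nn lam p \<and>
        fundamental_diff_op (\<Sum>i=1..n. N i) (qpoly_space n N lam p) b \<and>
        \<Psi> = gaudin_BA n N nn lam b)"

definition is_xxx_BA :: "complex poly set \<Rightarrow> (complex \<Rightarrow> complex \<Rightarrow> complex) \<Rightarrow> bool" where
  "is_xxx_BA Y \<Phi> \<longleftrightarrow>
     (\<exists>m l M mm q n N nn mu B.
        qexp_data m l M mm q \<and>
        discrete_data (\<Sum>a=1..m. M a) (qexp_space m l M q) n N nn mu \<and>
        fundamental_shift_op (\<Sum>a=1..m. M a) (qexp_space m l M q) B \<and>
        qexp_nondegenerate m M mm n N nn B \<and>
        xxx_subspace m l M mm q Y \<and>
        \<Phi> = xxx_BA m l M B)"

text \<open>The stationary Baker--Akhiezer functions, which are \<open>x\<^sup>u\<close> times rational functions, are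
  compared away from finitely many values of \<open>x = exp t\<close> and of \<open>u\<close>.\<close>

definition bispectral_correspondent :: "complex poly set \<Rightarrow> complex poly set \<Rightarrow> bool" where
  "bispectral_correspondent X Y \<longleftrightarrow>
     (\<exists>\<Psi> \<Phi> S T. is_gaudin_BA X \<Psi> \<and> is_xxx_BA Y \<Phi> \<and> finite S \<and> finite T \<and>
        (\<forall>t u. exp t \<notin> S \<longrightarrow> u \<notin> T \<longrightarrow> \<Psi> t u = \<Phi> u t))"

end

theory Submission
  imports Defs
begin

text \<open>
  Multiplied by \<open>x\<^sup>N \<Prod>\<^sub>a (x - z\<^sub>a)\<^bsup>M\<^sub>a\<^esup>\<close>, the monic operator annihilating \<open>V\<close> becomes a polynomial
  in \<open>x\<close> and \<open>x d/dx\<close>. Applied to \<open>x\<^sup>u\<close> it gives \<open>\<Sum>\<^sub>j \<beta>\<^sub>j(u) x\<^sup>u\<^sup>+\<^sup>j\<close> with \<open>j \<le> M\<^sub>1 + \<dots> + M\<^sub>m\<close>, so it can also be read as the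
  difference operator \<open>\<Sum>\<^sub>j \<beta>\<^sub>j(u) \<tau>\<^sup>j\<close> applied to \<open>x\<^sup>u\<close>. The theorem says that, up to the factor
  \<open>\<Prod>\<^sub>i\<^sub>j (u - \<lambda>\<^sub>i - n\<^sub>i\<^sub>j)\<close>, this is the monic difference operator annihilating \<open>U\<close>. There are four points.

  Polynomiality (\<open>coefficient_polynomial\<close>). The equation is Fuchsian at \<open>0\<close>, \<open>\<infinity>\<close> and the \<open>z\<^sub>a\<close>: enough solutions
  behave like distinct powers, and solving the linear system for the coefficients bounds them
  (\<open>coefficients_bounded_if_solutions_like_powers\<close>). At \<open>z\<^sub>a\<close> the general bound on the pole orders improves to
  \<open>M\<^sub>a\<close>, because the first exponents are \<open>0, \<dots>, N - M\<^sub>a - 1\<close> (\<open>pole_order_at_singular_point\<close>). The coefficients are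
  single-valued, so removal of singularities and Liouville's theorem apply. The coefficient \<open>\<beta>\<^sub>j\<close> of largest
  \<open>j\<close> is the indicial polynomial at \<open>\<infinity>\<close>, that is \<open>\<Prod>\<^sub>i\<^sub>j (u - \<lambda>\<^sub>i - n\<^sub>i\<^sub>j)\<close> (\<open>leading_coefficient\<close>).

  Annihilation (\<open>mellin_dual_annihilated\<close>). For \<open>h \<in> V\<^sup>\<star>\<close> and any \<open>\<phi>\<close>, the product of \<open>h\<close> with the operator applied to
  \<open>\<phi>\<close> is a derivative, by the Lagrange identity for Wronskians (\<open>star_space_primitive\<close>). For \<open>\<phi> = x\<^sup>u\<close>,
  integration over the circle around \<open>z\<^sub>a\<close> shows that the integrals which span \<open>U\<close> are annihilated by
  \<open>\<Sum>\<^sub>j \<beta>\<^sub>j(u) \<tau>\<^sup>j\<close>.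

  Uniqueness (\<open>short_annihilator_zero\<close>). A difference operator with polynomial coefficients of order less than
  \<open>dim U\<close> which annihilates \<open>U\<close> is zero: some nonzero element of \<open>U\<close> would vanish on a whole progression
  \<open>u\<^sub>0 + \<nat>\<close>, and exponentials with distinct bases are independent over the polynomials. Hence two
  annihilators of order \<open>dim U\<close> are proportional.

  Multiplicities (\<open>multiplicities_equal\<close>). It remains to see that \<open>U\<close> has the same numbers \<open>M\<^sub>a\<close>, which gives both
  the order of the difference operator and the factors \<open>x - z\<^sub>a\<close>. In the basis of \<open>V\<^sup>\<dagger>\<close> dual to solutions with
  distinct exponents at \<open>z\<^sub>a\<close>, \<open>M\<^sub>a\<close> functions have poles of distinct orders there; their products with \<open>x\<^sup>u\<close> have
  residues proportional to elements \<open>z\<^sub>a\<^sup>u r(u)\<close> of \<open>U\<close> of \<open>M\<^sub>a\<close> different degrees (\<open>mellin_dual_summand\<close>). The opposite inequality follows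
  from uniqueness, as \<open>\<Sum>\<^sub>j \<beta>\<^sub>j(u) \<tau>\<^sup>j\<close> cannot have order less than \<open>dim U\<close>.
\<close>

section \<open>Square linear systems\<close>

text \<open>Matrices are given by their entries as functions of the indices, so that rows and columns can be
  replaced, rescaled and differentiated under a \<open>\<lambda>\<close>.\<close>

definition sqdet :: "nat \<Rightarrow> (nat \<Rightarrow> nat \<Rightarrow> complex) \<Rightarrow> complex" where
  "sqdet n A = Determinant.det (Matrix.mat n n (\<lambda>(i, j). A i j))"

lemma wronskian_eq_sqdet: "wronskian k f t = sqdet k (\<lambda>i j. (xderiv ^^ j) (f (Suc i)) t)"
  by (simp add: wronskian_def sqdet_def)

lemma sqdet_cong:
  assumes "\<And>i j. i < n \<Longrightarrow> j < n \<Longrightarrow> A i j = A' i j"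
  shows "sqdet n A = sqdet n A'"
proof -
  have "Matrix.mat n n (\<lambda>(i, j). A i j) = Matrix.mat n n (\<lambda>(i, j). A' i j)"
    using assms by (intro eq_matI) auto
  thus ?thesis by (simp add: sqdet_def)
qed

lemma sqdet_eq_0_iff:
  "sqdet n A = 0 \<longleftrightarrow> (\<exists>c. (\<exists>k<n. c k \<noteq> 0) \<and> (\<forall>i<n. (\<Sum>k<n. A i k * c k) = 0))"
proof -
  let ?M = "Matrix.mat n n (\<lambda>(i, j). A i j)"
  have M: "?M \<in> carrier_mat n n" by simp
  have prod: "vec_index (?M *\<^sub>v v) i = (\<Sum>k<n. A i k * vec_index v k)" if "v \<in> carrier_vec n" "i < n" for v i
    using that by (auto simp: scalar_prod_def atLeast0LessThan intro!: sum.cong)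
  have "sqdet n A = 0 \<longleftrightarrow> (\<exists>v. v \<in> carrier_vec n \<and> v \<noteq> 0\<^sub>v n \<and> ?M *\<^sub>v v = 0\<^sub>v n)"
    unfolding sqdet_def by (rule det_0_iff_vec_prod_zero_field[OF M])
  also have "\<dots> \<longleftrightarrow> (\<exists>c. (\<exists>k<n. c k \<noteq> 0) \<and> (\<forall>i<n. (\<Sum>k<n. A i k * c k) = 0))" (is "?L \<longleftrightarrow> ?R")
  proof
    assume ?L
    then obtain v where v: "v \<in> carrier_vec n" "v \<noteq> 0\<^sub>v n" "?M *\<^sub>v v = 0\<^sub>v n" by blast
    have "\<exists>k<n. vec_index v k \<noteq> 0" using v(1,2) by (metis carrier_vecD eq_vecI index_zero_vec)
    moreover have "\<forall>i<n. (\<Sum>k<n. A i k * vec_index v k) = 0"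
      using prod[OF v(1)] v(3) by (metis index_zero_vec(1))
    ultimately show ?R by blast
  next
    assume ?R
    then obtain c k where c: "k < n" "c k \<noteq> 0" "\<forall>i<n. (\<Sum>k<n. A i k * c k) = 0" by blast
    let ?v = "Matrix.vec n c"
    have "?M *\<^sub>v ?v = 0\<^sub>v n"
      using c(3) prod[of ?v] by (intro eq_vecI) auto
    moreover have "?v \<noteq> 0\<^sub>v n" using c(1,2) by (metis index_vec index_zero_vec(1))
    ultimately show ?L by (intro exI[of _ ?v]) auto
  qed
  finally show ?thesis .
qed

lemma sqdet_transpose: "sqdet n (\<lambda>i j. A j i) = sqdet n A"
proof -
  have "Matrix.mat n n (\<lambda>(i, j). A j i) = transpose_mat (Matrix.mat n n (\<lambda>(i, j). A i j))"
    by (intro eq_matI) auto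
  thus ?thesis unfolding sqdet_def by (simp add: det_transpose[of _ n])
qed

lemma permutes_lessThan: "p permutes {0..<n::nat} \<Longrightarrow> j < n \<Longrightarrow> p j < n"
  using permutes_in_image[of p "{0..<n}" j] by auto

lemma sqdet_leibniz:
  "sqdet n A = (\<Sum>p | p permutes {0..<n}. signof p * (\<Prod>j<n. A (p j) j))"
proof -
  have "(\<Prod>j<n. Matrix.mat n n (\<lambda>(i, j). A i j) $$ (p j, j)) = (\<Prod>j<n. A (p j) j)"
    if "p permutes {0..<n}" for p
    using permutes_lessThan[OF that] by (intro prod.cong refl) simp
  thus ?thesis unfolding sqdet_def by (simp add: det_col[of _ n])
qed

lemma sqdet_scale:
  "sqdet n (\<lambda>i j. r i * c j * A i j) = (\<Prod>i<n. r i) * (\<Prod>j<n. c j) * sqdet n A"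
proof -
  have "(\<Prod>j<n. r (p j)) = (\<Prod>i<n. r i)" if "p permutes {0..<n}" for p
    using prod.permute[OF that, of r] by (simp add: atLeast0LessThan comp_def)
  thus ?thesis unfolding sqdet_leibniz sum_distrib_left
    by (intro sum.cong refl) (simp add: prod.distrib mult_ac)
qed

lemma sqdet_equal_columns:
  assumes "j < n" "k < n" "j \<noteq> k" "\<And>i. i < n \<Longrightarrow> A i j = A i k"
  shows "sqdet n A = 0"
  unfolding sqdet_def
  by (rule det_identical_columns[of _ n j k]) (use assms in \<open>auto intro!: eq_vecI\<close>)

lemma tendsto_sqdet:
  assumes "\<And>i j. i < n \<Longrightarrow> j < n \<Longrightarrow> ((\<lambda>x. A x i j) \<longlongrightarrow> A0 i j) F"
  shows "((\<lambda>x. sqdet n (A x)) \<longlongrightarrow> sqdet n A0) F"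
  unfolding sqdet_leibniz
  using assms by (intro tendsto_sum tendsto_mult tendsto_const tendsto_prod) (auto dest: permutes_lessThan)

lemma holomorphic_sqdet:
  assumes "\<And>i j. i < n \<Longrightarrow> j < n \<Longrightarrow> (\<lambda>x. A x i j) holomorphic_on S"
  shows "(\<lambda>x. sqdet n (A x)) holomorphic_on S"
  unfolding sqdet_leibniz
  using assms by (intro holomorphic_on_sum holomorphic_on_mult holomorphic_on_const holomorphic_on_prod) (auto dest: permutes_lessThan)

text \<open>Only the last column of a Wronskian changes under differentiation. Its cofactors make the
  determinant a linear form in it; the last cofactor is the minor that appears in \<open>V\<^sup>\<star>\<close>.\<close>

lemma sqdet_last_column:
  obtains cof where
    "\<And>v. sqdet (Suc n) (\<lambda>i j. if j = n then v i else A i j) = (\<Sum>i\<le>n. v i * cof i)"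
    "cof n = sqdet n A"
proof -
  define cof where "cof i = Determinant.cofactor (Matrix.mat (Suc n) (Suc n) (\<lambda>(i, j). A i j)) i n" for i
  have del: "mat_delete (Matrix.mat (Suc n) (Suc n) (\<lambda>(i, j). if j = n then v i else A i j)) i n
     = mat_delete (Matrix.mat (Suc n) (Suc n) (\<lambda>(i, j). A i j)) i n" for v i
    unfolding mat_delete_def by (intro eq_matI) auto
  have "sqdet (Suc n) (\<lambda>i j. if j = n then v i else A i j) = (\<Sum>i\<le>n. v i * cof i)" for v
    unfolding sqdet_def
    by (subst laplace_expansion_column[of _ "Suc n" n])
       (auto simp: cof_def Determinant.cofactor_def del lessThan_Suc_atMost intro!: sum.cong)
  moreover have "mat_delete (Matrix.mat (Suc n) (Suc n) (\<lambda>(i, j). A i j)) n n = Matrix.mat n n (\<lambda>(i, j). A i j)"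
    unfolding mat_delete_def by (intro eq_matI) auto
  hence "cof n = sqdet n A"
    by (simp add: cof_def sqdet_def Determinant.cofactor_def flip: mult_2)
  ultimately show ?thesis using that by blast
qed

lemma sqdet_has_field_derivative:
  assumes "\<And>i j. i < n \<Longrightarrow> j < n \<Longrightarrow> ((\<lambda>x. A x i j) has_field_derivative A' i j) (at x)"
  shows "((\<lambda>x. sqdet n (A x)) has_field_derivative
           (\<Sum>k<n. sqdet n (\<lambda>i j. if j = k then A' i j else A x i j))) (at x)"
proof -
  have "((\<lambda>x. \<Prod>j<n. A x (p j) j) has_field_derivative
      (\<Sum>k<n. \<Prod>j<n. if j = k then A' (p j) j else A x (p j) j)) (at x)"
    if p: "p permutes {0..<n}" for p
  proof -
    have "((\<lambda>x. \<Prod>j<n. A x (p j) j) has_field_derivative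
        (\<Sum>k<n. A' (p k) k * (\<Prod>j\<in>{..<n} - {k}. A x (p j) j))) (at x)"
      using assms p by (intro has_field_derivative_prod) (auto dest: permutes_lessThan)
    moreover
    have "A' (p k) k * (\<Prod>j\<in>{..<n} - {k}. A x (p j) j)
        = (\<Prod>j<n. if j = k then A' (p j) j else A x (p j) j)" if "k < n" for k
      using that by (subst prod.remove[of _ k]) (auto intro!: prod.cong)
    hence "(\<Sum>k<n. A' (p k) k * (\<Prod>j\<in>{..<n} - {k}. A x (p j) j))
        = (\<Sum>k<n. \<Prod>j<n. if j = k then A' (p j) j else A x (p j) j)"
      by (intro sum.cong refl) simp
    ultimately show ?thesis by simp
  qed
  hence "((\<lambda>x. sqdet n (A x)) has_field_derivative
     (\<Sum>p | p permutes {0..<n}. signof p * (\<Sum>k<n. \<Prod>j<n. if j = k then A' (p j) j else A x (p j) j))) (at x)"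
    unfolding sqdet_leibniz by (intro DERIV_sum DERIV_cmult) simp
  also have "(\<Sum>p | p permutes {0..<n}. signof p * (\<Sum>k<n. \<Prod>j<n. if j = k then A' (p j) j else A x (p j) j))
      = (\<Sum>k<n. sqdet n (\<lambda>i j. if j = k then A' i j else A x i j))"
    unfolding sqdet_leibniz sum_distrib_left by (rule sum.swap)
  finally show ?thesis .
qed

lemma exists_left_inverse:
  assumes "sqdet n A \<noteq> 0"
  obtains L where "\<And>k k'. k < n \<Longrightarrow> k' < n \<Longrightarrow> (\<Sum>i<n. L k i * A i k') = (if k = k' then 1 else 0)"
proof -
  let ?M = "Matrix.mat n n (\<lambda>(i, j). A i j)"
  have M: "?M \<in> carrier_mat n n" by simp
  define L where "L k i = adj_mat ?M $$ (k, i) / Determinant.det ?M" for k i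
  have "(\<Sum>i<n. L k i * A i k') = (if k = k' then 1 else 0)" if "k < n" "k' < n" for k k'
  proof -
    have "(adj_mat ?M * ?M) $$ (k, k') = (\<Sum>i<n. adj_mat ?M $$ (k, i) * A i k')"
      using that adj_mat(1)[OF M] by (auto simp: scalar_prod_def atLeast0LessThan intro!: sum.cong)
    moreover have "(adj_mat ?M * ?M) $$ (k, k') = (if k = k' then Determinant.det ?M else 0)"
      using that adj_mat(3)[OF M] by simp
    ultimately have "(\<Sum>i<n. adj_mat ?M $$ (k, i) * A i k') = (if k = k' then Determinant.det ?M else 0)"
      by metis
    hence "(\<Sum>i<n. adj_mat ?M $$ (k, i) * A i k') / Determinant.det ?M = (if k = k' then 1 else 0)"
      using assms unfolding sqdet_def by (cases "k = k'") simp_all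
    thus ?thesis by (simp add: L_def sum_divide_distrib)
  qed
  thus ?thesis using that by blast
qed

text \<open>Multiplying the system by the inverse of the limit matrix leaves a small perturbation of the
  identity, which can be absorbed on the left-hand side.\<close>

lemma solution_bigo:
  fixes A :: "'a \<Rightarrow> nat \<Rightarrow> nat \<Rightarrow> complex" and g :: "'a \<Rightarrow> complex"
  assumes A: "\<And>i k. i < n \<Longrightarrow> k < n \<Longrightarrow> ((\<lambda>x. A x i k) \<longlongrightarrow> A0 i k) F"
    and A0: "sqdet n A0 \<noteq> 0"
    and sys: "\<And>i. i < n \<Longrightarrow> \<forall>\<^sub>F x in F. (\<Sum>k<n. A x i k * y x k) = r x i"
    and r: "\<And>i. i < n \<Longrightarrow> (\<lambda>x. r x i) \<in> O[F](g)"
    and k: "k < n"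
  shows "(\<lambda>x. y x k) \<in> O[F](g)"
proof -
  obtain L where L: "\<And>k k'. k < n \<Longrightarrow> k' < n \<Longrightarrow> (\<Sum>i<n. L k i * A0 i k') = (if k = k' then 1 else 0)"
    using exists_left_inverse[OF A0] by blast
  define E where "E x k k' = (\<Sum>i<n. L k i * (A x i k' - A0 i k'))" for x k k'
  define S where "S x = (\<Sum>k<n. norm (y x k))" for x
  define T where "T x = (\<Sum>k<n. norm (\<Sum>i<n. L k i * r x i))" for x
  have "((\<lambda>x. \<Sum>k<n. \<Sum>k'<n. norm (E x k k')) \<longlongrightarrow> (\<Sum>k<n. \<Sum>k'<n. norm (\<Sum>i<n. L k i * (A0 i k' - A0 i k')))) F"
    unfolding E_def using A by (intro tendsto_sum tendsto_norm tendsto_mult tendsto_diff tendsto_const) auto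
  hence "((\<lambda>x. \<Sum>k<n. \<Sum>k'<n. norm (E x k k')) \<longlongrightarrow> 0) F" by simp
  hence small: "\<forall>\<^sub>F x in F. (\<Sum>k<n. \<Sum>k'<n. norm (E x k k')) < 1 / 2"
    by (rule order_tendstoD) simp
  have "\<forall>\<^sub>F x in F. \<forall>i\<in>{..<n}. (\<Sum>k<n. A x i k * y x k) = r x i"
    using sys by (intro eventually_ball_finite) auto
  hence main: "\<forall>\<^sub>F x in F. S x \<le> 2 * T x"
    using small
  proof eventually_elim
    case (elim x)
    have y: "y x k = (\<Sum>i<n. L k i * r x i) - (\<Sum>k'<n. E x k k' * y x k')" if k: "k < n" for k
    proof -
      have "(\<Sum>i<n. L k i * r x i) = (\<Sum>i<n. L k i * (\<Sum>k'<n. A x i k' * y x k'))"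
        using elim(1) by simp
      also have "\<dots> = (\<Sum>k'<n. (\<Sum>i<n. L k i * A x i k') * y x k')"
        unfolding sum_distrib_left sum_distrib_right by (subst sum.swap) (simp add: mult_ac)
      also have "\<dots> = (\<Sum>k'<n. (E x k k' + (if k = k' then 1 else 0)) * y x k')"
        using L[OF k] by (intro sum.cong refl) (simp add: E_def right_diff_distrib sum_subtractf)
      also have "\<dots> = (\<Sum>k'<n. E x k k' * y x k') + (\<Sum>k'<n. if k = k' then y x k' else 0)"
        unfolding sum.distrib[symmetric] by (intro sum.cong) (auto simp: distrib_right)
      also have "(\<Sum>k'<n. if k = k' then y x k' else 0) = y x k" using k by simp
      finally show ?thesis by simp
    qed
    have "norm (y x k) \<le> norm (\<Sum>i<n. L k i * r x i) + (\<Sum>k'<n. norm (E x k k')) * S x" if k: "k < n" for k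
    proof -
      have "norm (y x k) \<le> norm (\<Sum>i<n. L k i * r x i) + norm (\<Sum>k'<n. E x k k' * y x k')"
        unfolding y[OF k] by (rule norm_triangle_ineq4)
      also have "norm (\<Sum>k'<n. E x k k' * y x k') \<le> (\<Sum>k'<n. norm (E x k k') * norm (y x k'))"
        by (rule sum_norm_le) (simp add: norm_mult)
      also have "\<dots> \<le> (\<Sum>k'<n. norm (E x k k') * S x)"
        unfolding S_def by (intro sum_mono mult_left_mono member_le_sum) auto
      finally show ?thesis by (simp add: sum_distrib_right)
    qed
    hence "S x \<le> (\<Sum>k<n. norm (\<Sum>i<n. L k i * r x i) + (\<Sum>k'<n. norm (E x k k')) * S x)"
      unfolding S_def[of x] by (intro sum_mono) (auto simp: S_def)
    also have "\<dots> = T x + (\<Sum>k<n. \<Sum>k'<n. norm (E x k k')) * S x"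
      by (simp add: T_def sum.distrib sum_distrib_right)
    also have "\<dots> \<le> T x + 1 / 2 * S x"
      using elim(2) by (intro add_left_mono mult_right_mono) (auto simp: S_def sum_nonneg)
    finally show ?case by simp
  qed
  have "(\<lambda>x. \<Sum>i<n. L k i * r x i) \<in> O[F](g)" for k
    using r by (intro big_sum_in_bigo) (auto intro!: landau_o.big.mult_in_1 simp: landau_o.big.cmult_in_iff')
  hence T: "T \<in> O[F](\<lambda>x. norm (g x))"
    unfolding T_def by (intro big_sum_in_bigo) (simp add: landau_o.big.norm_iff)
  have "(\<lambda>x. norm (y x k)) \<in> O[F](T)"
  proof (rule landau_o.bigI[where c = 2])
    show "\<forall>\<^sub>F x in F. norm (norm (y x k)) \<le> 2 * norm (T x)"
      using main
    proof eventually_elim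
      case (elim x)
      have "norm (y x k) \<le> S x" unfolding S_def using k by (intro member_le_sum) auto
      moreover have "T x \<ge> 0" by (simp add: T_def sum_nonneg)
      ultimately show ?case using elim by simp
    qed
  qed simp
  also note T
  finally show ?thesis by (simp add: landau_o.big.norm_iff)
qed

text \<open>Differentiating a column of a Wronskian reproduces the next one, except for the last column, whose
  derivative is replaced by means of the equation. Rows of solutions then cancel, and the row \<open>n\<close>, which
  is arbitrary, leaves its residual. If it is also a solution, this is Abel's formula for the Wronskian;
  together the two cases give the Lagrange identity.\<close>

lemma wronskian_determinant_derivative:
  fixes G :: "nat \<Rightarrow> nat \<Rightarrow> complex \<Rightarrow> complex"
  assumes deriv: "\<And>i j. i \<le> n \<Longrightarrow> j \<le> n \<Longrightarrow> (G i j has_field_derivative G i (Suc j) x) (at x)"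
    and sol: "\<And>i. i < n \<Longrightarrow> G i (Suc n) x + (\<Sum>k\<le>n. b k * G i k x) = 0"
  shows "((\<lambda>x. sqdet (Suc n) (\<lambda>i j. G i j x)) has_field_derivative
           (G n (Suc n) x + (\<Sum>k\<le>n. b k * G n k x)) * sqdet n (\<lambda>i j. G i j x)
             - b n * sqdet (Suc n) (\<lambda>i j. G i j x)) (at x)"
proof -
  let ?A = "\<lambda>i j. G i j x"
  define r where "r i = G i (Suc n) x + (\<Sum>k\<le>n. b k * G i k x)" for i
  obtain cof where cof:
      "\<And>v. sqdet (Suc n) (\<lambda>i j. if j = n then v i else ?A i j) = (\<Sum>i\<le>n. v i * cof i)"
      "cof n = sqdet n ?A"
    using sqdet_last_column[of n ?A] by blast
  have col: "(\<Sum>i\<le>n. G i k x * cof i) = (if k = n then sqdet (Suc n) ?A else 0)" if "k \<le> n" for k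
  proof (cases "k = n")
    case True
    hence "sqdet (Suc n) (\<lambda>i j. if j = n then G i k x else ?A i j) = sqdet (Suc n) ?A"
      by (intro sqdet_cong) auto
    thus ?thesis using cof(1)[of "\<lambda>i. G i k x"] True by simp
  next
    case False
    hence "sqdet (Suc n) (\<lambda>i j. if j = n then G i k x else ?A i j) = 0"
      using that by (intro sqdet_equal_columns[of k _ n]) auto
    thus ?thesis using cof(1)[of "\<lambda>i. G i k x"] False by simp
  qed
  have "((\<lambda>x. sqdet (Suc n) (\<lambda>i j. G i j x)) has_field_derivative
      (\<Sum>k<Suc n. sqdet (Suc n) (\<lambda>i j. if j = k then G i (Suc j) x else ?A i j))) (at x)"
    using deriv by (intro sqdet_has_field_derivative) auto
  also have "(\<Sum>k<Suc n. sqdet (Suc n) (\<lambda>i j. if j = k then G i (Suc j) x else ?A i j))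
      = sqdet (Suc n) (\<lambda>i j. if j = n then G i (Suc j) x else ?A i j)"
  proof -
    have "sqdet (Suc n) (\<lambda>i j. if j = k then G i (Suc j) x else ?A i j) = 0" if "k < n" for k
      using that by (intro sqdet_equal_columns[of k _ "Suc k"]) auto
    thus ?thesis by simp
  qed
  also have "\<dots> = (\<Sum>i\<le>n. G i (Suc n) x * cof i)"
    unfolding cof(1)[symmetric] by (intro sqdet_cong) auto
  also have "\<dots> = (\<Sum>i\<le>n. r i * cof i) - (\<Sum>i\<le>n. (\<Sum>k\<le>n. b k * G i k x) * cof i)"
    unfolding sum_subtractf[symmetric] by (intro sum.cong refl) (simp add: r_def algebra_simps)
  also have "(\<Sum>i\<le>n. r i * cof i) = r n * cof n"
    using sol by (simp add: r_def flip: lessThan_Suc_atMost)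
  also have "(\<Sum>i\<le>n. (\<Sum>k\<le>n. b k * G i k x) * cof i) = (\<Sum>k\<le>n. b k * (\<Sum>i\<le>n. G i k x * cof i))"
    unfolding sum_distrib_left sum_distrib_right by (subst sum.swap) (simp add: mult_ac)
  also have "\<dots> = b n * sqdet (Suc n) ?A"
    using col by (simp add: if_distrib[of "\<lambda>c. _ * c"] cong: if_cong)
  finally show ?thesis by (simp add: r_def cof(2))
qed


section \<open>Polynomials of distinct degrees, and falling factorials\<close>

text \<open>Among the summands with nonzero coefficient, the one of largest degree cannot be cancelled.\<close>

lemma degree_combination:
  fixes q :: "'i \<Rightarrow> complex poly"
  assumes "finite I" "inj_on (\<lambda>i. Polynomial.degree (q i)) I" "\<And>i. i \<in> I \<Longrightarrow> q i \<noteq> 0"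
    and "i0 \<in> I" "c i0 \<noteq> 0"
  shows "(\<Sum>i\<in>I. Polynomial.smult (c i) (q i)) \<noteq> 0"
    and "\<exists>i\<in>I. Polynomial.degree (\<Sum>i\<in>I. Polynomial.smult (c i) (q i)) = Polynomial.degree (q i)"
proof -
  let ?Q = "\<Sum>i\<in>I. Polynomial.smult (c i) (q i)" and ?d = "\<lambda>i. Polynomial.degree (q i)"
  obtain i where i: "i \<in> I" "c i \<noteq> 0" and max: "\<And>j. j \<in> I \<Longrightarrow> c j \<noteq> 0 \<Longrightarrow> ?d j \<le> ?d i"
  proof -
    have "Max (?d ` {i \<in> I. c i \<noteq> 0}) \<in> ?d ` {i \<in> I. c i \<noteq> 0}"
      using assms by (intro Max_in) auto
    then obtain i where "i \<in> I" "c i \<noteq> 0" "?d i = Max (?d ` {i \<in> I. c i \<noteq> 0})" by auto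
    thus ?thesis using that[of i] assms(1) by auto
  qed
  have small: "Polynomial.coeff (Polynomial.smult (c j) (q j)) e = 0"
    if "j \<in> I" "e \<ge> ?d i" "e = ?d i \<longrightarrow> j \<noteq> i" for j e
  proof (cases "c j = 0")
    case False
    have "?d j \<le> ?d i" by (rule max[OF that(1) False])
    moreover have "?d j \<noteq> ?d i \<or> e \<noteq> ?d i" using that inj_onD[OF assms(2)] i by blast
    ultimately show ?thesis using that(2) by (auto intro!: coeff_eq_0)
  qed simp
  have "Polynomial.coeff ?Q (?d i) = (\<Sum>j\<in>I. Polynomial.coeff (Polynomial.smult (c j) (q j)) (?d i))"
    by (simp add: coeff_sum)
  also have "\<dots> = Polynomial.coeff (Polynomial.smult (c i) (q i)) (?d i)"
    using small i(1) assms(1) by (subst sum.remove[of _ i]) (simp_all add: sum.neutral)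
  finally have lead: "Polynomial.coeff ?Q (?d i) \<noteq> 0" using i assms(3) by simp
  thus "?Q \<noteq> 0" by auto
  have "Polynomial.degree ?Q \<le> ?d i"
    using small by (intro degree_le) (auto simp: coeff_sum intro!: sum.neutral)
  moreover have "?d i \<le> Polynomial.degree ?Q" using lead by (rule le_degree)
  ultimately show "\<exists>i\<in>I. Polynomial.degree ?Q = ?d i" using i(1) by auto
qed

lemma poly_eq_0_if_many_roots:
  fixes Q :: "complex poly"
  assumes "Polynomial.degree Q < n" "inj_on x {..<n}" "\<And>i. i < n \<Longrightarrow> poly Q (x i) = 0"
  shows "Q = 0"
proof (rule ccontr)
  assume Q: "Q \<noteq> 0"
  have "n = card (x ` {..<n})" using assms(2) by (simp add: card_image)
  also have "\<dots> \<le> card {z. poly Q z = 0}"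
    using assms(3) poly_roots_finite[OF Q] by (intro card_mono) auto
  also have "\<dots> \<le> Polynomial.degree Q" by (rule card_poly_roots_bound[OF Q])
  finally show False using assms(1) by simp
qed

text \<open>A vector in the kernel would be the coefficient vector of a nonzero polynomial of degree less than
  \<open>n\<close> with \<open>n\<close> roots.\<close>

lemma vandermonde_nonzero:
  assumes deg: "\<And>k. k < n \<Longrightarrow> Polynomial.degree (P k) = k" and nz: "\<And>k. k < n \<Longrightarrow> P k \<noteq> 0"
    and inj: "inj_on x {..<n}"
  shows "sqdet n (\<lambda>i k. poly (P k) (x i)) \<noteq> 0"
proof
  assume "sqdet n (\<lambda>i k. poly (P k) (x i)) = 0"
  then obtain c k where c: "k < n" "c k \<noteq> 0" "\<forall>i<n. (\<Sum>k<n. poly (P k) (x i) * c k) = 0"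
    unfolding sqdet_eq_0_iff by blast
  let ?Q = "\<Sum>k<n. Polynomial.smult (c k) (P k)"
  have "?Q \<noteq> 0"
    by (rule degree_combination[where ?i0.0 = k]) (use c deg nz in \<open>auto simp: inj_on_def\<close>)
  moreover have "Polynomial.degree ?Q < n"
    using c(1) deg by (intro degree_sum_less) (auto intro: le_less_trans[OF degree_smult_le])
  moreover have "poly ?Q (x i) = 0" if "i < n" for i
    using c(3) that by (simp add: poly_sum mult.commute)
  ultimately show False using poly_eq_0_if_many_roots[OF _ inj] by blast
qed

text \<open>These polynomials arise as \<open>x\<^sup>k (d/dx)\<^sup>k x\<^sup>u = u (u - 1) \<dots> (u - k + 1) x\<^sup>u\<close>.\<close>

definition falling_poly :: "nat \<Rightarrow> complex poly" where
  "falling_poly k = (\<Prod>s<k. [:- of_nat s, 1:])"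

lemma poly_falling_Suc: "poly (falling_poly (Suc k)) u = poly (falling_poly k) u * (u - of_nat k)"
  by (simp add: falling_poly_def algebra_simps)

lemma poly_falling_0 [simp]: "poly (falling_poly 0) u = 1"
  by (simp add: falling_poly_def)

lemma degree_falling_poly [simp]: "Polynomial.degree (falling_poly k) = k"
  unfolding falling_poly_def by (subst degree_prod_eq_sum_degree) auto

lemma lead_coeff_falling_poly [simp]: "Polynomial.coeff (falling_poly k) k = 1"
  using lead_coeff_prod[of "\<lambda>s. [:- of_nat s, 1 :: complex:]" "{..<k}"] degree_falling_poly[of k]
  unfolding falling_poly_def by simp

lemma falling_poly_nonzero [simp]: "falling_poly k \<noteq> 0"
  using lead_coeff_falling_poly[of k] by fastforce

lemma poly_falling_eq_0_iff: "poly (falling_poly k) (of_nat e) = 0 \<longleftrightarrow> e < k"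
  unfolding falling_poly_def by (auto simp: poly_prod)

lemma falling_vandermonde_nonzero:
  assumes "inj_on \<rho> {..<n}" "\<And>i. i < n \<Longrightarrow> c i \<noteq> 0"
  shows "sqdet n (\<lambda>i k. c i * poly (falling_poly k) (\<rho> i)) \<noteq> 0"
  using sqdet_scale[of n c "\<lambda>_. 1" "\<lambda>i k. poly (falling_poly k) (\<rho> i)"]
    vandermonde_nonzero[of n falling_poly \<rho>] assms by simp

text \<open>Fuchs' argument for regular singular points. If \<open>n\<close> solutions behave like distinct powers, the
  equations which they impose on the rescaled coefficients \<open>y\<close> have a matrix that tends to an
  invertible one of Vandermonde type.\<close>

lemma coefficients_bounded_if_solutions_like_powers:
  fixes A :: "'a \<Rightarrow> nat \<Rightarrow> nat \<Rightarrow> complex"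
  assumes inj: "inj_on \<rho> {..<n}" and c: "\<And>i. i < n \<Longrightarrow> c i \<noteq> 0"
    and lim: "\<And>i k. i < n \<Longrightarrow> k \<le> n \<Longrightarrow> ((\<lambda>x. A x i k) \<longlongrightarrow> c i * poly (falling_poly k) (\<rho> i)) F"
    and sys: "\<And>i. i < n \<Longrightarrow> \<forall>\<^sub>F x in F. A x i n + (\<Sum>k<n. A x i k * y x k) = 0"
    and k: "k < n"
  shows "(\<lambda>x. y x k) \<in> O[F](\<lambda>_. 1 :: complex)"
proof (rule solution_bigo[where A = A and r = "\<lambda>x i. - A x i n" and n = n])
  show "sqdet n (\<lambda>i k. c i * poly (falling_poly k) (\<rho> i)) \<noteq> 0"
    by (rule falling_vandermonde_nonzero[OF inj c])
  show "\<forall>\<^sub>F x in F. (\<Sum>k<n. A x i k * y x k) = - A x i n" if "i < n" for i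
    using sys[OF that] by eventually_elim (simp add: eq_neg_iff_add_eq_0 add.commute)
  show "(\<lambda>x. - A x i n) \<in> O[F](\<lambda>_. 1)" if "i < n" for i
  proof -
    have "((\<lambda>x. - A x i n) \<longlongrightarrow> - (c i * poly (falling_poly n) (\<rho> i))) F"
      using lim[OF that, of n] by (intro tendsto_minus) auto
    thus ?thesis by (intro bigoI_tendsto[where c = "- (c i * poly (falling_poly n) (\<rho> i))"]) auto
  qed
qed (use lim k in auto)

section \<open>Calculus in the coordinate \<open>t = ln x\<close>\<close>

lemma exp_ln_branch: "x \<noteq> 0 \<Longrightarrow> exp (ln_branch s x) = x"
  by (simp add: ln_branch_def exp_add)

lemma ln_branch_center [simp]: "ln_branch s (exp s) = s"
  by (simp add: ln_branch_def)

lemma nonzero_in_disc: "x \<in> ball z (norm z) \<Longrightarrow> x \<noteq> (0::complex)"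
  by auto

lemma ln_branch_shift: "exp s' = exp s \<Longrightarrow> ln_branch s x + (s' - s) = ln_branch s' x"
  by (simp add: ln_branch_def)

lemma ln_branch_has_field_derivative:
  assumes "x \<in> ball (exp s) (norm (exp s))"
  shows "(ln_branch s has_field_derivative 1 / x) (at x)"
proof -
  have "norm (1 - x / exp s) = norm (exp s - x) / norm (exp s)"
    unfolding norm_divide[symmetric] by (simp add: diff_divide_distrib)
  also have "\<dots> < 1" using assms by (simp add: dist_norm)
  finally have "Re (1 - x / exp s) < 1"
    using complex_Re_le_cmod[of "1 - x / exp s"] by linarith
  hence "x / exp s \<notin> \<real>\<^sub>\<le>\<^sub>0" by (auto simp: complex_nonpos_Reals_iff)
  thus ?thesis
    unfolding ln_branch_def using nonzero_in_disc[OF assms]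
    by (auto intro!: derivative_eq_intros simp: field_simps)
qed

lemma xderiv_funpow_Suc: "(xderiv ^^ Suc k) f t = deriv ((xderiv ^^ k) f) t / exp t"
  by (simp add: xderiv_def)

lemma holomorphic_xderiv_funpow:
  assumes "f holomorphic_on UNIV"
  shows "(xderiv ^^ k) f holomorphic_on UNIV"
proof (induction k)
  case (Suc k)
  have "(\<lambda>t. deriv ((xderiv ^^ k) f) t / exp t) holomorphic_on UNIV"
    using Suc by (intro holomorphic_intros) auto
  thus ?case by (simp add: xderiv_def[abs_def])
qed (use assms in simp)

text \<open>This is what makes \<open>xderiv\<close> the derivation \<open>d/dx\<close> on every branch.\<close>

lemma has_field_derivative_along_branch:
  assumes "f holomorphic_on UNIV" "x \<in> ball (exp s) (norm (exp s))"
  shows "((\<lambda>x. (xderiv ^^ k) f (ln_branch s x)) has_field_derivative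
           (xderiv ^^ Suc k) f (ln_branch s x)) (at x)"
proof -
  have "((xderiv ^^ k) f has_field_derivative deriv ((xderiv ^^ k) f) t) (at t)" for t
    using holomorphic_xderiv_funpow[OF assms(1), of k]
    by (intro holomorphic_derivI[of _ UNIV]) auto
  from DERIV_chain2[OF this ln_branch_has_field_derivative[OF assms(2)]]
  show ?thesis
    using exp_ln_branch[OF nonzero_in_disc[OF assms(2)]] by (simp add: xderiv_funpow_Suc del: funpow.simps)
qed

lemma holomorphic_along_branch:
  assumes "f holomorphic_on UNIV"
  shows "(\<lambda>x. (xderiv ^^ k) f (ln_branch s x)) holomorphic_on ball (exp s) (norm (exp s))"
  using has_field_derivative_along_branch[OF assms]
  by (meson holomorphic_on_open open_ball)

lemma xderiv_funpow_sum:
  assumes "\<And>i. i \<in> I \<Longrightarrow> f i holomorphic_on UNIV"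
  shows "(xderiv ^^ k) (\<lambda>t. \<Sum>i\<in>I. c i * f i t) = (\<lambda>t. \<Sum>i\<in>I. c i * (xderiv ^^ k) (f i) t)"
proof (induction k)
  case (Suc k)
  have "((\<lambda>t. \<Sum>i\<in>I. c i * (xderiv ^^ k) (f i) t) has_field_derivative
           (\<Sum>i\<in>I. c i * deriv ((xderiv ^^ k) (f i)) t)) (at t)" for t
    by (intro DERIV_sum DERIV_cmult holomorphic_derivI[of _ UNIV] holomorphic_xderiv_funpow assms) auto
  hence "deriv (\<lambda>t. \<Sum>i\<in>I. c i * (xderiv ^^ k) (f i) t) t = (\<Sum>i\<in>I. c i * deriv ((xderiv ^^ k) (f i)) t)" for t
    by (rule DERIV_imp_deriv)
  thus ?case by (intro ext) (simp add: Suc xderiv_funpow_Suc sum_divide_distrib del: funpow.simps)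
qed simp

lemma xderiv_funpow_shift:
  assumes "f holomorphic_on UNIV" "exp w = 1"
  shows "(xderiv ^^ k) (\<lambda>t. f (t + w)) = (\<lambda>t. (xderiv ^^ k) f (t + w))"
proof (induction k)
  case (Suc k)
  have "((xderiv ^^ k) f has_field_derivative deriv ((xderiv ^^ k) f) t) (at t)" for t
    using holomorphic_xderiv_funpow[OF assms(1), of k]
    by (intro holomorphic_derivI[of _ UNIV]) auto
  hence "((\<lambda>t. (xderiv ^^ k) f (t + w)) has_field_derivative deriv ((xderiv ^^ k) f) (t + w)) (at t)" for t
    by (metis DERIV_shift)
  hence "deriv (\<lambda>t. (xderiv ^^ k) f (t + w)) t = deriv ((xderiv ^^ k) f) (t + w)" for t
    by (rule DERIV_imp_deriv)
  thus ?case using assms(2) by (intro ext) (simp add: Suc xderiv_funpow_Suc exp_add del: funpow.simps)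
qed simp

lemma xderiv_funpow_power:
  "(xderiv ^^ k) (\<lambda>t. exp (u * t)) = (\<lambda>t. poly (falling_poly k) u * exp ((u - of_nat k) * t))"
proof (induction k)
  case (Suc k)
  have "deriv (\<lambda>t. poly (falling_poly k) u * exp ((u - of_nat k) * t)) t
      = poly (falling_poly k) u * ((u - of_nat k) * exp ((u - of_nat k) * t))" for t
    by (rule DERIV_imp_deriv) (auto intro!: derivative_eq_intros)
  moreover have "exp ((u - of_nat k) * t) / exp t = exp ((u - of_nat (Suc k)) * t)" for t
    by (simp add: exp_diff[symmetric] algebra_simps)
  ultimately show ?case by (intro ext) (simp add: Suc xderiv_funpow_Suc poly_falling_Suc mult.assoc del: funpow.simps of_nat_Suc flip: times_divide_eq_right)
qed simp

lemma quasi_polynomial_holomorphic: "(\<lambda>t. exp (lam * t) * poly h (exp t)) holomorphic_on UNIV"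
  by (intro holomorphic_intros)

lemma xderiv_funpow_quasi_polynomial:
  "exp t ^ k * (xderiv ^^ k) (\<lambda>t. exp (lam * t) * poly h (exp t)) t =
     exp (lam * t) * (\<Sum>a\<le>Polynomial.degree h. Polynomial.coeff h a * poly (falling_poly k) (lam + of_nat a) * exp t ^ a)"
proof -
  have "(\<lambda>t. exp (lam * t) * poly h (exp t))
      = (\<lambda>t. \<Sum>a\<le>Polynomial.degree h. Polynomial.coeff h a * exp ((lam + of_nat a) * t))"
  proof -
    have "exp ((lam + of_nat a) * t) = exp (lam * t) * exp t ^ a" for a t
      by (simp add: distrib_right exp_add exp_of_nat_mult)
    thus ?thesis by (intro ext) (simp add: poly_altdef sum_distrib_left mult_ac)
  qed
  moreover have "(\<lambda>t. exp ((lam + of_nat a) * t)) holomorphic_on UNIV" for a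
    by (intro holomorphic_intros)
  ultimately have "(xderiv ^^ k) (\<lambda>t. exp (lam * t) * poly h (exp t)) t =
     (\<Sum>a\<le>Polynomial.degree h. Polynomial.coeff h a *
        (poly (falling_poly k) (lam + of_nat a) * exp ((lam + of_nat a - of_nat k) * t)))"
    by (simp only: xderiv_funpow_sum xderiv_funpow_power)
  moreover have "exp t ^ k * (c * (p * exp ((lam + of_nat a - of_nat k) * t))) = exp (lam * t) * (c * p * exp t ^ a)"
    for c p a
  proof -
    have "exp t ^ k * exp ((lam + of_nat a - of_nat k) * t) = exp (lam * t) * exp t ^ a"
      by (simp add: exp_of_nat_mult[symmetric] exp_add[symmetric] algebra_simps)
    thus ?thesis by (simp add: mult_ac)
  qed
  ultimately show ?thesis by (simp only: sum_distrib_left)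
qed

section \<open>Local exponents\<close>

text \<open>The factorization \<open>f = (x - z)\<^sup>e h\<^sub>0\<close> at \<open>z = exp s\<close>, on the branch through \<open>s\<close>, is recorded together
  with the factorizations of all derivatives, since Wronskians involve them all. The cofactors
  satisfy the recursion \<open>h\<^sub>k\<^sub>+\<^sub>1 = (e - k) h\<^sub>k + (x - z) h\<^sub>k'\<close>.\<close>

definition root_expansion ::
  "(complex \<Rightarrow> complex) \<Rightarrow> complex \<Rightarrow> nat \<Rightarrow> (nat \<Rightarrow> complex \<Rightarrow> complex) \<Rightarrow> real \<Rightarrow> bool" where
  "root_expansion f s e h \<epsilon> \<longleftrightarrow>
     0 < \<epsilon> \<and> ball (exp s) \<epsilon> \<subseteq> ball (exp s) (norm (exp s)) \<and> h 0 (exp s) \<noteq> 0 \<and>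
     (\<forall>k. h k holomorphic_on ball (exp s) \<epsilon> \<and>
          h k (exp s) = h 0 (exp s) * poly (falling_poly k) (of_nat e) \<and>
          (\<forall>x\<in>ball (exp s) \<epsilon> - {exp s}.
             (x - exp s) ^ k * (xderiv ^^ k) f (ln_branch s x) = (x - exp s) ^ e * h k x))"

definition root_order :: "(complex \<Rightarrow> complex) \<Rightarrow> complex \<Rightarrow> nat \<Rightarrow> bool" where
  "root_order f s e \<longleftrightarrow> (\<exists>h \<epsilon>. root_expansion f s e h \<epsilon>)"

lemma root_expansion_from_factorization:
  assumes f: "f holomorphic_on UNIV" and \<epsilon>: "0 < \<epsilon>" "ball (exp s) \<epsilon> \<subseteq> ball (exp s) (norm (exp s))"
    and g: "g holomorphic_on ball (exp s) \<epsilon>" "g (exp s) \<noteq> 0"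
    and fg: "\<And>x. x \<in> ball (exp s) \<epsilon> \<Longrightarrow> f (ln_branch s x) = (x - exp s) ^ e * g x"
  shows "root_order f s e"
proof -
  define z where "z = exp s"
  define h where "h = rec_nat g (\<lambda>k hk x. (of_nat e - of_nat k) * hk x + (x - z) * deriv hk x)"
  have h0: "h 0 = g" and hSuc: "h (Suc k) = (\<lambda>x. (of_nat e - of_nat k) * h k x + (x - z) * deriv (h k) x)" for k
    by (simp_all add: h_def)
  have "h k holomorphic_on ball z \<epsilon> \<and> h k z = h 0 z * poly (falling_poly k) (of_nat e) \<and>
      (\<forall>x\<in>ball z \<epsilon> - {z}. (x - z) ^ k * (xderiv ^^ k) f (ln_branch s x) = (x - z) ^ e * h k x)" for k
  proof (induction k)
    case 0
    show ?case using g fg by (simp add: h0 z_def)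
  next
    case (Suc k)
    note IH = Suc
    have hol: "h (Suc k) holomorphic_on ball z \<epsilon>"
      unfolding hSuc using IH by (intro holomorphic_intros) auto
    have val: "h (Suc k) z = h 0 z * poly (falling_poly (Suc k)) (of_nat e)"
      using IH by (simp add: hSuc poly_falling_Suc mult_ac)
    have "(x - z) ^ Suc k * (xderiv ^^ Suc k) f (ln_branch s x) = (x - z) ^ e * h (Suc k) x"
      if x: "x \<in> ball z \<epsilon> - {z}" for x
    proof -
      let ?F = "\<lambda>k x. (xderiv ^^ k) f (ln_branch s x)"
      have F': "(?F k has_field_derivative ?F (Suc k) x) (at x)"
        by (rule has_field_derivative_along_branch[OF f]) (use x \<epsilon>(2) in \<open>auto simp: z_def\<close>)
      have hk': "(h k has_field_derivative deriv (h k) x) (at x)"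
        using IH x by (intro holomorphic_derivI[of _ "ball z \<epsilon>"]) auto
      have pow: "((\<lambda>x. (x - z) ^ j) has_field_derivative of_nat j * (x - z) ^ (j - 1)) (at x)" for j
        by (auto intro!: derivative_eq_intros)
      have L: "((\<lambda>x. (x - z) ^ k * ?F k x) has_field_derivative
          of_nat k * (x - z) ^ (k - 1) * ?F k x + ?F (Suc k) x * (x - z) ^ k) (at x)"
        by (rule DERIV_mult[OF pow F'])
      have R: "((\<lambda>x. (x - z) ^ e * h k x) has_field_derivative
          of_nat e * (x - z) ^ (e - 1) * h k x + deriv (h k) x * (x - z) ^ e) (at x)"
        by (rule DERIV_mult[OF pow hk'])
      have ev: "\<forall>\<^sub>F x in nhds x. (x - z) ^ k * ?F k x = (x - z) ^ e * h k x"
        using IH x by (intro eventually_nhds_in_open[of "ball z \<epsilon> - {z}", THEN eventually_mono]) auto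
      have "of_nat k * (x - z) ^ (k - 1) * ?F k x + ?F (Suc k) x * (x - z) ^ k
          = of_nat e * (x - z) ^ (e - 1) * h k x + deriv (h k) x * (x - z) ^ e"
        by (rule DERIV_unique[OF DERIV_cong_ev[OF refl ev refl, THEN iffD1, OF L] R])
      \<comment> \<open>The factor \<open>x - z\<close> turns the powers \<open>k - 1\<close> and \<open>e - 1\<close> into \<open>k\<close> and \<open>e\<close>, also where the
         exponent \<open>0 - 1\<close> is truncated.\<close>
      from arg_cong[OF this, of "\<lambda>y. (x - z) * y"]
      have X: "of_nat k * ((x - z) * (x - z) ^ (k - 1)) * ?F k x + (x - z) ^ Suc k * ?F (Suc k) x
          = of_nat e * ((x - z) * (x - z) ^ (e - 1)) * h k x + (x - z) ^ e * ((x - z) * deriv (h k) x)"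
        by (simp only: distrib_left power_Suc mult_ac)
      have P: "of_nat j * ((x - z) * (x - z) ^ (j - 1)) = of_nat j * (x - z) ^ j" for j :: nat
        by (cases j) auto
      have "(x - z) ^ Suc k * ?F (Suc k) x
          = of_nat e * (x - z) ^ e * h k x + (x - z) ^ e * ((x - z) * deriv (h k) x)
            - of_nat k * ((x - z) ^ k * ?F k x)"
        using X[unfolded P] by (simp only: mult.assoc eq_diff_eq add.commute)
      also have "(x - z) ^ k * ?F k x = (x - z) ^ e * h k x" using IH x by blast
      finally show ?thesis by (simp add: hSuc algebra_simps)
    qed
    thus ?case using hol val by blast
  qed
  moreover have "h 0 z \<noteq> 0" using g(2) by (simp add: h0 z_def)
  ultimately have "root_expansion f s e h \<epsilon>"
    unfolding root_expansion_def z_def[symmetric] using \<epsilon>[folded z_def] by blast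
  thus ?thesis by (auto simp: root_order_def)
qed

lemma entire_eq_0_if_branch_eq_0:
  assumes f: "f holomorphic_on UNIV" and 0: "\<And>x. x \<in> ball (exp s) (norm (exp s)) \<Longrightarrow> f (ln_branch s x) = 0"
  shows "f = (\<lambda>_. 0)"
proof -
  have "open (exp -` ball (exp s) (norm (exp s)) \<inter> ball s 1)"
    by (intro open_Int open_vimage) (auto intro!: continuous_intros)
  moreover have "s \<in> exp -` ball (exp s) (norm (exp s)) \<inter> ball s 1" by simp
  ultimately obtain \<delta> where \<delta>: "\<delta> > 0" "ball s \<delta> \<subseteq> exp -` ball (exp s) (norm (exp s)) \<inter> ball s 1"
    by (meson open_contains_ball)
  have "f t = 0" if t: "t \<in> ball s \<delta>" for t
  proof -
    have "\<bar>Im (t - s)\<bar> \<le> norm (t - s)" by (rule abs_Im_le_cmod)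
    also have "\<dots> < 1" using t \<delta>(2) by (auto simp: dist_norm norm_minus_commute)
    finally have "\<bar>Im (t - s)\<bar> < pi" using pi_gt3 by linarith
    hence "ln_branch s (exp t) = t"
      by (simp add: ln_branch_def exp_diff[symmetric] Ln_exp)
    thus ?thesis using 0[of "exp t"] t \<delta>(2) by auto
  qed
  hence "f t = 0" for t
    using analytic_continuation_open[of "ball s \<delta>" UNIV f "\<lambda>_. 0" t] f \<delta>(1) by auto
  thus ?thesis by auto
qed

lemma zorder_root_order:
  assumes f: "f holomorphic_on UNIV" "f \<noteq> (\<lambda>_. 0)"
  obtains e where "zorder (\<lambda>x. f (ln_branch s x)) (exp s) = int e" "root_order f s e"
proof -
  let ?F = "\<lambda>x. f (ln_branch s x)" and ?D = "ball (exp s) (norm (exp s))"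
  have "?F holomorphic_on ?D" using holomorphic_along_branch[OF f(1), of 0] by simp
  moreover have "\<exists>w\<in>?D. ?F w \<noteq> 0" using entire_eq_0_if_branch_eq_0[OF f(1)] f(2) by blast
  ultimately obtain r where
      n: "if ?F (exp s) = 0 then zorder ?F (exp s) > 0 else zorder ?F (exp s) = 0"
    and r: "r > 0" "cball (exp s) r \<subseteq> ?D" "zor_poly ?F (exp s) holomorphic_on cball (exp s) r"
      "\<forall>w\<in>cball (exp s) r. ?F w = zor_poly ?F (exp s) w * (w - exp s) ^ nat (zorder ?F (exp s))
          \<and> zor_poly ?F (exp s) w \<noteq> 0"
    using zorder_exist_zero[of ?F ?D "exp s"] by auto
  define e where "e = nat (zorder ?F (exp s))"
  have e: "zorder ?F (exp s) = int e" using n by (auto simp: e_def split: if_splits)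
  have "root_order f s e"
  proof (rule root_expansion_from_factorization[OF f(1) r(1)])
    show "ball (exp s) r \<subseteq> ?D" using r(2) ball_subset_cball by blast
    show "zor_poly ?F (exp s) holomorphic_on ball (exp s) r"
      using r(3) ball_subset_cball by (rule holomorphic_on_subset)
  qed (use r in \<open>auto simp: e_def\<close>)
  with e that show ?thesis by blast
qed

lemma root_order_tendsto:
  assumes "root_order f s e"
  obtains c where "c \<noteq> 0"
    "\<And>k. ((\<lambda>x. (x - exp s) ^ k * (xderiv ^^ k) f (ln_branch s x) / (x - exp s) ^ e)
            \<longlongrightarrow> c * poly (falling_poly k) (of_nat e)) (at (exp s))"
proof -
  obtain h \<epsilon> where h: "root_expansion f s e h \<epsilon>" using assms by (auto simp: root_order_def)
  let ?z = "exp s"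
  have \<epsilon>: "\<epsilon> > 0" and hol: "h k holomorphic_on ball ?z \<epsilon>"
    and val: "h k ?z = h 0 ?z * poly (falling_poly k) (of_nat e)"
    and eq: "x \<in> ball ?z \<epsilon> - {?z} \<Longrightarrow> (x - ?z) ^ k * (xderiv ^^ k) f (ln_branch s x) = (x - ?z) ^ e * h k x" for k x
    using h unfolding root_expansion_def by blast+
  have "((\<lambda>x. (x - ?z) ^ k * (xderiv ^^ k) f (ln_branch s x) / (x - ?z) ^ e) \<longlongrightarrow> h 0 ?z * poly (falling_poly k) (of_nat e)) (at ?z)" for k
  proof -
    have "isCont (h k) ?z"
      using holomorphic_on_imp_continuous_on[OF hol, THEN continuous_on_interior] \<epsilon> by simp
    hence "(h k \<longlongrightarrow> h 0 ?z * poly (falling_poly k) (of_nat e)) (at ?z)"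
      by (metis isCont_def val)
    moreover have "\<forall>\<^sub>F x in at ?z. h k x = (x - ?z) ^ k * (xderiv ^^ k) f (ln_branch s x) / (x - ?z) ^ e"
    proof -
      have "\<forall>\<^sub>F x in at ?z. x \<in> ball ?z \<epsilon> - {?z}"
        using \<epsilon> by (intro eventually_at_in_open) auto
      thus ?thesis
        by eventually_elim (use eq in \<open>auto simp: field_simps\<close>)
    qed
    ultimately show ?thesis by (rule Lim_transform_eventually)
  qed
  moreover have "h 0 ?z \<noteq> 0" using h unfolding root_expansion_def by blast
  ultimately show ?thesis using that by blast
qed

lemma tendsto_along_branch:
  assumes "f holomorphic_on UNIV"
  shows "((\<lambda>x. (xderiv ^^ k) f (ln_branch s x)) \<longlongrightarrow> (xderiv ^^ k) f s) (at (exp s))"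
proof -
  have "isCont (\<lambda>x. (xderiv ^^ k) f (ln_branch s x)) (exp s)"
    using has_field_derivative_along_branch[OF assms, of "exp s" s k] DERIV_isCont by simp
  thus ?thesis by (simp add: isCont_def)
qed

lemma root_order_derivatives:
  assumes f: "f holomorphic_on UNIV" and e: "root_order f s e"
  shows "k < e \<Longrightarrow> (xderiv ^^ k) f s = 0" and "(xderiv ^^ e) f s \<noteq> 0"
proof -
  let ?z = "exp s"
  obtain c where c: "c \<noteq> 0"
    "\<And>k. ((\<lambda>x. (x - ?z) ^ k * (xderiv ^^ k) f (ln_branch s x) / (x - ?z) ^ e)
            \<longlongrightarrow> c * poly (falling_poly k) (of_nat e)) (at ?z)"
    using root_order_tendsto[OF e] by blast
  have ne: "\<forall>\<^sub>F x in at ?z. x \<noteq> ?z" by (rule eventually_neq_at_within)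
  have lim: "((\<lambda>x. (xderiv ^^ k) f (ln_branch s x)) \<longlongrightarrow> 0 ^ (e - k) * (c * poly (falling_poly k) (of_nat e))) (at ?z)"
    if "k \<le> e" for k
  proof -
    have "((\<lambda>x. (x - ?z) ^ (e - k) * ((x - ?z) ^ k * (xderiv ^^ k) f (ln_branch s x) / (x - ?z) ^ e))
        \<longlongrightarrow> (?z - ?z) ^ (e - k) * (c * poly (falling_poly k) (of_nat e))) (at ?z)"
      by (intro tendsto_mult tendsto_power tendsto_diff tendsto_const tendsto_ident_at c(2))
    moreover have "\<forall>\<^sub>F x in at ?z. (x - ?z) ^ (e - k) * ((x - ?z) ^ k * (xderiv ^^ k) f (ln_branch s x) / (x - ?z) ^ e)
        = (xderiv ^^ k) f (ln_branch s x)"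
      using ne
    proof eventually_elim
      case (elim x)
      have "(x - ?z) ^ (e - k) * (x - ?z) ^ k = (x - ?z) ^ e"
        using that by (simp add: power_add[symmetric])
      thus ?case using elim by (simp add: mult.assoc[symmetric])
    qed
    ultimately show ?thesis by (simp add: Lim_transform_eventually)
  qed
  have "(xderiv ^^ k) f s = 0 ^ (e - k) * (c * poly (falling_poly k) (of_nat e))" if "k \<le> e" for k
    using tendsto_unique[OF _ tendsto_along_branch[OF f, of k s] lim[OF that]] by simp
  thus "k < e \<Longrightarrow> (xderiv ^^ k) f s = 0" and "(xderiv ^^ e) f s \<noteq> 0"
    using c(1) by (auto simp: poly_falling_eq_0_iff)
qed

lemma sqdet_triangular_nonzero:
  assumes "\<And>i k. i < n \<Longrightarrow> k < i \<Longrightarrow> A i k = 0" "\<And>i. i < n \<Longrightarrow> A i i \<noteq> 0"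
  shows "sqdet n A \<noteq> 0"
proof -
  have "upper_triangular (Matrix.mat n n (\<lambda>(i, j). A i j))"
    using assms(1) by (auto simp: upper_triangular_def)
  hence "sqdet n A = prod_list (diag_mat (Matrix.mat n n (\<lambda>(i, j). A i j)))"
    unfolding sqdet_def by (rule det_upper_triangular) auto
  thus ?thesis using assms(2) by (auto simp: prod_list_zero_iff diag_mat_def)
qed

text \<open>After division of the rows by \<open>(x - z)\<^bsup>e i\<^esup>\<close> and multiplication of the columns by \<open>(x - z)\<^sup>k\<close>, the Wronskian matrix
  tends to one of Vandermonde type. Hence the multiplicity of the Wronskian is the sum of the \<open>e i\<close>
  minus \<open>0 + 1 + \<dots> + (n - 1)\<close>.\<close>

lemma wronskian_tendsto:
  assumes e: "\<And>i. i < n \<Longrightarrow> root_order (f i) s (e i)" and inj: "inj_on e {..<n}"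
  obtains c where "c \<noteq> 0"
    "((\<lambda>x. sqdet n (\<lambda>i k. (xderiv ^^ k) (f i) (ln_branch s x)) * (x - exp s) ^ (\<Sum>k<n. k)
         / (x - exp s) ^ (\<Sum>i<n. e i)) \<longlongrightarrow> c) (at (exp s))"
proof -
  let ?z = "exp s"
  have "\<exists>c. c \<noteq> 0 \<and> (\<forall>k. ((\<lambda>x. (x - ?z) ^ k * (xderiv ^^ k) (f i) (ln_branch s x) / (x - ?z) ^ e i)
            \<longlongrightarrow> c * poly (falling_poly k) (of_nat (e i))) (at ?z))" if "i < n" for i
    by (rule root_order_tendsto[OF e[OF that]]) blast
  then have "\<exists>c. \<forall>i<n. c i \<noteq> 0 \<and> (\<forall>k. ((\<lambda>x. (x - ?z) ^ k * (xderiv ^^ k) (f i) (ln_branch s x) / (x - ?z) ^ e i)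
            \<longlongrightarrow> c i * poly (falling_poly k) (of_nat (e i))) (at ?z))"
    by (subst choice_iff[symmetric]) blast
  then obtain c where c: "\<And>i. i < n \<Longrightarrow> c i \<noteq> 0"
    "\<And>i k. i < n \<Longrightarrow> ((\<lambda>x. (x - ?z) ^ k * (xderiv ^^ k) (f i) (ln_branch s x) / (x - ?z) ^ e i)
            \<longlongrightarrow> c i * poly (falling_poly k) (of_nat (e i))) (at ?z)"
    by blast
  have "((\<lambda>x. sqdet n (\<lambda>i k. (x - ?z) ^ k * (xderiv ^^ k) (f i) (ln_branch s x) / (x - ?z) ^ e i))
      \<longlongrightarrow> sqdet n (\<lambda>i k. c i * poly (falling_poly k) (of_nat (e i)))) (at ?z)"
    using c(2) by (intro tendsto_sqdet) auto
  moreover have "sqdet n (\<lambda>i k. (x - ?z) ^ k * (xderiv ^^ k) (f i) (ln_branch s x) / (x - ?z) ^ e i)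
      = sqdet n (\<lambda>i k. (xderiv ^^ k) (f i) (ln_branch s x)) * (x - ?z) ^ (\<Sum>k<n. k) / (x - ?z) ^ (\<Sum>i<n. e i)" for x
  proof -
    have "(\<Prod>i<n. 1 / (x - ?z) ^ e i) = 1 / (x - ?z) ^ (\<Sum>i<n. e i)"
      and "(\<Prod>k<n. (x - ?z) ^ k) = (x - ?z) ^ (\<Sum>k<n. k)"
      by (simp_all add: power_sum prod_dividef)
    thus ?thesis
      using sqdet_scale[of n "\<lambda>i. 1 / (x - ?z) ^ e i" "\<lambda>k. (x - ?z) ^ k"
          "\<lambda>i k. (xderiv ^^ k) (f i) (ln_branch s x)"] by simp
  qed
  moreover have "sqdet n (\<lambda>i k. c i * poly (falling_poly k) (of_nat (e i))) \<noteq> 0"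
    using inj c(1) by (intro falling_vandermonde_nonzero) (auto simp: inj_on_def)
  ultimately show ?thesis using that by simp
qed


section \<open>Finite-dimensional spaces of entire functions of \<open>ln x\<close>\<close>

lemma sum_fun_apply: "(\<Sum>i\<in>I. F i) t = (\<Sum>i\<in>I. F i t)"
  for F :: "'i \<Rightarrow> complex \<Rightarrow> complex"
  by (induction I rule: infinite_finite_induct) simp_all

text \<open>The dimension enters as an upper bound only; independence of given elements always comes from a
  Wronskian which does not vanish. Invariance under \<open>shift\<close> is invariance under the monodromy.\<close>

locale function_space =
  fixes d :: nat and V :: "(complex \<Rightarrow> complex) set"
  assumes subspace: "cfun.subspace V"
    and entire: "f \<in> V \<Longrightarrow> f holomorphic_on UNIV"
    and shift: "f \<in> V \<Longrightarrow> exp w = 1 \<Longrightarrow> (\<lambda>t. f (t + w)) \<in> V"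
    and spanned: "\<exists>S. finite S \<and> card S \<le> d \<and> V \<subseteq> cfun.span S"
begin

lemma combination_in_space:
  assumes "\<And>i. i \<in> I \<Longrightarrow> f i \<in> V"
  shows "(\<lambda>t. \<Sum>i\<in>I. c i * f i t) \<in> V"
proof -
  have "(\<Sum>i\<in>I. (\<lambda>t. c i * f i t)) \<in> V"
    using assms subspace by (intro cfun.subspace_sum cfun.subspace_scale) auto
  moreover have "(\<Sum>i\<in>I. (\<lambda>t. c i * f i t)) = (\<lambda>t. \<Sum>i\<in>I. c i * f i t)"
    by (rule ext) (simp add: sum_fun_apply)
  ultimately show ?thesis by simp
qed

text \<open>An exponent may be witnessed on any branch, but the monodromy preserves the space.\<close>

lemma exponent_root_order:
  assumes "e \<in> exponents V (exp s)"
  obtains f where "f \<in> V" "root_order f s e"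
proof -
  obtain f s' where f: "f \<in> V" "f \<noteq> 0" "exp s' = exp s" "zorder (\<lambda>x. f (ln_branch s' x)) (exp s) = int e"
    using assms by (auto simp: exponents_def)
  define g where "g = (\<lambda>t. f (t + (s' - s)))"
  have g: "g \<in> V" unfolding g_def using f by (intro shift) (auto simp: exp_diff)
  have "f = (\<lambda>_. 0)" if "g = (\<lambda>_. 0)"
  proof
    fix t show "f t = 0" using fun_cong[OF that, of "t - (s' - s)"] by (simp add: g_def)
  qed
  hence "g \<noteq> (\<lambda>_. 0)" using f(2) by (auto simp: zero_fun_def)
  then obtain e' where e': "zorder (\<lambda>x. g (ln_branch s x)) (exp s) = int e'" "root_order g s e'"
    using zorder_root_order[OF entire[OF g]] by metis
  moreover have "g (ln_branch s x) = f (ln_branch s' x)" for x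
    unfolding g_def using ln_branch_shift[OF f(3)] by simp
  ultimately have "e' = e" using f(4) by simp
  thus ?thesis using that g e' by blast
qed

lemma large_exponent_if_derivatives_vanish:
  assumes f: "f \<in> V" "f \<noteq> (\<lambda>_. 0)" and 0: "\<And>k. k < j \<Longrightarrow> (xderiv ^^ k) f s = 0"
  shows "\<exists>e\<ge>j. e \<in> exponents V (exp s)"
proof -
  obtain e where e: "zorder (\<lambda>x. f (ln_branch s x)) (exp s) = int e" "root_order f s e"
    using zorder_root_order[OF entire[OF f(1)] f(2)] by metis
  have "e \<in> exponents V (exp s)"
    unfolding exponents_def using e(1) f by (auto simp: zero_fun_def)
  moreover have "e \<ge> j"
    using root_order_derivatives(2)[OF entire[OF f(1)] e(2)] 0 by (meson not_le_imp_less)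
  ultimately show ?thesis by blast
qed

lemma basis_if_wronskian_nonzero:
  assumes f: "\<And>i. i \<in> {1..d} \<Longrightarrow> f i \<in> V" and W: "wronskian d f t \<noteq> 0"
  shows "basis_of d f V"
proof -
  have W': "sqdet d (\<lambda>k i. (xderiv ^^ k) (f (Suc i)) t) \<noteq> 0"
    using W by (simp add: wronskian_eq_sqdet sqdet_transpose[of d "\<lambda>i k. (xderiv ^^ k) (f (Suc i)) t"])
  have indep: "\<forall>i\<in>{1..d}. c i = 0" if "(\<lambda>t. \<Sum>i=1..d. c i * f i t) = (\<lambda>_. 0)" for c
  proof (rule ccontr)
    assume "\<not> ?thesis"
    then obtain i where i: "i \<in> {1..d}" "c i \<noteq> 0" by blast
    have "(xderiv ^^ k) (\<lambda>_. 0) = (\<lambda>_. 0)" for k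
      using xderiv_funpow_sum[of "{} :: nat set" f k c] by simp
    hence "(\<Sum>i=1..d. c i * (xderiv ^^ k) (f i) t) = 0" for k
      using xderiv_funpow_sum[of "{1..d}" f k c] that entire f by (metis (no_types, lifting))
    moreover have "(\<Sum>i=1..d. c i * (xderiv ^^ k) (f i) t) = (\<Sum>i<d. (xderiv ^^ k) (f (Suc i)) t * c (Suc i))" for k
      by (rule sum.reindex_bij_witness[of _ Suc "\<lambda>i. i - 1"]) auto
    ultimately have "\<forall>k<d. (\<Sum>i<d. (xderiv ^^ k) (f (Suc i)) t * c (Suc i)) = 0" by simp
    moreover have "\<exists>j<d. c (Suc j) \<noteq> 0" using i by (intro exI[of _ "i - 1"]) auto
    ultimately have "sqdet d (\<lambda>k i. (xderiv ^^ k) (f (Suc i)) t) = 0"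
      unfolding sqdet_eq_0_iff by (intro exI[of _ "\<lambda>i. c (Suc i)"]) blast
    with W' show False by contradiction
  qed
  have inj: "inj_on f {1..d}"
  proof (rule inj_onI, rule ccontr)
    fix i j assume ij: "i \<in> {1..d}" "j \<in> {1..d}" "f i = f j" "i \<noteq> j"
    define c where "c k = (if k = i then 1 else if k = j then - 1 else 0 :: complex)" for k
    have "(\<Sum>k=1..d. c k * f k t) = 0" for t
    proof -
      have "(\<Sum>k=1..d. c k * f k t) = (\<Sum>k\<in>{i, j}. c k * f k t)"
        using ij by (intro sum.mono_neutral_right) (auto simp: c_def)
      thus ?thesis using ij by (simp add: c_def)
    qed
    from indep[OF ext[OF this]] ij(1) have "c i = 0" by blast
    thus False by (simp add: c_def)
  qed
  have ind: "cfun.independent (f ` {1..d})"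
  proof (rule cfun.independent_if_scalars_zero)
    fix c g assume "(\<Sum>x\<in>f ` {1..d}. (\<lambda>t. c x * x t)) = 0" and g: "g \<in> f ` {1..d}"
    hence "(\<Sum>i=1..d. (\<lambda>t. c (f i) * f i t)) = 0"
      unfolding sum.reindex[OF inj] by (simp only: comp_def)
    hence "(\<lambda>t. \<Sum>i=1..d. c (f i) * f i t) = (\<lambda>_. 0)"
      by (simp add: fun_eq_iff sum_fun_apply)
    from indep[OF this] g show "c g = 0" by auto
  qed simp
  have "V \<subseteq> cfun.span (f ` {1..d})"
  proof (rule ccontr)
    assume "\<not> ?thesis"
    then obtain g where g: "g \<in> V" "g \<notin> cfun.span (f ` {1..d})" by blast
    have "cfun.independent (insert g (f ` {1..d}))" using ind g(2) by (simp add: cfun.independent_insert)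
    moreover obtain S where S: "finite S" "card S \<le> d" "V \<subseteq> cfun.span S" using spanned by blast
    moreover have "insert g (f ` {1..d}) \<subseteq> cfun.span S" using f g(1) S(3) by auto
    ultimately have "card (insert g (f ` {1..d})) \<le> card S"
      using cfun.independent_span_bound[of S "insert g (f ` {1..d})"] by simp
    moreover have "g \<notin> f ` {1..d}" 
      by (rule contra_subsetD[OF cfun.span_superset g(2)])
    hence "card (insert g (f ` {1..d})) = Suc d" using card_image[OF inj] by simp
    ultimately show False using S(2) by simp
  qed
  moreover have "cfun.span (f ` {1..d}) \<subseteq> V"
    using f subspace by (intro cfun.span_minimal) auto
  ultimately show ?thesis unfolding basis_of_def using inj ind by simp
qed

text \<open>A zero of the Wronskian at \<open>t\<close> would give a nonzero element of \<open>V\<close> with a root of multiplicity at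
  least \<open>d\<close>, which does not exist at a regular point.\<close>

lemma wronskian_nonzero_if_basis:
  assumes g: "basis_of d g V" and t: "exp t \<notin> singular_points d V"
  shows "wronskian d g t \<noteq> 0"
proof
  assume "wronskian d g t = 0"
  hence "sqdet d (\<lambda>k i. (xderiv ^^ k) (g (Suc i)) t) = 0"
    by (simp add: wronskian_eq_sqdet sqdet_transpose[of d "\<lambda>i k. (xderiv ^^ k) (g (Suc i)) t"])
  then obtain c j where c: "j < d" "c j \<noteq> 0" "\<forall>k<d. (\<Sum>i<d. (xderiv ^^ k) (g (Suc i)) t * c i) = 0"
    unfolding sqdet_eq_0_iff by blast
  have gV: "g (Suc i) \<in> V" if "i < d" for i
    using g that cfun.span_base by (fastforce simp: basis_of_def)
  define h where "h = (\<lambda>t. \<Sum>i<d. c i * g (Suc i) t)"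
  have h: "h \<in> V" unfolding h_def using gV by (intro combination_in_space) auto
  have "(xderiv ^^ k) h t = 0" if "k < d" for k
    unfolding h_def using c(3) that gV entire by (subst xderiv_funpow_sum) (auto simp: mult.commute)
  moreover have "h \<noteq> (\<lambda>_. 0)"
  proof
    assume "h = (\<lambda>_. 0)"
    moreover have "(\<Sum>i=1..d. c (i - 1) * g i t) = h t" for t
      unfolding h_def by (rule sum.reindex_bij_witness[of _ Suc "\<lambda>i. i - 1"]) auto
    ultimately have zero: "(\<Sum>i=1..d. (\<lambda>t. c (i - 1) * g i t)) = 0"
      by (intro ext) (simp add: sum_fun_apply)
    have inj: "inj_on g {1..d}" and ind: "cfun.independent (g ` {1..d})"
      using g unfolding basis_of_def by blast+
    let ?c = "\<lambda>x. c (inv_into {1..d} g x - 1)"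
    have "(\<Sum>x\<in>g ` {1..d}. (\<lambda>t. ?c x * x t)) = (\<Sum>i=1..d. (\<lambda>t. c (i - 1) * g i t))"
      unfolding sum.reindex[OF inj] by (intro sum.cong refl) (simp only: comp_def inv_into_f_f[OF inj])
    also note zero
    finally have "?c (g (Suc j)) = 0"
      using cfun.independentD[OF ind _ order_refl, of ?c "g (Suc j)"] c(1) by simp
    moreover have "?c (g (Suc j)) = c j"
      by (subst inv_into_f_f[OF inj]) (use c(1) in auto)
    ultimately show False using c(2) by simp
  qed
  ultimately obtain e where "e \<ge> d" "e \<in> exponents V (exp t)"
    using large_exponent_if_derivatives_vanish[OF h] by blast
  moreover have "exponents V (exp t) = {..<d}" using t by (simp add: singular_points_def)
  ultimately show False by (metis lessThan_iff not_le)
qed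

text \<open>At a regular point \<open>V\<close> has elements of the multiplicities \<open>0, \<dots>, d - 1\<close>, and the matrix of their
  derivatives is triangular.\<close>

lemma derivatives_separate:
  assumes t: "exp t \<notin> singular_points d V" and y: "\<And>f. f \<in> V \<Longrightarrow> (\<Sum>k<d. y k * (xderiv ^^ k) f t) = 0"
    and k: "k < d"
  shows "y k = 0"
proof -
  have E: "exponents V (exp t) = {..<d}" using t by (auto simp: singular_points_def)
  have "\<exists>f. f \<in> V \<and> root_order f t i" if "i < d" for i
    using exponent_root_order[of i t] that unfolding E by (metis lessThan_iff)
  then obtain f where f: "\<And>i. i < d \<Longrightarrow> f i \<in> V \<and> root_order (f i) t i" by metis
  have "sqdet d (\<lambda>i k. (xderiv ^^ k) (f i) t) \<noteq> 0"
  proof (rule sqdet_triangular_nonzero)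
    fix i assume i: "i < d"
    show "(xderiv ^^ i) (f i) t \<noteq> 0"
      using f[OF i] entire root_order_derivatives(2) by blast
    show "(xderiv ^^ k) (f i) t = 0" if "k < i" for k
      using f[OF i] entire root_order_derivatives(1)[OF _ _ that] by blast
  qed
  moreover have "\<forall>i<d. (\<Sum>k<d. (xderiv ^^ k) (f i) t * y k) = 0"
    using f y by (simp add: mult.commute)
  ultimately show ?thesis using k unfolding sqdet_eq_0_iff by blast
qed

end

section \<open>Fuchsian coefficients are polynomials\<close>

lemma power_ratio_tendsto_at_infinity:
  fixes n :: nat
  assumes "a \<le> n"
  shows "((\<lambda>x::complex. x ^ a / x ^ n) \<longlongrightarrow> (if a = n then 1 else 0)) at_infinity"
proof -
  have lim: "((\<lambda>x::complex. inverse x ^ (n - a)) \<longlongrightarrow> 0 ^ (n - a)) at_infinity"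
    by (intro tendsto_power tendsto_inverse_0)
  have ev: "\<forall>\<^sub>F x::complex in at_infinity. inverse x ^ (n - a) = x ^ a / x ^ n"
    using eventually_not_equal_at_infinity[of 0]
    by eventually_elim (use assms in \<open>simp add: power_diff power_inverse field_simps\<close>)
  have "0 ^ (n - a) = (if a = n then 1 else 0 :: complex)" using assms by auto
  with Lim_transform_eventually[OF lim ev] show ?thesis by simp
qed

lemma polynomial_sum_tendsto_at_infinity:
  "((\<lambda>x::complex. (\<Sum>a\<le>n. c a * x ^ a) / x ^ n) \<longlongrightarrow> c n) at_infinity"
proof -
  have "((\<lambda>x::complex. \<Sum>a\<le>n. c a * (x ^ a / x ^ n)) \<longlongrightarrow> (\<Sum>a\<le>n. c a * (if a = n then 1 else 0))) at_infinity"
    by (intro tendsto_sum tendsto_mult tendsto_const power_ratio_tendsto_at_infinity) auto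
  moreover have "(\<Sum>a\<le>n. c a * (if a = n then 1 else 0)) = c n"
    by (simp add: if_distrib[of "\<lambda>y. c _ * y"] cong: if_cong)
  ultimately show ?thesis by (simp add: sum_divide_distrib)
qed

lemma polynomial_sum_tendsto_at_0:
  fixes c :: "nat \<Rightarrow> complex"
  assumes "r \<le> n" "\<And>a. a < r \<Longrightarrow> c a = 0"
  shows "((\<lambda>x. (\<Sum>a\<le>n. c a * x ^ a) / x ^ r) \<longlongrightarrow> c r) (at 0)"
proof -
  have lim: "((\<lambda>x. \<Sum>a\<le>n. c a * x ^ (a - r)) \<longlongrightarrow> (\<Sum>a\<le>n. c a * 0 ^ (a - r))) (at 0)"
    by (intro tendsto_sum tendsto_mult tendsto_const tendsto_power tendsto_ident_at)
  have ev: "\<forall>\<^sub>F x::complex in at 0. (\<Sum>a\<le>n. c a * x ^ (a - r)) = (\<Sum>a\<le>n. c a * x ^ a) / x ^ r"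
    using eventually_neq_at_within[of 0]
  proof eventually_elim
    case (elim x)
    have "c a * x ^ (a - r) = c a * x ^ a / x ^ r" for a
      using elim assms(2)[of a] by (cases "a < r") (simp_all add: power_diff)
    thus ?case by (simp add: sum_divide_distrib)
  qed
  have "(\<Sum>a\<le>n. c a * 0 ^ (a - r)) = c r"
  proof -
    have "(\<Sum>a\<le>n. c a * 0 ^ (a - r)) = (\<Sum>a\<in>{r}. c a * 0 ^ (a - r))"
      using assms by (intro sum.mono_neutral_right) (auto simp: zero_power)
    thus ?thesis by simp
  qed
  with Lim_transform_eventually[OF lim ev] show ?thesis by simp
qed

lemma poly_tendsto_at_infinity:
  fixes p :: "complex poly"
  assumes "Polynomial.degree p \<le> n"
  shows "((\<lambda>x. poly p x / x ^ n) \<longlongrightarrow> Polynomial.coeff p n) at_infinity"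
proof -
  have "poly p x = (\<Sum>a\<le>n. Polynomial.coeff p a * x ^ a)" for x
    unfolding poly_altdef using assms by (intro sum.mono_neutral_left) (auto simp: coeff_eq_0)
  thus ?thesis using polynomial_sum_tendsto_at_infinity[of "Polynomial.coeff p" n] by simp
qed

lemma eventually_at_not_in_finite:
  fixes S :: "complex set"
  assumes "finite S"
  shows "\<forall>\<^sub>F x in at z. x \<notin> S"
proof -
  have "open (- (S - {z}))" using assms by (intro open_Compl finite_imp_closed) auto
  hence "\<forall>\<^sub>F x in at z. x \<in> - (S - {z}) - {z}" by (intro eventually_at_in_open) auto
  thus ?thesis by eventually_elim auto
qed

lemma eventually_at_infinity_not_in_finite:
  fixes S :: "complex set"
  assumes "finite S"
  shows "\<forall>\<^sub>F x in at_infinity. x \<notin> S"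
proof -
  obtain B where B: "\<And>x. x \<in> S \<Longrightarrow> norm x \<le> B"
    using finite_imp_bounded[OF assms] by (auto simp: bounded_iff)
  have "x \<notin> S" if "B + 1 \<le> norm x" for x using B[of x] that by auto
  thus ?thesis unfolding eventually_at_infinity by blast
qed

text \<open>The behaviour \<open>c x\<^sup>r\<close> at \<open>0\<close> or \<open>\<infinity>\<close>, with the derivatives. No branch of the logarithm is holomorphic
  near these points, but the quotients by \<open>x\<^sup>r\<close> may have limits all the same, whatever the cut.\<close>

definition power_like :: "complex filter \<Rightarrow> (complex \<Rightarrow> complex) \<Rightarrow> complex \<Rightarrow> bool" where
  "power_like F f r \<longleftrightarrow> (\<exists>c. c \<noteq> 0 \<and>
     (\<forall>k. ((\<lambda>x. x ^ k * (xderiv ^^ k) f (Ln x) / exp (r * Ln x)) \<longlongrightarrow> c * poly (falling_poly k) r) F))"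

lemma power_like_family:
  assumes "\<And>i. i < d \<Longrightarrow> power_like F (f i) (\<rho> i)"
  obtains c where "\<And>i. i < d \<Longrightarrow> c i \<noteq> 0"
    "\<And>i k. i < d \<Longrightarrow> ((\<lambda>x. x ^ k * (xderiv ^^ k) (f i) (Ln x) / exp (\<rho> i * Ln x))
         \<longlongrightarrow> c i * poly (falling_poly k) (\<rho> i)) F"
proof -
  have "\<forall>i. \<exists>c. i < d \<longrightarrow> c \<noteq> 0 \<and>
     (\<forall>k. ((\<lambda>x. x ^ k * (xderiv ^^ k) (f i) (Ln x) / exp (\<rho> i * Ln x)) \<longlongrightarrow> c * poly (falling_poly k) (\<rho> i)) F)"
    using assms unfolding power_like_def by blast
  from choice[OF this] that show ?thesis by blast
qed

text \<open>The assumption \<open>at_0\<close> says that \<open>0\<close> is a regular singular point; the exponents at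
  \<open>\<infinity>\<close> are prescribed to be \<open>rho\<close>, as they determine the poles of the Baker--Akhiezer function in \<open>u\<close>.\<close>

locale fuchsian_space = function_space d V
  for d :: nat and V :: "(complex \<Rightarrow> complex) set" +
  fixes b :: "nat \<Rightarrow> complex \<Rightarrow> complex" and m :: nat and l :: "nat \<Rightarrow> complex"
    and M :: "nat \<Rightarrow> nat" and mm :: "nat \<Rightarrow> nat \<Rightarrow> nat" and rho :: "nat \<Rightarrow> complex"
  assumes operator: "fundamental_diff_op d V b"
    and sing: "singular_data d V m l M mm"
    and at_0: "\<exists>f \<rho>. inj_on \<rho> {..<d} \<and> (\<forall>i<d. f i \<in> V \<and> power_like (at 0) (f i) (\<rho> i))"
    and rho_inj: "inj_on rho {..<d}"
    and at_inf: "\<exists>f. \<forall>i<d. f i \<in> V \<and> power_like at_infinity (f i) (rho i)"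
begin

definition Z :: "complex set" where "Z = (\<lambda>a. exp (l a)) ` {1..m}"

definition D :: nat where "D = (\<Sum>a=1..m. M a)"

definition R :: "complex poly" where "R = (\<Prod>a=1..m. [:- exp (l a), 1:] ^ M a)"

lemma finite_Z: "finite Z" by (simp add: Z_def)

lemma singular_points_eq: "singular_points d V = Z"
  using sing by (simp add: singular_data_def Z_def)

lemma poly_R: "poly R x = (\<Prod>a=1..m. (x - exp (l a)) ^ M a)"
  by (simp add: R_def poly_prod poly_power)

lemma degree_R: "Polynomial.degree R = D"
  unfolding R_def D_def by (subst degree_prod_eq_sum_degree) (auto simp: degree_power_eq)

lemma lead_coeff_R: "Polynomial.coeff R D = 1"
  using lead_coeff_prod[of "\<lambda>a. [:- exp (l a), 1:] ^ M a" "{1..m}"] degree_R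
  by (simp add: R_def lead_coeff_power)

lemma poly_R_nonzero: "x \<notin> Z \<Longrightarrow> poly R x \<noteq> 0"
  by (auto simp: poly_R Z_def)

lemma equation: "f \<in> V \<Longrightarrow> exp t \<notin> Z \<Longrightarrow> (xderiv ^^ d) f t + (\<Sum>k<d. b k t * (xderiv ^^ k) f t) = 0"
  using operator singular_points_eq by (auto simp: fundamental_diff_op_def monic_diff_op_def)

text \<open>Analytic continuation maps \<open>V\<close> to itself, so both values solve the same system, which is uniquely
  solvable at a regular point.\<close>

lemma coefficient_single_valued:
  assumes "exp t = exp t'" "exp t \<notin> Z" "k < d"
  shows "b k t = b k t'"
proof -
  have "(\<Sum>k<d. (b k t - b k t') * (xderiv ^^ k) f t) = 0" if f: "f \<in> V" for f
  proof -
    have w: "exp (t - t') = 1" using assms(1) by (simp add: exp_diff)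
    have "(\<lambda>s. f (s + (t - t'))) \<in> V" by (rule shift[OF f w])
    from equation[OF this, of t'] have "(xderiv ^^ d) f t + (\<Sum>k<d. b k t' * (xderiv ^^ k) f t) = 0"
      using assms(1,2) by (simp add: xderiv_funpow_shift[OF entire[OF f] w])
    thus ?thesis using equation[OF f assms(2)] by (simp add: left_diff_distrib sum_subtractf add_eq_0_iff)
  qed
  from derivatives_separate[OF _ this assms(3)] show ?thesis
    using assms(2) by (simp add: singular_points_eq)
qed

lemma coefficient_on_branch:
  assumes "x \<noteq> 0" "x \<notin> Z" "k < d"
  shows "b k (ln_branch s x) = b k (Ln x)"
  using assms by (intro coefficient_single_valued) (auto simp: exp_ln_branch)

lemma coefficient_holomorphic:
  assumes k: "k < d"
  shows "(\<lambda>x. b k (Ln x)) holomorphic_on - insert 0 Z"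
proof -
  have "open (- insert 0 Z)" using finite_Z by (intro open_Compl finite_imp_closed) auto
  moreover have "\<exists>D. ((\<lambda>x. b k (Ln x)) has_field_derivative D) (at x)" if x: "x \<in> - insert 0 Z" for x
  proof -
    have "open (exp -` (- Z) :: complex set)"
      using finite_Z by (intro open_vimage open_Compl finite_imp_closed continuous_intros)
    moreover have "exp -` (- Z) = {t. exp t \<notin> Z}" by auto
    moreover have "b k holomorphic_on {t. exp t \<notin> Z}"
      using operator k singular_points_eq by (simp add: fundamental_diff_op_def)
    moreover have "Ln x \<in> {t. exp t \<notin> Z}" using x by simp
    ultimately have "(b k has_field_derivative deriv (b k) (Ln x)) (at (Ln x))"
      using holomorphic_derivI by metis
    moreover have "(ln_branch (Ln x) has_field_derivative 1 / x) (at x)"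
      using ln_branch_has_field_derivative[of x "Ln x"] x by simp
    moreover have "ln_branch (Ln x) x = Ln x" using ln_branch_center[of "Ln x"] x by (simp del: ln_branch_center)
    ultimately have D: "((\<lambda>x'. b k (ln_branch (Ln x) x')) has_field_derivative deriv (b k) (Ln x) * (1 / x)) (at x)"
      by (intro DERIV_chain2) simp_all
    have "\<forall>\<^sub>F x' in nhds x. x' \<in> - insert 0 Z"
      using \<open>open (- insert 0 Z)\<close> x by (rule eventually_nhds_in_open)
    hence ev: "\<forall>\<^sub>F x' in nhds x. b k (ln_branch (Ln x) x') = b k (Ln x')"
      by eventually_elim (use k in \<open>auto intro: coefficient_on_branch\<close>)
    show ?thesis using DERIV_cong_ev[OF refl ev refl, THEN iffD1, OF D] by (rule exI)
  qed
  ultimately show ?thesis by (simp add: holomorphic_on_open)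
qed

lemma scaled_equation:
  assumes "f \<in> V" "x \<noteq> 0" "x \<notin> Z"
  shows "x ^ d * (xderiv ^^ d) f (Ln x) / exp (r * Ln x)
     + (\<Sum>k<d. (x ^ k * (xderiv ^^ k) f (Ln x) / exp (r * Ln x)) * (x ^ (d - k) * b k (Ln x))) = 0"
proof -
  have "(x ^ k * (xderiv ^^ k) f (Ln x) / exp (r * Ln x)) * (x ^ (d - k) * b k (Ln x))
      = x ^ d / exp (r * Ln x) * (b k (Ln x) * (xderiv ^^ k) f (Ln x))" if "k < d" for k
  proof -
    have "x ^ d = x ^ k * x ^ (d - k)" using that by (simp flip: power_add)
    thus ?thesis by (simp add: mult_ac)
  qed
  hence "(\<Sum>k<d. (x ^ k * (xderiv ^^ k) f (Ln x) / exp (r * Ln x)) * (x ^ (d - k) * b k (Ln x)))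
      = x ^ d / exp (r * Ln x) * (\<Sum>k<d. b k (Ln x) * (xderiv ^^ k) f (Ln x))"
    unfolding sum_distrib_left by (intro sum.cong refl) (simp only: lessThan_iff)
  moreover have "x ^ d / exp (r * Ln x) * ((xderiv ^^ d) f (Ln x) + (\<Sum>k<d. b k (Ln x) * (xderiv ^^ k) f (Ln x))) = 0"
    using equation[OF assms(1), of "Ln x"] assms by simp
  ultimately show ?thesis by (simp add: distrib_left)
qed

lemma bounded_where_power_like:
  assumes inj: "inj_on \<rho> {..<d}" and f: "\<And>i. i < d \<Longrightarrow> f i \<in> V \<and> power_like F (f i) (\<rho> i)"
    and ev: "\<forall>\<^sub>F x in F. x \<notin> insert 0 Z" and k: "k < d"
  shows "(\<lambda>x. x ^ (d - k) * b k (Ln x)) \<in> O[F](\<lambda>_. 1)"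
proof -
  obtain c where c: "\<And>i. i < d \<Longrightarrow> c i \<noteq> 0"
    "\<And>i k. i < d \<Longrightarrow> ((\<lambda>x. x ^ k * (xderiv ^^ k) (f i) (Ln x) / exp (\<rho> i * Ln x))
         \<longlongrightarrow> c i * poly (falling_poly k) (\<rho> i)) F"
    using power_like_family[of d F f \<rho>] f by blast
  show ?thesis
  proof (rule coefficients_bounded_if_solutions_like_powers[where y = "\<lambda>x k. x ^ (d - k) * b k (Ln x)",
        OF inj c(1) c(2) _ k])
    fix i assume i: "i < d"
    show "\<forall>\<^sub>F x in F. x ^ d * (xderiv ^^ d) (f i) (Ln x) / exp (\<rho> i * Ln x)
     + (\<Sum>k<d. (x ^ k * (xderiv ^^ k) (f i) (Ln x) / exp (\<rho> i * Ln x)) * (x ^ (d - k) * b k (Ln x))) = 0"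
      using ev
    proof eventually_elim
      case (elim x)
      thus ?case using f[OF i] by (intro scaled_equation) auto
    qed
  qed auto
qed

text \<open>The exponents at \<open>z\<^sub>a\<close> in increasing order, numbered from \<open>0\<close>.\<close>

definition local_exponent :: "nat \<Rightarrow> nat \<Rightarrow> nat" where
  "local_exponent a i = (if i < d - M a then i else d - M a + mm a (Suc (i - (d - M a))))"

lemma local_exponent_inj:
  assumes a: "a \<in> {1..m}"
  shows "inj_on (local_exponent a) {..<d}"
proof (rule strict_mono_on_imp_inj_on, rule strict_mono_onI)
  fix i j assume ij: "i \<in> {..<d}" "j \<in> {..<d}" "i < j"
  have Ma: "1 \<le> M a" "M a \<le> d" and mm: "strict_mono_on {1..M a} (mm a)"
    using sing a by (auto simp: singular_data_def)
  show "local_exponent a i < local_exponent a j"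
  proof (cases "i < d - M a")
    case False
    hence "mm a (Suc (i - (d - M a))) < mm a (Suc (j - (d - M a)))"
      using ij Ma by (intro strict_mono_onD[OF mm]) auto
    thus ?thesis using False ij by (simp add: local_exponent_def)
  qed (use ij Ma in \<open>auto simp: local_exponent_def\<close>)
qed

lemma adapted_family:
  assumes a: "a \<in> {1..m}"
  obtains f where "\<And>i. i < d \<Longrightarrow> f i \<in> V" "\<And>i. i < d \<Longrightarrow> root_order (f i) (l a) (local_exponent a i)"
proof -
  have Ma: "1 \<le> M a" "M a \<le> d"
    and E: "exponents V (exp (l a)) = {..<d - M a} \<union> (\<lambda>b. d - M a + mm a b) ` {1..M a}"
    using sing a by (auto simp: singular_data_def)
  have "local_exponent a i \<in> exponents V (exp (l a))" if "i < d" for i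
    using that Ma by (auto simp: E local_exponent_def)
  hence "\<exists>f. f \<in> V \<and> root_order f (l a) (local_exponent a i)" if "i < d" for i
    using exponent_root_order[of "local_exponent a i" "l a"] that by metis
  thus ?thesis using that by metis
qed

text \<open>The exponents at \<open>z\<^sub>a\<close> start with \<open>0, \<dots>, d - M\<^sub>a - 1\<close>. The Fuchs bound controls the
  coefficients of the derivatives of order \<open>k \<ge> d - M\<^sub>a\<close>; the solutions with the first exponents form
  a system which is invertible at \<open>z\<^sub>a\<close> and expresses the other coefficients through those.\<close>

lemma pole_order_at_singular_point:
  assumes a: "a \<in> {1..m}" and k: "k < d"
  shows "(\<lambda>x. (x - exp (l a)) ^ M a * b k (Ln x)) \<in> O[at (exp (l a))](\<lambda>_. 1)"
proof -
  define z where "z = exp (l a)"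
  define n where "n = d - M a"
  define e where "e = local_exponent a"
  have Ma: "1 \<le> M a" "M a \<le> d" using sing a by (auto simp: singular_data_def)
  have e_inj: "inj_on e {..<d}" unfolding e_def by (rule local_exponent_inj[OF a])
  obtain f where f: "\<And>i. i < d \<Longrightarrow> f i \<in> V" "\<And>i. i < d \<Longrightarrow> root_order (f i) (l a) (e i)"
    using adapted_family[OF a] unfolding e_def by blast
  define G where "G i k x = (xderiv ^^ k) (f i) (ln_branch (l a) x)" for i k x
  define \<beta> where "\<beta> k x = b k (Ln x)" for k x
  have ev: "\<forall>\<^sub>F x in at z. x \<notin> insert 0 (insert z Z)"
    using finite_Z by (intro eventually_at_not_in_finite) simp
  have eq: "G i d x + (\<Sum>k<d. \<beta> k x * G i k x) = 0" if "i < d" "x \<notin> insert 0 (insert z Z)" for i x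
    using equation[OF f(1)[OF that(1)], of "ln_branch (l a) x"] that(2)
    by (simp add: G_def \<beta>_def exp_ln_branch coefficient_on_branch)
  have G_lim: "(G i k \<longlongrightarrow> (xderiv ^^ k) (f i) (l a)) (at z)" if "i < d" for i k
    unfolding G_def z_def by (rule tendsto_along_branch[OF entire[OF f(1)[OF that]]])
  have G_bound: "G i k \<in> O[at z](\<lambda>_. 1)" if "i < d" for i k
    by (rule bigoI_tendsto[where c = "(xderiv ^^ k) (f i) (l a)"]) (use G_lim[OF that] in auto)
  have "\<exists>c. c \<noteq> 0 \<and> (\<forall>k. ((\<lambda>x. (x - z) ^ k * G i k x / (x - z) ^ e i)
            \<longlongrightarrow> c * poly (falling_poly k) (of_nat (e i))) (at z))" if "i < d" for i
    unfolding G_def z_def by (rule root_order_tendsto[OF f(2)[OF that]]) blast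
  hence "\<forall>i. \<exists>c. i < d \<longrightarrow> c \<noteq> 0 \<and> (\<forall>k. ((\<lambda>x. (x - z) ^ k * G i k x / (x - z) ^ e i)
            \<longlongrightarrow> c * poly (falling_poly k) (of_nat (e i))) (at z))" by blast
  from choice[OF this] obtain c where c: "\<And>i. i < d \<Longrightarrow> c i \<noteq> 0"
    "\<And>i k. i < d \<Longrightarrow> ((\<lambda>x. (x - z) ^ k * G i k x / (x - z) ^ e i)
            \<longlongrightarrow> c i * poly (falling_poly k) (of_nat (e i))) (at z)"
    by blast
  have fuchs: "(\<lambda>x. (x - z) ^ (d - k) * \<beta> k x) \<in> O[at z](\<lambda>_. 1)" if k: "k < d" for k
  proof (rule coefficients_bounded_if_solutions_like_powers[where y = "\<lambda>x k. (x - z) ^ (d - k) * \<beta> k x"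
        and \<rho> = "\<lambda>i. of_nat (e i)", OF _ c(1) c(2) _ k])
    show "inj_on (\<lambda>i. of_nat (e i) :: complex) {..<d}" using e_inj by (auto simp: inj_on_def)
    fix i assume i: "i < d"
    show "\<forall>\<^sub>F x in at z. (x - z) ^ d * G i d x / (x - z) ^ e i
        + (\<Sum>k<d. (x - z) ^ k * G i k x / (x - z) ^ e i * ((x - z) ^ (d - k) * \<beta> k x)) = 0"
      using ev
    proof eventually_elim
      case (elim x)
      have "(x - z) ^ k * G i k x / (x - z) ^ e i * ((x - z) ^ (d - k) * \<beta> k x)
          = (x - z) ^ d / (x - z) ^ e i * (\<beta> k x * G i k x)" if "k < d" for k
      proof -
        have "(x - z) ^ d = (x - z) ^ k * (x - z) ^ (d - k)" using that by (simp flip: power_add)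
        thus ?thesis by (simp add: mult_ac)
      qed
      hence "(\<Sum>k<d. (x - z) ^ k * G i k x / (x - z) ^ e i * ((x - z) ^ (d - k) * \<beta> k x))
        = (x - z) ^ d / (x - z) ^ e i * (\<Sum>k<d. \<beta> k x * G i k x)"
        unfolding sum_distrib_left by (intro sum.cong refl) (simp only: lessThan_iff)
      moreover have "(x - z) ^ d / (x - z) ^ e i * (G i d x + (\<Sum>k<d. \<beta> k x * G i k x)) = 0"
        using eq[OF i elim] by simp
      ultimately show ?case by (simp add: distrib_left)
    qed
  qed auto
  have high: "(\<lambda>x. (x - z) ^ M a * \<beta> k x) \<in> O[at z](\<lambda>_. 1)" if k: "n \<le> k" "k < d" for k
  proof -
    have "((\<lambda>x. (x - z) ^ (M a - (d - k))) \<longlongrightarrow> (z - z) ^ (M a - (d - k))) (at z)"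
      by (intro tendsto_power tendsto_diff tendsto_ident_at tendsto_const)
    hence "(\<lambda>x. (x - z) ^ (M a - (d - k))) \<in> O[at z](\<lambda>_. 1)"
      by (intro bigoI_tendsto[where c = "(z - z) ^ (M a - (d - k))"]) auto
    from landau_o.big_mult[OF this fuchs[OF k(2)]]
    have "(\<lambda>x. (x - z) ^ (M a - (d - k)) * ((x - z) ^ (d - k) * \<beta> k x)) \<in> O[at z](\<lambda>_. 1)" by simp
    moreover have "(x - z) ^ (M a - (d - k)) * (x - z) ^ (d - k) = (x - z) ^ M a" for x
      using k Ma by (simp flip: power_add add: n_def)
    ultimately show ?thesis by (simp add: mult.assoc[symmetric])
  qed
  have low: "(\<lambda>x. (x - z) ^ M a * \<beta> k x) \<in> O[at z](\<lambda>_. 1)" if k: "k < n" for k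
  proof (rule solution_bigo[where n = n and A = "\<lambda>x i k. G i k x" and y = "\<lambda>x k. (x - z) ^ M a * \<beta> k x"
        and ?A0.0 = "\<lambda>i k. (xderiv ^^ k) (f i) (l a)"
        and r = "\<lambda>x i. - ((x - z) ^ M a * G i d x) - (\<Sum>k=n..<d. (x - z) ^ M a * \<beta> k x * G i k x)", OF _ _ _ _ k])
    have nd: "i < d" if "i < n" for i using that by (simp add: n_def)
    show "((\<lambda>x. G i k x) \<longlongrightarrow> (xderiv ^^ k) (f i) (l a)) (at z)" if "i < n" "k < n" for i k
      using G_lim[OF nd[OF that(1)]] .
    have order: "root_order (f i) (l a) i" if "i < n" for i
      using f(2)[OF nd[OF that]] that by (simp add: e_def local_exponent_def n_def)
    show "sqdet n (\<lambda>i k. (xderiv ^^ k) (f i) (l a)) \<noteq> 0"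
      by (rule sqdet_triangular_nonzero)
        (simp_all add: root_order_derivatives[OF entire[OF f(1)[OF nd]] order])
    fix i assume i: "i < n"
    show "\<forall>\<^sub>F x in at z. (\<Sum>k<n. G i k x * ((x - z) ^ M a * \<beta> k x))
        = - ((x - z) ^ M a * G i d x) - (\<Sum>k=n..<d. (x - z) ^ M a * \<beta> k x * G i k x)"
      using ev
    proof eventually_elim
      case (elim x)
      have split: "{..<d} = {..<n} \<union> {n..<d}" "{..<n} \<inter> {n..<d} = {}" by (auto simp: n_def)
      have "(\<Sum>k<d. \<beta> k x * G i k x) = (\<Sum>k<n. \<beta> k x * G i k x) + (\<Sum>k=n..<d. \<beta> k x * G i k x)"
        unfolding split(1) by (rule sum.union_disjoint) (use split(2) in auto)
      hence "(x - z) ^ M a * (G i d x + ((\<Sum>k<n. \<beta> k x * G i k x) + (\<Sum>k=n..<d. \<beta> k x * G i k x))) = 0"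
        using eq[OF nd[OF i] elim] by simp
      thus ?case by (simp add: distrib_left sum_distrib_left mult_ac eq_diff_eq eq_neg_iff_add_eq_0 add_ac)
    qed
    have "((\<lambda>x. (x - z) ^ M a) \<longlongrightarrow> (z - z) ^ M a) (at z)"
      by (intro tendsto_power tendsto_diff tendsto_ident_at tendsto_const)
    hence "(\<lambda>x. (x - z) ^ M a) \<in> O[at z](\<lambda>_. 1)"
      by (intro bigoI_tendsto[where c = "(z - z) ^ M a"]) auto
    hence "(\<lambda>x. (x - z) ^ M a * G i d x) \<in> O[at z](\<lambda>_. 1 * 1)"
      by (intro landau_o.big_mult G_bound nd i)
    moreover have "(\<lambda>x. (x - z) ^ M a * \<beta> k x * G i k x) \<in> O[at z](\<lambda>_. 1 * 1)" if "k \<in> {n..<d}" for k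
      using that by (intro landau_o.big_mult[OF high G_bound[OF nd[OF i]]]) auto
    hence "(\<lambda>x. \<Sum>k=n..<d. (x - z) ^ M a * \<beta> k x * G i k x) \<in> O[at z](\<lambda>_. 1 * 1)"
      by (rule big_sum_in_bigo)
    ultimately have "(\<lambda>x. - ((x - z) ^ M a * G i d x) - (\<Sum>k=n..<d. (x - z) ^ M a * \<beta> k x * G i k x)) \<in> O[at z](\<lambda>_. 1 * 1)"
      by (intro sum_in_bigo) auto
    thus "(\<lambda>x. - ((x - z) ^ M a * G i d x) - (\<Sum>k=n..<d. (x - z) ^ M a * \<beta> k x * G i k x)) \<in> O[at z](\<lambda>_. 1)"
      by simp
  qed
  show ?thesis using low[of k] high[of k] k unfolding z_def \<beta>_def by (cases "k < n") auto
qed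

text \<open>The product extends over \<open>0\<close> and the \<open>z\<^sub>a\<close>, where it is bounded, and grows at most like \<open>x\<^sup>D\<close>
  at \<open>\<infinity>\<close>; Liouville's theorem does the rest.\<close>

lemma coefficient_polynomial:
  assumes k: "k < d"
  shows "\<exists>P. Polynomial.degree P \<le> D \<and>
    (\<forall>x. x \<notin> insert 0 Z \<longrightarrow> poly P x = x ^ (d - k) * b k (Ln x) * poly R x)"
proof -
  define C where "C x = x ^ (d - k) * b k (Ln x) * poly R x" for x
  have polyO: "(\<lambda>x. poly p x) \<in> O[at z](\<lambda>_. 1)" for p and z :: complex
  proof -
    have "((\<lambda>x. poly p x) \<longlongrightarrow> poly p z) (at z)" unfolding isCont_def[symmetric] by simp
    thus ?thesis by (intro bigoI_tendsto[where c = "poly p z"]) auto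
  qed
  have "C \<in> O[at z](\<lambda>_. 1)" if z: "z \<in> insert 0 Z" for z
  proof (cases "z = 0")
    case True
    obtain f \<rho> where f: "inj_on \<rho> {..<d}" "\<forall>i<d. f i \<in> V \<and> power_like (at 0) (f i) (\<rho> i)"
      using at_0 by blast
    have "\<forall>\<^sub>F x in at 0. x \<notin> insert 0 Z"
      using finite_Z by (intro eventually_at_not_in_finite) simp
    hence "(\<lambda>x. x ^ (d - k) * b k (Ln x)) \<in> O[at 0](\<lambda>_. 1)"
      using f by (intro bounded_where_power_like[OF f(1) _ _ k]) auto
    from landau_o.big_mult[OF this polyO[of R]] show ?thesis using True by (simp add: C_def[abs_def])
  next
    case False
    then obtain a where a: "a \<in> {1..m}" "z = exp (l a)" using z by (auto simp: Z_def)
    let ?Q = "(\<Prod>a\<in>{1..m} - {a}. [:- exp (l a), 1:] ^ M a) * Polynomial.monom 1 (d - k)"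
    have "poly R x = (x - z) ^ M a * (\<Prod>a\<in>{1..m} - {a}. (x - exp (l a)) ^ M a)" for x
      unfolding poly_R a(2) by (rule prod.remove) (use a in auto)
    hence "C = (\<lambda>x. ((x - z) ^ M a * b k (Ln x)) * poly ?Q x)"
      by (intro ext) (simp add: C_def poly_prod poly_power poly_monom mult_ac)
    with landau_o.big_mult[OF pole_order_at_singular_point[OF a(1) k] polyO[of ?Q]] show ?thesis
      by (simp add: a(2))
  qed
  moreover have "C holomorphic_on UNIV - insert 0 Z"
    unfolding C_def using coefficient_holomorphic[OF k]
    by (intro holomorphic_intros) (simp_all add: Compl_eq_Diff_UNIV)
  ultimately have "\<exists>g. g holomorphic_on UNIV \<and> (\<forall>z\<in>UNIV - insert 0 Z. g z = C z)"
    using finite_Z by (intro removable_singularities) auto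
  then obtain g where g: "g holomorphic_on UNIV" "\<And>x. x \<notin> insert 0 Z \<Longrightarrow> g x = C x" by auto
  obtain f where f: "\<forall>i<d. f i \<in> V \<and> power_like at_infinity (f i) (rho i)"
    using at_inf by blast
  have ev: "\<forall>\<^sub>F x in at_infinity. x \<notin> insert 0 Z"
    using finite_Z by (intro eventually_at_infinity_not_in_finite) simp
  have y: "(\<lambda>x. x ^ (d - k) * b k (Ln x)) \<in> O[at_infinity](\<lambda>_. 1)"
    using f by (intro bounded_where_power_like[OF rho_inj _ ev k]) auto
  have "(\<lambda>x. poly R x / x ^ D) \<in> O[at_infinity](\<lambda>_. 1)"
    using poly_tendsto_at_infinity[of R D] degree_R
    by (intro bigoI_tendsto[where c = "Polynomial.coeff R D"]) auto
  from landau_o.big_mult[OF y this] obtain c where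
    c: "\<forall>\<^sub>F x in at_infinity. norm (x ^ (d - k) * b k (Ln x) * (poly R x / x ^ D)) \<le> c * norm (1 * 1 :: complex)"
    by (rule landau_o.bigE)
  from c ev have "\<forall>\<^sub>F x in at_infinity. norm (g x) \<le> c * norm x ^ D"
  proof eventually_elim
    case (elim x)
    have "norm (C x) / norm x ^ D \<le> c"
      using elim(1) by (simp add: C_def norm_mult norm_divide norm_power)
    thus ?case using elim(2) g(2) by (simp add: field_simps)
  qed
  then obtain A where A: "\<And>x. A \<le> norm x \<Longrightarrow> norm (g x) \<le> c * norm x ^ D"
    by (auto simp: eventually_at_infinity)
  let ?P = "\<Sum>j\<le>D. Polynomial.monom ((deriv ^^ j) g 0 / fact j) j"
  have "g x = poly ?P x" for x
    using Liouville_polynomial[OF g(1) A, where \<xi> = x] by (simp add: poly_sum poly_monom)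
  moreover have "Polynomial.degree ?P \<le> D"
    by (rule degree_sum_le) (auto intro: order_trans[OF degree_monom_le])
  ultimately show ?thesis using g(2) by (intro exI[of _ ?P]) (auto simp: C_def)
qed

text \<open>The coefficients of \<open>x\<^sup>d R\<close> times the monic operator, with respect to the operators \<open>x\<^sup>k (d/dx)\<^sup>k\<close> for
  \<open>k \<le> d\<close>.\<close>

definition P :: "nat \<Rightarrow> complex poly" where
  "P k = (if k < d then SOME P. Polynomial.degree P \<le> D \<and>
    (\<forall>x. x \<notin> insert 0 Z \<longrightarrow> poly P x = x ^ (d - k) * b k (Ln x) * poly R x) else R)"

lemma degree_P: "Polynomial.degree (P k) \<le> D"
  and poly_P: "k < d \<Longrightarrow> x \<notin> insert 0 Z \<Longrightarrow> poly (P k) x = x ^ (d - k) * b k (Ln x) * poly R x"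
  and P_d: "P d = R"
proof -
  have "Polynomial.degree (P k) \<le> D \<and>
    (\<forall>x. x \<notin> insert 0 Z \<longrightarrow> poly (P k) x = x ^ (d - k) * b k (Ln x) * poly R x)" if "k < d" for k
    using someI_ex[OF coefficient_polynomial[OF that]] that by (simp add: P_def)
  thus "Polynomial.degree (P k) \<le> D"
    and "k < d \<Longrightarrow> x \<notin> insert 0 Z \<Longrightarrow> poly (P k) x = x ^ (d - k) * b k (Ln x) * poly R x"
    and "P d = R"
    using degree_R by (cases "k < d"; simp add: P_def)+
qed

section \<open>The associated difference operator\<close>

text \<open>On \<open>x\<^sup>u\<close>, the operator \<open>x\<^sup>j\<close> acts as the shift \<open>u \<mapsto> u + j\<close> and \<open>x\<^sup>k (d/dx)\<^sup>k\<close> as a polynomial in \<open>u\<close>.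
  This turns the differential operator in \<open>x\<close> into a difference operator in \<open>u\<close>, with the
  coefficients \<open>\<beta>\<close>.\<close>

definition \<beta> :: "nat \<Rightarrow> complex poly" where
  "\<beta> j = (\<Sum>k\<le>d. Polynomial.smult (Polynomial.coeff (P k) j) (falling_poly k))"

lemma operator_on_powers:
  assumes t: "exp t \<notin> Z"
  shows "exp t ^ d * poly R (exp t) * monic_diff_op d b (\<lambda>s. exp (u * s)) t
    = (\<Sum>j\<le>D. poly (\<beta> j) u * exp ((u + of_nat j) * t))"
proof -
  define x where "x = exp t"
  have x: "x \<notin> insert 0 Z" using t by (simp add: x_def)
  have bk: "b k t = b k (Ln x)" if "k < d" for k
    using that t by (intro coefficient_single_valued) (auto simp: x_def)
  have e: "x ^ k * exp ((u - of_nat k) * t) = exp (u * t)" for k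
    by (simp add: x_def exp_of_nat_mult[symmetric] exp_add[symmetric] algebra_simps)
  have "x ^ d * poly R x * (b k t * (poly (falling_poly k) u * exp ((u - of_nat k) * t)))
      = exp (u * t) * (poly (P k) x * poly (falling_poly k) u)" if k: "k < d" for k
  proof -
    have "x ^ d = x ^ (d - k) * x ^ k" using k by (simp flip: power_add)
    thus ?thesis using bk[OF k] poly_P[OF k x] e[of k] by (simp add: mult_ac)
  qed
  hence "x ^ d * poly R x * (\<Sum>k<d. b k t * (poly (falling_poly k) u * exp ((u - of_nat k) * t)))
      = (\<Sum>k<d. exp (u * t) * (poly (P k) x * poly (falling_poly k) u))"
    unfolding sum_distrib_left by (intro sum.cong refl) (simp only: lessThan_iff)
  moreover have "x ^ d * poly R x * (poly (falling_poly d) u * exp ((u - of_nat d) * t))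
      = exp (u * t) * (poly (P d) x * poly (falling_poly d) u)"
    using e[of d] by (simp add: P_d mult_ac)
  ultimately have "x ^ d * poly R x * monic_diff_op d b (\<lambda>s. exp (u * s)) t
      = (\<Sum>k\<le>d. exp (u * t) * (poly (P k) x * poly (falling_poly k) u))"
    unfolding monic_diff_op_def xderiv_funpow_power
    by (simp add: distrib_left lessThan_Suc_atMost[symmetric])
  also have "\<dots> = (\<Sum>k\<le>d. \<Sum>j\<le>D. Polynomial.coeff (P k) j * poly (falling_poly k) u * (exp (u * t) * x ^ j))"
  proof (intro sum.cong refl)
    fix k
    have "poly (P k) x = (\<Sum>j\<le>D. Polynomial.coeff (P k) j * x ^ j)"
      unfolding poly_altdef using degree_P by (intro sum.mono_neutral_left) (auto simp: coeff_eq_0)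
    thus "exp (u * t) * (poly (P k) x * poly (falling_poly k) u)
      = (\<Sum>j\<le>D. Polynomial.coeff (P k) j * poly (falling_poly k) u * (exp (u * t) * x ^ j))"
      by (simp add: sum_distrib_left sum_distrib_right mult_ac)
  qed
  also have "\<dots> = (\<Sum>j\<le>D. poly (\<beta> j) u * (exp (u * t) * x ^ j))"
    unfolding \<beta>_def poly_sum sum_distrib_right by (subst sum.swap) simp
  also have "\<dots> = (\<Sum>j\<le>D. poly (\<beta> j) u * exp ((u + of_nat j) * t))"
    by (intro sum.cong refl arg_cong2[where f = "(*)"])
      (simp add: x_def exp_of_nat_mult[symmetric] exp_add[symmetric] algebra_simps)
  finally show ?thesis by (simp add: x_def)
qed

text \<open>The leading coefficient of the difference operator collects the values at \<open>x = \<infinity>\<close> of the rescaled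
  coefficients, so it is the indicial polynomial at that point: it is monic of degree \<open>d\<close>, and its roots
  are the \<open>d\<close> distinct exponents.\<close>

lemma leading_coefficient: "\<beta> D = (\<Prod>i<d. [:- rho i, 1:])"
proof -
  obtain f where f: "\<And>i. i < d \<Longrightarrow> f i \<in> V \<and> power_like at_infinity (f i) (rho i)"
    using at_inf by blast
  obtain c where c: "\<And>i. i < d \<Longrightarrow> c i \<noteq> 0"
    "\<And>i k. i < d \<Longrightarrow> ((\<lambda>x. x ^ k * (xderiv ^^ k) (f i) (Ln x) / exp (rho i * Ln x))
         \<longlongrightarrow> c i * poly (falling_poly k) (rho i)) at_infinity"
    using power_like_family[of d at_infinity f rho] f by blast
  have ev: "\<forall>\<^sub>F x in at_infinity. x \<notin> insert 0 Z"
    using finite_Z by (intro eventually_at_infinity_not_in_finite) simp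
  have coeff_lim: "((\<lambda>x. x ^ (d - k) * b k (Ln x)) \<longlongrightarrow> Polynomial.coeff (P k) D) at_infinity" if k: "k < d" for k
  proof -
    have "((\<lambda>x. (poly (P k) x / x ^ D) / (poly R x / x ^ D)) \<longlongrightarrow> Polynomial.coeff (P k) D / Polynomial.coeff R D) at_infinity"
      using degree_P[of k] degree_R lead_coeff_R by (intro tendsto_divide poly_tendsto_at_infinity) auto
    moreover have "\<forall>\<^sub>F x in at_infinity. (poly (P k) x / x ^ D) / (poly R x / x ^ D) = x ^ (d - k) * b k (Ln x)"
      using ev
    proof eventually_elim
      case (elim x)
      thus ?case using poly_P[OF k elim] poly_R_nonzero[of x] by simp
    qed
    ultimately have "((\<lambda>x. x ^ (d - k) * b k (Ln x)) \<longlongrightarrow> Polynomial.coeff (P k) D / Polynomial.coeff R D) at_infinity"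
      by (rule Lim_transform_eventually)
    thus ?thesis by (simp add: lead_coeff_R)
  qed
  have beta: "poly (\<beta> D) u = poly (falling_poly d) u + (\<Sum>k<d. Polynomial.coeff (P k) D * poly (falling_poly k) u)" for u
    by (simp add: \<beta>_def poly_sum lessThan_Suc_atMost[symmetric] P_d lead_coeff_R)
  have root: "poly (\<beta> D) (rho i) = 0" if i: "i < d" for i
  proof -
    have lim: "((\<lambda>x. x ^ d * (xderiv ^^ d) (f i) (Ln x) / exp (rho i * Ln x)
       + (\<Sum>k<d. (x ^ k * (xderiv ^^ k) (f i) (Ln x) / exp (rho i * Ln x)) * (x ^ (d - k) * b k (Ln x))))
       \<longlongrightarrow> c i * poly (falling_poly d) (rho i)
         + (\<Sum>k<d. c i * poly (falling_poly k) (rho i) * Polynomial.coeff (P k) D)) at_infinity"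
      using c(2)[OF i] coeff_lim by (intro tendsto_add tendsto_sum tendsto_mult) auto
    have zero: "\<forall>\<^sub>F x in at_infinity. x ^ d * (xderiv ^^ d) (f i) (Ln x) / exp (rho i * Ln x)
       + (\<Sum>k<d. (x ^ k * (xderiv ^^ k) (f i) (Ln x) / exp (rho i * Ln x)) * (x ^ (d - k) * b k (Ln x))) = 0"
      using ev
    proof eventually_elim
      case (elim x)
      thus ?case using f[OF i] by (intro scaled_equation) auto
    qed
    note lim0 = Lim_transform_eventually[OF lim zero]
    have "c i * poly (falling_poly d) (rho i)
         + (\<Sum>k<d. c i * poly (falling_poly k) (rho i) * Polynomial.coeff (P k) D) = 0"
      by (rule tendsto_unique[OF trivial_limit_at_infinity lim0 tendsto_const])
    hence "c i * poly (\<beta> D) (rho i) = 0"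
      by (simp add: beta distrib_left sum_distrib_left mult_ac)
    thus ?thesis using c(1)[OF i] by simp
  qed
  let ?Q = "\<Prod>i<d. [:- rho i, 1:]"
  have degQ: "Polynomial.degree ?Q = d" by (subst degree_prod_eq_sum_degree) auto
  have "Polynomial.coeff ?Q d = 1"
    using lead_coeff_prod[of "\<lambda>i. [:- rho i, 1:]" "{..<d}"] degQ by simp
  moreover have "Polynomial.coeff (\<beta> D) d = 1"
  proof -
    have "Polynomial.coeff (\<beta> D) d = (\<Sum>k\<le>d. Polynomial.coeff (P k) D * Polynomial.coeff (falling_poly k) d)"
      by (simp add: \<beta>_def coeff_sum)
    also have "\<dots> = (\<Sum>k\<le>d. if k = d then Polynomial.coeff (P d) D else 0)"
      by (intro sum.cong refl) (auto intro!: coeff_eq_0)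
    finally show ?thesis by (simp add: P_d lead_coeff_R)
  qed
  moreover have "Polynomial.degree (\<beta> D) \<le> d"
    unfolding \<beta>_def by (intro degree_sum_le) (auto intro: order_trans[OF degree_smult_le])
  ultimately have "\<beta> D - ?Q = 0 \<or> Polynomial.degree (\<beta> D - ?Q) < d"
    using degQ by (intro eq_zero_or_degree_less degree_diff_le) auto
  moreover have "poly (\<beta> D - ?Q) (rho i) = 0" if "i < d" for i
    using root[OF that] that by (auto simp: poly_prod prod_zero_iff)
  ultimately have "\<beta> D - ?Q = 0" using poly_eq_0_if_many_roots[OF _ rho_inj] by blast
  thus ?thesis by simp
qed

end

section \<open>Quasi-polynomials\<close>

lemma quasi_polynomial_ratio:
  assumes "x \<noteq> 0"
  shows "x ^ k * (xderiv ^^ k) (\<lambda>t. exp (lam * t) * poly p (exp t)) (Ln x) / exp ((lam + of_nat e) * Ln x)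
    = (\<Sum>a\<le>Polynomial.degree p. Polynomial.coeff p a * poly (falling_poly k) (lam + of_nat a) * x ^ a) / x ^ e"
proof -
  have "exp ((lam + of_nat e) * Ln x) = exp (lam * Ln x) * x ^ e"
    using assms by (simp add: distrib_right exp_add exp_of_nat_mult)
  thus ?thesis
    using xderiv_funpow_quasi_polynomial[of "Ln x" k lam p] assms by simp
qed

lemma quasi_polynomial_at_infinity:
  assumes "p \<noteq> 0"
  shows "power_like at_infinity (\<lambda>t. exp (lam * t) * poly p (exp t)) (lam + of_nat (Polynomial.degree p))"
  unfolding power_like_def
proof (intro exI conjI allI)
  fix k
  let ?c = "\<lambda>a. Polynomial.coeff p a * poly (falling_poly k) (lam + of_nat a)"
  let ?n = "Polynomial.degree p"
  have ev: "\<forall>\<^sub>F x in at_infinity. (\<Sum>a\<le>?n. ?c a * x ^ a) / x ^ ?n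
      = x ^ k * (xderiv ^^ k) (\<lambda>t. exp (lam * t) * poly p (exp t)) (Ln x) / exp ((lam + of_nat ?n) * Ln x)"
    using eventually_not_equal_at_infinity[of 0]
    by eventually_elim (simp add: quasi_polynomial_ratio)
  show "((\<lambda>x. x ^ k * (xderiv ^^ k) (\<lambda>t. exp (lam * t) * poly p (exp t)) (Ln x) / exp ((lam + of_nat ?n) * Ln x))
     \<longlongrightarrow> lead_coeff p * poly (falling_poly k) (lam + of_nat ?n)) at_infinity"
    by (rule Lim_transform_eventually[OF polynomial_sum_tendsto_at_infinity ev])
qed (use assms in simp)

lemma quasi_polynomial_at_0:
  assumes "p \<noteq> 0"
  shows "power_like (at 0) (\<lambda>t. exp (lam * t) * poly p (exp t)) (lam + of_nat (Polynomial.order 0 p))"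
  unfolding power_like_def
proof (intro exI conjI allI)
  fix k
  let ?c = "\<lambda>a. Polynomial.coeff p a * poly (falling_poly k) (lam + of_nat a)"
  let ?n = "Polynomial.degree p" and ?r = "Polynomial.order 0 p"
  have low: "Polynomial.coeff p a = 0" if "a < ?r" for a
    using monom_1_dvd_iff'[of ?r p] monom_1_dvd_iff[OF assms, of ?r] that by simp
  show "Polynomial.coeff p ?r \<noteq> 0"
  proof
    assume "Polynomial.coeff p ?r = 0"
    hence "\<forall>a<Suc ?r. Polynomial.coeff p a = 0" using low by (auto simp: less_Suc_eq)
    thus False using monom_1_dvd_iff'[of "Suc ?r" p] monom_1_dvd_iff[OF assms, of "Suc ?r"] by simp
  qed
  have ev: "\<forall>\<^sub>F x in at 0. (\<Sum>a\<le>?n. ?c a * x ^ a) / x ^ ?r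
      = x ^ k * (xderiv ^^ k) (\<lambda>t. exp (lam * t) * poly p (exp t)) (Ln x) / exp ((lam + of_nat ?r) * Ln x)"
    using eventually_neq_at_within[of 0]
    by eventually_elim (simp add: quasi_polynomial_ratio)
  have "((\<lambda>x. (\<Sum>a\<le>?n. ?c a * x ^ a) / x ^ ?r) \<longlongrightarrow> ?c ?r) (at 0)"
    using low order_degree[OF assms] by (intro polynomial_sum_tendsto_at_0) auto
  from Lim_transform_eventually[OF this ev]
  show "((\<lambda>x. x ^ k * (xderiv ^^ k) (\<lambda>t. exp (lam * t) * poly p (exp t)) (Ln x) / exp ((lam + of_nat ?r) * Ln x))
     \<longlongrightarrow> Polynomial.coeff p ?r * poly (falling_poly k) (lam + of_nat ?r)) (at 0)" .
qed

lemma quasi_polynomial_span_properties: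
  assumes S: "\<And>f. f \<in> S \<Longrightarrow> \<exists>lam p. f = (\<lambda>t. exp (lam * t) * poly p (exp t))"
    and f: "f \<in> cfun.span S"
  shows "f holomorphic_on UNIV" and "exp w = 1 \<Longrightarrow> (\<lambda>t. f (t + w)) \<in> cfun.span S"
proof -
  show "f holomorphic_on UNIV"
  proof (rule cfun.span_induct[OF f])
    show "cfun.subspace {f. f holomorphic_on UNIV}"
      unfolding cfun.subspace_def plus_fun_def zero_fun_def
      by (auto intro!: holomorphic_intros)
    show "f holomorphic_on UNIV" if "f \<in> S" for f
      using S[OF that] quasi_polynomial_holomorphic by auto
  qed
  show "(\<lambda>t. f (t + w)) \<in> cfun.span S" if w: "exp w = 1"
  proof (rule cfun.span_induct[OF f])
    show "cfun.subspace {f. (\<lambda>t. f (t + w)) \<in> cfun.span S}"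
      unfolding cfun.subspace_def
      using cfun.span_zero cfun.span_add cfun.span_scale
      by (auto simp: plus_fun_def zero_fun_def)
    show "(\<lambda>t. f (t + w)) \<in> cfun.span S" if f: "f \<in> S" for f
    proof -
      obtain lam p where fp: "f = (\<lambda>t. exp (lam * t) * poly p (exp t))" using S[OF f] by blast
      have "(\<lambda>t. f (t + w)) = (\<lambda>t. exp (lam * w) * f t)"
        by (simp add: fp fun_eq_iff distrib_left exp_add w mult_ac)
      thus ?thesis using cfun.span_scale[OF cfun.span_base[OF f], of "exp (lam * w)"] by simp
    qed
  qed
qed

locale quasi_polynomials =
  fixes n :: nat and N :: "nat \<Rightarrow> nat" and nn :: "nat \<Rightarrow> nat \<Rightarrow> nat" and lam :: "nat \<Rightarrow> complex"
    and p :: "nat \<Rightarrow> nat \<Rightarrow> complex poly"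
  assumes data: "qpoly_data n N nn lam p"
    and nondegenerate: "qpoly_nondegenerate n N nn lam p"
begin

definition I :: "(nat \<times> nat) set" where "I = Sigma {1..n} (\<lambda>i. {1..N i})"

lemma finite_I: "finite I" and card_I: "card I = (\<Sum>i=1..n. N i)"
  by (simp_all add: I_def)

definition enum :: "nat \<Rightarrow> nat \<times> nat" where
  "enum = (SOME h. bij_betw h {..<card I} I)"

lemma enum: "bij_betw enum {..<card I} I"
proof -
  have "\<exists>h. bij_betw h {..<card I} I"
    using ex_bij_betw_nat_finite[OF finite_I] by (simp add: atLeast0LessThan)
  thus ?thesis unfolding enum_def by (rule someI_ex)
qed

lemma enum_in_I: "k < card I \<Longrightarrow> enum k \<in> I"
  using enum by (auto simp: bij_betw_def)

definition rho :: "nat \<Rightarrow> complex" where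
  "rho k = (case enum k of (i, j) \<Rightarrow> lam i + of_nat (nn i j))"

lemma exponents_distinct:
  assumes e: "\<And>i j j'. i \<in> {1..n} \<Longrightarrow> j \<in> {1..N i} \<Longrightarrow> j' \<in> {1..N i} \<Longrightarrow> e i j = e i j' \<Longrightarrow> j = j'"
  shows "inj_on (\<lambda>k. case enum k of (i, j) \<Rightarrow> lam i + of_nat (e i j :: nat)) {..<card I}"
proof -
  have "inj_on (\<lambda>(i, j). lam i + of_nat (e i j)) I"
  proof (rule inj_onI, clarify)
    fix i j i' j' assume ij: "(i, j) \<in> I" "(i', j') \<in> I"
      and eq: "lam i + of_nat (e i j) = lam i' + of_nat (e i' j')"
    have "lam i - lam i' = of_int (int (e i' j') - int (e i j))"
      using eq by (simp add: algebra_simps)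
    hence "lam i - lam i' \<in> \<int>" by (metis Ints_of_int)
    moreover have "i \<in> {1..n}" "i' \<in> {1..n}" using ij by (auto simp: I_def)
    ultimately have "i = i'" using data unfolding qpoly_data_def by blast
    thus "i = i' \<and> j = j'" using eq e ij by (auto simp: I_def)
  qed
  thus ?thesis using enum unfolding bij_betw_def
    by (intro comp_inj_on[of enum _ "\<lambda>(i, j). lam i + of_nat (e i j)", unfolded comp_def]) auto
qed

abbreviation V :: "(complex \<Rightarrow> complex) set" where "V \<equiv> qpoly_space n N lam p"

lemma generator_in_V: "i \<in> {1..n} \<Longrightarrow> j \<in> {1..N i} \<Longrightarrow> (\<lambda>t. exp (lam i * t) * poly (p i j) (exp t)) \<in> V"
  unfolding qpoly_space_def by (rule cfun.span_base) blast

lemma V_eq: "V = cfun.span ((\<lambda>(i, j) t. exp (lam i * t) * poly (p i j) (exp t)) ` I)"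
  unfolding qpoly_space_def I_def 
proof (intro arg_cong[where f = cfun.span] equalityI subsetI)
  fix f assume "f \<in> (\<lambda>(i, j) t. exp (lam i * t) * poly (p i j) (exp t)) ` (SIGMA i:{1..n}. {1..N i})"
  then obtain i j where "f = (\<lambda>t. exp (lam i * t) * poly (p i j) (exp t))" "i \<in> {1..n}" "j \<in> {1..N i}"
    by (auto simp del: atLeastAtMost_iff)
  thus "f \<in> {\<lambda>t. exp (lam i * t) * poly (p i j) (exp t) |i j. i \<in> {1..n} \<and> j \<in> {1..N i}}" by blast
next
  fix f assume "f \<in> {\<lambda>t. exp (lam i * t) * poly (p i j) (exp t) |i j. i \<in> {1..n} \<and> j \<in> {1..N i}}"
  then obtain i j where "f = (\<lambda>t. exp (lam i * t) * poly (p i j) (exp t))" "i \<in> {1..n}" "j \<in> {1..N i}"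
    by blast
  thus "f \<in> (\<lambda>(i, j) t. exp (lam i * t) * poly (p i j) (exp t)) ` (SIGMA i:{1..n}. {1..N i})"
    by (intro image_eqI[of _ _ "(i, j)"]) auto
qed

sublocale function_space "\<Sum>i=1..n. N i" V
proof
  let ?S = "(\<lambda>(i, j) t. exp (lam i * t) * poly (p i j) (exp t)) ` I"
  have S: "\<exists>lam p. f = (\<lambda>t. exp (lam * t) * poly p (exp t))" if "f \<in> ?S" for f
    using that by auto
  show "cfun.subspace V" unfolding V_eq by (rule cfun.subspace_span)
  show "f holomorphic_on UNIV" if "f \<in> V" for f
    by (rule quasi_polynomial_span_properties(1)[of ?S]) (use S that V_eq in simp_all)
  show "(\<lambda>t. f (t + w)) \<in> V" if "f \<in> V" "exp w = 1" for f w
    unfolding V_eq by (rule quasi_polynomial_span_properties(2)[of ?S]) (use S that V_eq in simp_all)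
  show "\<exists>S. finite S \<and> card S \<le> (\<Sum>i=1..n. N i) \<and> V \<subseteq> cfun.span S"
    unfolding V_eq card_I[symmetric] using finite_I card_image_le[OF finite_I] by blast
qed

text \<open>At \<open>\<infinity>\<close> the leading terms of the \<open>p\<^sub>i\<^sub>j\<close> have distinct exponents; at \<open>0\<close> the same holds for the lowest terms
  of the combinations which exist by non-degeneracy.\<close>

lemma fuchsian:
  assumes "fundamental_diff_op (\<Sum>i=1..n. N i) V b" and "singular_data (\<Sum>i=1..n. N i) V m l M mm"
  shows "fuchsian_space (\<Sum>i=1..n. N i) V b m l M mm rho"
proof
  show "fundamental_diff_op (\<Sum>i=1..n. N i) V b" and "singular_data (\<Sum>i=1..n. N i) V m l M mm" by fact+
  have inj: "nn i j = nn i j' \<Longrightarrow> j = j'" if "i \<in> {1..n}" "j \<in> {1..N i}" "j' \<in> {1..N i}" for i j j'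
    using data that strict_mono_on_imp_inj_on[of "{1..N i}" "nn i"] by (auto simp: qpoly_data_def dest: inj_onD)
  show "inj_on rho {..<\<Sum>i=1..n. N i}"
    unfolding rho_def[abs_def] card_I[symmetric] by (rule exponents_distinct[OF inj])
  show "\<exists>f. \<forall>i<\<Sum>i=1..n. N i. f i \<in> V \<and> power_like at_infinity (f i) (rho i)"
  proof (rule exI[of _ "\<lambda>k. case enum k of (i, j) \<Rightarrow> (\<lambda>t. exp (lam i * t) * poly (p i j) (exp t))"], safe)
    fix k assume "k < (\<Sum>i=1..n. N i)"
    hence "k < card I" by (simp only: card_I)
    then obtain i j where ij: "enum k = (i, j)" "i \<in> {1..n}" "j \<in> {1..N i}"
      using enum_in_I[of k] by (auto simp: I_def)
    have deg: "Polynomial.degree (p i j) = nn i j" "0 < nn i j"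
      using data ij(2,3) by (auto simp: qpoly_data_def)
    hence "p i j \<noteq> 0" by auto
    thus "power_like at_infinity (case enum k of (i, j) \<Rightarrow> (\<lambda>t. exp (lam i * t) * poly (p i j) (exp t))) (rho k)"
      using quasi_polynomial_at_infinity[of "p i j" "lam i"] by (simp add: ij(1) rho_def deg(1))
    show "(case enum k of (i, j) \<Rightarrow> (\<lambda>t. exp (lam i * t) * poly (p i j) (exp t))) \<in> V"
      using generator_in_V[OF ij(2,3)] by (simp add: ij(1))
  qed
  have "\<exists>f. f \<in> V \<and> power_like (at 0) f (lam i + of_nat (j - 1))" if ij: "i \<in> {1..n}" "j \<in> {1..N i}" for i j
  proof -
    obtain c where c: "(\<Sum>k=1..N i. Polynomial.smult (c k) (p i k)) \<noteq> 0"
      "Polynomial.order 0 (\<Sum>k=1..N i. Polynomial.smult (c k) (p i k)) = j - 1"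
      using nondegenerate ij unfolding qpoly_nondegenerate_def by meson
    let ?q = "\<Sum>k=1..N i. Polynomial.smult (c k) (p i k)"
    have "(\<lambda>t. exp (lam i * t) * poly ?q (exp t)) = (\<lambda>t. \<Sum>k=1..N i. c k * (exp (lam i * t) * poly (p i k) (exp t)))"
      by (simp add: fun_eq_iff poly_sum sum_distrib_left mult_ac)
    moreover have "(\<lambda>t. \<Sum>k=1..N i. c k * (exp (lam i * t) * poly (p i k) (exp t))) \<in> V"
      using generator_in_V ij(1) by (intro combination_in_space) auto
    ultimately show ?thesis using quasi_polynomial_at_0[OF c(1), of "lam i"] c(2) by auto
  qed
  then obtain f where f: "\<And>i j. i \<in> {1..n} \<Longrightarrow> j \<in> {1..N i} \<Longrightarrow>
      f i j \<in> V \<and> power_like (at 0) (f i j) (lam i + of_nat (j - 1))" by metis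
  show "\<exists>f \<rho>. inj_on \<rho> {..<\<Sum>i=1..n. N i} \<and>
      (\<forall>i<\<Sum>i=1..n. N i. f i \<in> V \<and> power_like (at 0) (f i) (\<rho> i))"
  proof (intro exI conjI)
    show "inj_on (\<lambda>k. case enum k of (i, j) \<Rightarrow> lam i + of_nat (j - 1)) {..<\<Sum>i=1..n. N i}"
      unfolding card_I[symmetric] by (rule exponents_distinct) auto
    show "\<forall>k<\<Sum>i=1..n. N i. (case enum k of (i, j) \<Rightarrow> f i j) \<in> V \<and>
        power_like (at 0) (case enum k of (i, j) \<Rightarrow> f i j) (case enum k of (i, j) \<Rightarrow> lam i + of_nat (j - 1))"
    proof safe
      fix k assume "k < (\<Sum>i=1..n. N i)"
      hence "k < card I" by (simp only: card_I)
      then obtain i j where ij: "enum k = (i, j)" "i \<in> {1..n}" "j \<in> {1..N i}"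
        using enum_in_I[of k] by (auto simp: I_def)
      thus "(case enum k of (i, j) \<Rightarrow> f i j) \<in> V"
        and "power_like (at 0) (case enum k of (i, j) \<Rightarrow> f i j) (case enum k of (i, j) \<Rightarrow> lam i + of_nat (j - 1))"
        using f by simp_all
    qed
  qed
qed

lemma prod_rho: "(\<Prod>k<\<Sum>i=1..n. N i. u - rho k) = (\<Prod>i=1..n. \<Prod>j=1..N i. u - lam i - of_nat (nn i j))"
proof -
  have "(\<Prod>k<card I. u - rho k) = (\<Prod>(i, j)\<in>I. u - lam i - of_nat (nn i j))"
    by (intro prod.reindex_bij_betw[OF enum, THEN trans[rotated]] prod.cong)
      (auto simp: rho_def split: prod.splits)
  also have "\<dots> = (\<Prod>i=1..n. \<Prod>j=1..N i. u - lam i - of_nat (nn i j))"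
    unfolding I_def by (rule prod.Sigma[symmetric]) auto
  finally show ?thesis by (simp add: card_I)
qed

end

section \<open>Quasi-exponentials\<close>

lemma shift_poly:
  fixes r :: "complex poly"
  shows "Polynomial.degree (r \<circ>\<^sub>p [:1, 1:]) = Polynomial.degree r"
    and "lead_coeff (r \<circ>\<^sub>p [:1, 1:]) = lead_coeff r"
    and "poly (r \<circ>\<^sub>p [:1, 1:]) x = poly r (x + 1)"
  using lead_coeff_comp[of "[:1, 1:]" r] by (simp_all add: degree_pcompose poly_pcompose add.commute)

text \<open>For a fixed base \<open>w\<close>, the operator which maps \<open>f(n)\<close> to \<open>f(n + 1) - w f(n)\<close> decreases the degree of
  the coefficient of \<open>w\<^sup>n\<close> and preserves the degrees of the others.\<close>

lemma exponential_polynomials_independent: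
  fixes z :: "'a \<Rightarrow> complex" and r :: "'a \<Rightarrow> complex poly"
  assumes A: "finite A" "inj_on z A" "\<And>a. a \<in> A \<Longrightarrow> z a \<noteq> 0"
    and 0: "\<And>n. (\<Sum>a\<in>A. z a ^ n * poly (r a) (of_nat n)) = 0"
    and a: "a \<in> A"
  shows "r a = 0"
proof -
  define \<mu> where "\<mu> r = (\<Sum>a\<in>A. if r a = 0 then 0 else Suc (Polynomial.degree (r a)))" for r :: "'a \<Rightarrow> complex poly"
  have "\<forall>a\<in>A. r a = 0" using 0
  proof (induction "\<mu> r" arbitrary: r rule: less_induct)
    case less
    show ?case
    proof (rule ccontr)
      assume "\<not> ?thesis"
      then obtain a0 where a0: "a0 \<in> A" "r a0 \<noteq> 0" by blast
      define r' where "r' a = Polynomial.smult (z a) (r a \<circ>\<^sub>p [:1, 1:]) - Polynomial.smult (z a0) (r a)" for a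
      have deg: "Polynomial.degree (r' a) \<le> Polynomial.degree (r a)" for a
        unfolding r'_def by (intro degree_diff_le) (simp_all add: degree_smult_le shift_poly(1) order_trans[OF degree_smult_le])
      have lead: "Polynomial.coeff (r' a) (Polynomial.degree (r a)) = (z a - z a0) * lead_coeff (r a)" for a
        using shift_poly(2)[of "r a"] by (simp add: r'_def shift_poly(1) left_diff_distrib)
      have zero: "r' a = 0" if "r a = 0" for a using that by (simp add: r'_def)
      have "\<mu> r' < \<mu> r"
        unfolding \<mu>_def
      proof (rule sum_strict_mono_ex1[OF A(1)])
        show "\<forall>a\<in>A. (if r' a = 0 then 0 else Suc (Polynomial.degree (r' a)))
            \<le> (if r a = 0 then 0 else Suc (Polynomial.degree (r a)))"
          using deg zero by auto
        have "r' a0 = 0 \<or> Polynomial.degree (r' a0) < Polynomial.degree (r a0)"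
          using lead[of a0] deg[of a0] by (intro eq_zero_or_degree_less) auto
        thus "\<exists>a\<in>A. (if r' a = 0 then 0 else Suc (Polynomial.degree (r' a)))
            < (if r a = 0 then 0 else Suc (Polynomial.degree (r a)))"
          using a0 by (intro bexI[of _ a0]) auto
      qed
      moreover have "(\<Sum>a\<in>A. z a ^ n * poly (r' a) (of_nat n)) = 0" for n
      proof -
        have "(\<Sum>a\<in>A. z a ^ n * poly (r' a) (of_nat n))
            = (\<Sum>a\<in>A. z a ^ Suc n * poly (r a) (of_nat (Suc n)) - z a0 * (z a ^ n * poly (r a) (of_nat n)))"
          by (intro sum.cong refl) (simp add: r'_def shift_poly(3) algebra_simps)
        also have "\<dots> = (\<Sum>a\<in>A. z a ^ Suc n * poly (r a) (of_nat (Suc n))) - z a0 * (\<Sum>a\<in>A. z a ^ n * poly (r a) (of_nat n))"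
          by (simp only: sum_subtractf sum_distrib_left)
        also have "\<dots> = 0" by (simp only: less.prems) simp
        finally show ?thesis .
      qed
      ultimately have r': "\<forall>a\<in>A. r' a = 0" by (rule less.hyps)
      have other: "r a = 0" if "a \<in> A" "a \<noteq> a0" for a
      proof -
        have "z a \<noteq> z a0" using inj_onD[OF A(2)] that a0(1) by blast
        moreover have "(z a - z a0) * lead_coeff (r a) = 0" using lead[of a] r' that(1) by simp
        ultimately show ?thesis by simp
      qed
      have "poly (r a0) (of_nat n) = 0" for n
      proof -
        have "(\<Sum>a\<in>A. z a ^ n * poly (r a) (of_nat n)) = (\<Sum>a\<in>{a0}. z a ^ n * poly (r a) (of_nat n))"
          using a0 other A(1) by (intro sum.mono_neutral_right) auto
        thus ?thesis using less.prems[of n] A(3)[OF a0(1)] by simp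
      qed
      hence "r a0 = 0"
        by (intro poly_eq_0_if_many_roots[of _ "Suc (Polynomial.degree (r a0))" of_nat]) (auto simp: inj_on_def)
      with a0 show False by simp
    qed
  qed
  with a show ?thesis by blast
qed

text \<open>Filling up with zero rows gives a singular square matrix.\<close>

lemma underdetermined_system:
  fixes K d :: nat
  assumes "K < d"
  shows "\<exists>c. (\<exists>k<d. c k \<noteq> 0) \<and> (\<forall>i<K. (\<Sum>k<d. A i k * c k) = (0::complex))"
proof -
  define A' where "A' i k = (if i < K then A i k else 0)" for i k
  have "sqdet d (\<lambda>i k. A' k i) = 0"
  proof -
    define e where "e k = (if k = d - 1 then 1 else 0 :: complex)" for k
    have "d - 1 < d" "e (d - 1) \<noteq> 0" using assms by (auto simp: e_def)
    moreover have "(\<Sum>k<d. A' k i * e k) = 0" for i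
      using assms by (intro sum.neutral) (auto simp: A'_def e_def)
    ultimately show ?thesis unfolding sqdet_eq_0_iff by blast
  qed
  hence "sqdet d A' = 0" using sqdet_transpose[of d A'] by simp
  then obtain c where c: "\<exists>k<d. c k \<noteq> 0" "\<forall>i<d. (\<Sum>k<d. A' i k * c k) = 0"
    unfolding sqdet_eq_0_iff by blast
  have "(\<Sum>k<d. A i k * c k) = 0" if "i < K" for i
    using c(2)[rule_format, of i] that assms by (simp add: A'_def)
  with c(1) show ?thesis by blast
qed

locale quasi_exponentials =
  fixes m :: nat and l :: "nat \<Rightarrow> complex" and M :: "nat \<Rightarrow> nat" and mm :: "nat \<Rightarrow> nat \<Rightarrow> nat"
    and q :: "nat \<Rightarrow> nat \<Rightarrow> complex poly"
  assumes data: "qexp_data m l M mm q"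
begin

abbreviation U :: "(complex \<Rightarrow> complex) set" where "U \<equiv> qexp_space m l M q"

definition combination :: "(nat \<Rightarrow> nat \<Rightarrow> complex) \<Rightarrow> nat \<Rightarrow> complex poly" where
  "combination c a = (\<Sum>b=1..M a. Polynomial.smult (c a b) (q a b))"

lemma combination_degree:
  assumes a: "a \<in> {1..m}" and b: "b \<in> {1..M a}" "c a b \<noteq> 0"
  shows "combination c a \<noteq> 0"
    and "\<exists>b\<in>{1..M a}. Polynomial.degree (combination c a) = mm a b"
proof -
  have pos: "0 < mm a b \<and> Polynomial.degree (q a b) = mm a b" if "b \<in> {1..M a}" for b
    using data a that unfolding qexp_data_def by blast
  have deg: "Polynomial.degree (q a b) = mm a b" "q a b \<noteq> 0" if "b \<in> {1..M a}" for b
    using pos[OF that] by auto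
  have "strict_mono_on {1..M a} (mm a)" using data a unfolding qexp_data_def by blast
  hence "inj_on (mm a) {1..M a}" by (rule strict_mono_on_imp_inj_on)
  hence inj: "inj_on (\<lambda>b. Polynomial.degree (q a b)) {1..M a}"
    using deg(1) by (metis (no_types, lifting) inj_on_cong)
  note * = degree_combination[OF _ inj deg(2) b(1), of "c a"]
  show "combination c a \<noteq> 0" unfolding combination_def by (rule *(1)) (use b in auto)
  have "\<exists>b\<in>{1..M a}. Polynomial.degree (combination c a) = Polynomial.degree (q a b)"
    unfolding combination_def by (rule *(2)) (use b in auto)
  thus "\<exists>b\<in>{1..M a}. Polynomial.degree (combination c a) = mm a b" using deg(1) by auto
qed

lemma combination_in_U: "(\<lambda>u. \<Sum>a=1..m. exp (u * l a) * poly (combination c a) u) \<in> U"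
proof -
  have "(\<Sum>a=1..m. \<Sum>b=1..M a. (\<lambda>u. c a b * (exp (u * l a) * poly (q a b) u))) \<in> U"
    unfolding qexp_space_def
    by (intro cfun.span_sum cfun.span_scale cfun.span_base) blast
  moreover have "(\<Sum>a=1..m. \<Sum>b=1..M a. (\<lambda>u. c a b * (exp (u * l a) * poly (q a b) u)))
      = (\<lambda>u. \<Sum>a=1..m. exp (u * l a) * poly (combination c a) u)"
    by (intro ext) (simp add: sum_fun_apply combination_def poly_sum sum_distrib_left mult_ac)
  ultimately show ?thesis by simp
qed

lemma U_combination:
  assumes "f \<in> U"
  obtains c where "f = (\<lambda>u. \<Sum>a=1..m. exp (u * l a) * poly (combination c a) u)"
proof -
  define \<Phi> where "\<Phi> c = (\<lambda>u. \<Sum>a=1..m. exp (u * l a) * poly (combination c a) u)" for c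
  have "f \<in> range \<Phi>"
  proof (rule cfun.span_induct[OF assms[unfolded qexp_space_def]])
    have zero: "0 = \<Phi> (\<lambda>_ _. 0)"
      by (rule ext) (simp add: \<Phi>_def combination_def)
    have add: "\<Phi> c + \<Phi> c' = \<Phi> (\<lambda>a b. c a b + c' a b)" for c c'
      by (rule ext) (simp add: \<Phi>_def combination_def smult_add_left sum.distrib distrib_left)
    have scale: "(\<lambda>u. k * \<Phi> c u) = \<Phi> (\<lambda>a b. k * c a b)" for c k
    proof
      have "poly (combination (\<lambda>a b. k * c a b) a) u = k * poly (combination c a) u" for a u
        by (simp add: combination_def poly_sum sum_distrib_left mult_ac)
      thus "k * \<Phi> c u = \<Phi> (\<lambda>a b. k * c a b) u" for u
        by (simp add: \<Phi>_def sum_distrib_left mult_ac)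
    qed
    have "cfun.subspace (range \<Phi>)"
    proof (rule cfun.subspaceI)
      show "0 \<in> range \<Phi>" unfolding zero by (rule rangeI)
      fix f g and k :: complex assume "f \<in> range \<Phi>"
      then obtain c where c: "f = \<Phi> c" by blast
      show "(\<lambda>u. k * f u) \<in> range \<Phi>" unfolding c scale by (rule rangeI)
      assume "g \<in> range \<Phi>"
      then obtain c' where c': "g = \<Phi> c'" by blast
      show "f + g \<in> range \<Phi>" unfolding c c' add by (rule rangeI)
    qed
    thus "cfun.subspace {f. f \<in> range \<Phi>}" by simp
  next
    fix f assume "f \<in> {\<lambda>u. exp (u * l a) * poly (q a b) u |a b. a \<in> {1..m} \<and> b \<in> {1..M a}}"
    then obtain a b where ab: "f = (\<lambda>u. exp (u * l a) * poly (q a b) u)" "a \<in> {1..m}" "b \<in> {1..M a}" by blast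
    define c where "c a' b' = (if a' = a \<and> b' = b then 1 else 0 :: complex)" for a' b'
    have comb: "combination c a' = (if a' = a then q a b else 0)" for a'
    proof (cases "a' = a")
      case True
      have "combination c a = (\<Sum>b'\<in>{b}. Polynomial.smult (c a b') (q a b'))"
        unfolding combination_def using ab(3) by (intro sum.mono_neutral_right) (auto simp: c_def)
      thus ?thesis using True by (simp add: c_def)
    qed (simp add: combination_def c_def)
    have "f u = \<Phi> c u" for u
    proof -
      have "\<Phi> c u = (\<Sum>a'\<in>{a}. exp (u * l a') * poly (combination c a') u)"
        unfolding \<Phi>_def using ab(2) by (intro sum.mono_neutral_right) (auto simp: comb)
      thus ?thesis by (simp add: comb ab(1))
    qed
    hence "f = \<Phi> c" by (rule ext)
    thus "f \<in> range \<Phi>" by blast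
  qed
  then obtain c where "f = \<Phi> c" by blast
  thus ?thesis using that[of c] by (simp only: \<Phi>_def)
qed

lemma zero_if_zero_on_progression:
  assumes 0: "\<And>n. (\<Sum>a=1..m. exp ((u0 + of_nat n) * l a) * poly (r a) (u0 + of_nat n)) = 0"
    and a: "a \<in> {1..m}"
  shows "r a = 0"
proof -
  define r' where "r' a = Polynomial.smult (exp (u0 * l a)) (r a \<circ>\<^sub>p [:u0, 1:])" for a
  have "(\<Sum>a=1..m. exp (l a) ^ n * poly (r' a) (of_nat n)) = 0" for n
  proof -
    have "exp (l a) ^ n * poly (r' a) (of_nat n) = exp ((u0 + of_nat n) * l a) * poly (r a) (u0 + of_nat n)" for a
      by (simp add: r'_def poly_pcompose distrib_right exp_add exp_of_nat_mult)
    thus ?thesis using 0[of n] by simp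
  qed
  moreover have "inj_on (\<lambda>a. exp (l a)) {1..m}" using data by (simp add: qexp_data_def)
  ultimately have "r' a = 0"
    using exponential_polynomials_independent[of "{1..m}" "\<lambda>a. exp (l a)" r' a] a by simp
  hence "r a \<circ>\<^sub>p [:u0, 1:] = 0" by (simp add: r'_def)
  thus ?thesis by (rule pcompose_eq_0) simp
qed

lemma degree_of_summand:
  assumes f: "(\<lambda>u. exp (u * l a) * poly r u) \<in> U" and a: "a \<in> {1..m}" and r: "r \<noteq> 0"
  shows "\<exists>b\<in>{1..M a}. Polynomial.degree r = mm a b"
proof -
  obtain c where c: "(\<lambda>u. exp (u * l a) * poly r u) = (\<lambda>u. \<Sum>a=1..m. exp (u * l a) * poly (combination c a) u)"
    using U_combination[OF f] by blast
  have zero: "(\<Sum>a'=1..m. exp (u * l a') * poly (combination c a' - (if a' = a then r else 0)) u) = 0" for u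
  proof -
    have "(\<Sum>a'=1..m. exp (u * l a') * poly (combination c a' - (if a' = a then r else 0)) u)
        = (\<Sum>a'=1..m. exp (u * l a') * poly (combination c a') u) - (\<Sum>a'=1..m. exp (u * l a') * poly (if a' = a then r else 0) u)"
      by (simp add: right_diff_distrib sum_subtractf)
    also have "(\<Sum>a'=1..m. exp (u * l a') * poly (if a' = a then r else 0) u)
        = (\<Sum>a'\<in>{a}. exp (u * l a') * poly (if a' = a then r else 0) u)"
      using a by (intro sum.mono_neutral_right) auto
    finally show ?thesis using fun_cong[OF c, of u] by simp
  qed
  have "combination c a - (if a = a then r else 0) = 0"
    by (rule zero_if_zero_on_progression[of 0 "\<lambda>a'. combination c a' - (if a' = a then r else 0)", OF zero a])
  hence rc: "r = combination c a" by simp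
  have "\<exists>b\<in>{1..M a}. c a b \<noteq> 0"
  proof (rule ccontr)
    assume "\<not> ?thesis"
    hence "combination c a = 0" unfolding combination_def by (intro sum.neutral) simp
    with rc r show False by simp
  qed
  thus ?thesis using combination_degree(2)[OF a] rc by blast
qed

text \<open>The dimension count for difference equations: away from the zeros of its leading coefficient, an
  operator of order \<open>K\<close> determines a solution on \<open>u\<^sub>0 + \<nat>\<close> by the first \<open>K\<close> values, and a
  quasi-exponential is determined by its values there.\<close>

lemma short_annihilator_zero:
  fixes \<gamma> :: "nat \<Rightarrow> complex poly"
  assumes ann: "\<And>f u. f \<in> U \<Longrightarrow> (\<Sum>j\<le>J. poly (\<gamma> j) u * f (u + of_nat j)) = 0"
    and J: "J < (\<Sum>a=1..m. M a)" and j: "j \<le> J"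
  shows "\<gamma> j = 0"
proof (rule ccontr)
  define d where "d = (\<Sum>a=1..m. M a)"
  assume "\<gamma> j \<noteq> 0"
  define K where "K = Max {j. j \<le> J \<and> \<gamma> j \<noteq> 0}"
  have "K \<in> {j. j \<le> J \<and> \<gamma> j \<noteq> 0}"
    unfolding K_def using j \<open>\<gamma> j \<noteq> 0\<close> by (intro Max_in) auto
  hence K: "K \<le> J" "\<gamma> K \<noteq> 0" by auto
  have above: "\<gamma> j = 0" if "K < j" "j \<le> J" for j
  proof (rule ccontr)
    assume "\<gamma> j \<noteq> 0"
    hence "j \<le> K" unfolding K_def using that(2) by (intro Max_ge) auto
    with that(1) show False by simp
  qed
  obtain B where B: "\<And>x. poly (\<gamma> K) x = 0 \<Longrightarrow> norm x \<le> B"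
    using finite_imp_bounded[OF poly_roots_finite[OF K(2)]] by (auto simp: bounded_iff)
  \<comment> \<open>Beyond all zeros of the leading coefficient, so that the recursion never breaks down.\<close>
  define u0 where "u0 = complex_of_real (\<bar>B\<bar> + 1)"
  have regular: "poly (\<gamma> K) (u0 + of_nat n) \<noteq> 0" for n
  proof
    assume "poly (\<gamma> K) (u0 + of_nat n) = 0"
    hence "norm (u0 + of_nat n) \<le> B" by (rule B)
    moreover have "u0 + of_nat n = complex_of_real (\<bar>B\<bar> + 1 + real n)" by (simp add: u0_def)
    hence "norm (u0 + of_nat n) = \<bar>B\<bar> + 1 + real n" by (simp only: norm_of_real)
    ultimately show False by linarith
  qed
  define I where "I = Sigma {1..m} (\<lambda>a. {1..M a})"
  have "finite I" "card I = d" by (simp_all add: I_def d_def)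
  then obtain h where h: "bij_betw h {..<d} I"
    using ex_bij_betw_nat_finite[of I] by (auto simp: atLeast0LessThan)
  define F where "F k u = (case h k of (a, b) \<Rightarrow> exp (u * l a) * poly (q a b) u)" for k u
  obtain c0 where c0: "\<exists>k<d. c0 k \<noteq> 0" "\<forall>i<K. (\<Sum>k<d. F k (u0 + of_nat i) * c0 k) = 0"
    using underdetermined_system[of K d "\<lambda>i k. F k (u0 + of_nat i)"] K(1) J by (auto simp: d_def)
  define c where "c a b = c0 (the_inv_into {..<d} h (a, b))" for a b
  define f where "f u = (\<Sum>a=1..m. exp (u * l a) * poly (combination c a) u)" for u
  have hk: "c a b = c0 k" if "k < d" "h k = (a, b)" for k a b
    using the_inv_into_f_f[of h "{..<d}" k] h that by (simp add: c_def bij_betw_def)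
  have f_eq: "f u = (\<Sum>k<d. F k u * c0 k)" for u
  proof -
    have "f u = (\<Sum>(a, b)\<in>I. c a b * (exp (u * l a) * poly (q a b) u))"
    proof -
      have "f u = (\<Sum>a=1..m. \<Sum>b=1..M a. c a b * (exp (u * l a) * poly (q a b) u))"
        unfolding f_def combination_def by (simp add: poly_sum sum_distrib_left mult_ac)
      also have "\<dots> = (\<Sum>(a, b)\<in>I. c a b * (exp (u * l a) * poly (q a b) u))"
        unfolding I_def by (rule sum.Sigma) auto
      finally show ?thesis .
    qed
    also have "\<dots> = (\<Sum>k<d. case h k of (a, b) \<Rightarrow> c a b * (exp (u * l a) * poly (q a b) u))"
      by (rule sum.reindex_bij_betw[OF h, symmetric])
    also have "\<dots> = (\<Sum>k<d. F k u * c0 k)"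
      by (intro sum.cong refl) (auto simp: F_def hk split: prod.splits)
    finally show ?thesis .
  qed
  have fU: "f \<in> U" using combination_in_U[of c] by (simp add: f_def[abs_def])
  have "f (u0 + of_nat n) = 0" for n
  proof (induction n rule: less_induct)
    case (less n)
    show ?case
    proof (cases "n < K")
      case True
      thus ?thesis using c0(2) f_eq by simp
    next
      case False
      define u where "u = u0 + of_nat (n - K)"
      have u: "u + of_nat j = u0 + of_nat (n - K + j)" for j by (simp add: u_def)
      have "(\<Sum>j\<le>J. poly (\<gamma> j) u * f (u + of_nat j)) = (\<Sum>j\<in>{K}. poly (\<gamma> j) u * f (u + of_nat j))"
      proof (intro sum.mono_neutral_right ballI)
        fix j assume j: "j \<in> {..J} - {K}"
        show "poly (\<gamma> j) u * f (u + of_nat j) = 0"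
        proof (cases "j < K")
          case True
          hence "f (u + of_nat j) = 0" unfolding u using False by (intro less.IH) auto
          thus ?thesis by simp
        qed (use j above in auto)
      qed (use K in auto)
      hence "poly (\<gamma> K) u * f (u + of_nat K) = 0" using ann[OF fU, of u] by simp
      hence "f (u + of_nat K) = 0" using regular[of "n - K"] by (simp add: u_def)
      moreover have "u + of_nat K = u0 + of_nat n" using u[of K] False by simp
      ultimately show ?thesis by (simp only:)
    qed
  qed
  hence zero: "combination c a = 0" if "a \<in> {1..m}" for a
    using zero_if_zero_on_progression[of u0 "combination c", OF _ that] by (simp add: f_def)
  obtain k where k: "k < d" "c0 k \<noteq> 0" using c0(1) by blast
  obtain a b where ab: "h k = (a, b)" by (rule prod.exhaust)
  have "h k \<in> I" using bij_betwE[OF h] k(1) by simp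
  hence "(a, b) \<in> I" using ab by simp
  hence "combination c a \<noteq> 0"
    using combination_degree(1)[of a b c] hk[OF k(1) ab] k(2) by (simp add: I_def)
  with zero \<open>(a, b) \<in> I\<close> show False by (auto simp: I_def)
qed

end

section \<open>Integrals over small circles\<close>

lemma higher_deriv_along_branch:
  assumes f: "f holomorphic_on UNIV" and x: "x \<in> ball (exp s) (norm (exp s))"
  shows "(deriv ^^ k) (\<lambda>x. f (ln_branch s x)) x = (xderiv ^^ k) f (ln_branch s x)"
  using x
proof (induction k arbitrary: x)
  case (Suc k)
  have "\<forall>\<^sub>F y in nhds x. y \<in> ball (exp s) (norm (exp s))"
    using Suc.prems by (intro eventually_nhds_in_open) auto
  hence "\<forall>\<^sub>F y in nhds x. (deriv ^^ k) (\<lambda>x. f (ln_branch s x)) y = (xderiv ^^ k) f (ln_branch s y)"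
    by eventually_elim (rule Suc.IH)
  hence "deriv ((deriv ^^ k) (\<lambda>x. f (ln_branch s x))) x = deriv (\<lambda>y. (xderiv ^^ k) f (ln_branch s y)) x"
    by (rule deriv_cong_ev) simp
  also have "\<dots> = (xderiv ^^ Suc k) f (ln_branch s x)"
    by (rule DERIV_imp_deriv[OF has_field_derivative_along_branch[OF f Suc.prems]])
  finally show ?case by simp
qed simp

text \<open>By Cauchy's formula the integral is, up to a constant, the \<open>k\<close>-th derivative at \<open>z\<close> of \<open>x\<^sup>u H(x)\<close> with
  \<open>H(z) \<noteq> 0\<close>. The Leibniz rule gives \<open>z\<^sup>u\<close> times a combination of the falling factorials of \<open>u\<close> of order at
  most \<open>k\<close>, and the last one has the coefficient \<open>z\<^bsup>-k\<^esup> H(z)\<close>.\<close>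

lemma pole_integral:
  assumes r: "0 < r" "cball (exp s) r \<subseteq> T" and T: "open T" "T \<subseteq> ball (exp s) (norm (exp s))"
    and F: "F holomorphic_on T - {exp s}"
    and lim: "((\<lambda>x. (x - exp s) ^ Suc k * F x) \<longlongrightarrow> c) (at (exp s))" and c: "c \<noteq> 0"
  obtains p where "Polynomial.degree p = k" "p \<noteq> 0"
    "\<And>u. contour_integral (circlepath (exp s) r) (\<lambda>x. exp (u * ln_branch s x) * F x) = exp (u * s) * poly p u"
proof -
  define z where "z = exp s"
  have zT: "z \<in> T" using r unfolding z_def by force
  have "(\<lambda>x. (x - z) ^ Suc k * F x) \<in> O[at z](\<lambda>_. 1)"
    using lim by (intro bigoI_tendsto[where c = c]) (auto simp: z_def)
  moreover have "(\<lambda>x. (x - z) ^ Suc k * F x) holomorphic_on T - {z}"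
    using F unfolding z_def by (intro holomorphic_intros)
  ultimately have "\<exists>H. H holomorphic_on T \<and> (\<forall>x\<in>T - {z}. H x = (x - z) ^ Suc k * F x)"
    using zT T(1) by (intro removable_singularities) (auto simp: interior_open)
  then obtain H where H: "H holomorphic_on T" "\<And>x. x \<in> T - {z} \<Longrightarrow> H x = (x - z) ^ Suc k * F x"
    by blast
  have "H z = c"
  proof -
    have "isCont H z"
      using holomorphic_on_imp_continuous_on[OF H(1)] zT T(1) by (simp add: continuous_on_eq_continuous_at)
    hence "(H \<longlongrightarrow> H z) (at z)" by (simp add: isCont_def)
    moreover have "(H \<longlongrightarrow> c) (at z)"
    proof (rule Lim_transform_eventually[OF lim[folded z_def]])
      show "\<forall>\<^sub>F x in at z. (x - z) ^ Suc k * F x = H x"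
        using eventually_at_in_open[OF T(1) zT] by eventually_elim (simp add: H(2))
    qed
    ultimately show ?thesis using tendsto_unique[OF at_neq_bot] by blast
  qed
  define w where "w i = 2 * of_real pi * \<i> / fact k * (of_nat (k choose i) * exp (- of_nat i * s) * (deriv ^^ (k - i)) H z)" for i
  define p where "p = (\<Sum>i\<le>k. Polynomial.smult (w i) (falling_poly i))"
  have coeff: "Polynomial.coeff p k = w k"
  proof -
    have "Polynomial.coeff p k = (\<Sum>i\<le>k. if i = k then w k else 0)"
      unfolding p_def coeff_sum by (intro sum.cong refl) (auto intro!: coeff_eq_0)
    thus ?thesis by simp
  qed
  moreover have wk: "w k \<noteq> 0" using c \<open>H z = c\<close> by (simp add: w_def)
  moreover have "Polynomial.degree p \<le> k"
    unfolding p_def by (intro degree_sum_le) (auto intro: order_trans[OF degree_smult_le])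
  ultimately have "Polynomial.degree p = k" "p \<noteq> 0"
    using le_degree[of p k] by (auto intro: antisym)
  moreover have "contour_integral (circlepath z r) (\<lambda>x. exp (u * ln_branch s x) * F x) = exp (u * s) * poly p u" for u
  proof -
    let ?E = "\<lambda>x. exp (u * ln_branch s x)"
    have powhol: "(\<lambda>t. exp (u * t)) holomorphic_on UNIV" by (intro holomorphic_intros)
    have E: "?E holomorphic_on ball z (norm z)"
      using holomorphic_along_branch[OF powhol, of 0 s] by (simp add: z_def)
    have EH: "(\<lambda>x. ?E x * H x) holomorphic_on T"
      using holomorphic_on_subset[OF E, of T] H(1) T(2) by (intro holomorphic_on_mult) (auto simp: z_def)
    have "((\<lambda>x. (?E x * H x) / (x - z) ^ Suc k) has_contour_integral
        ((2 * pi * \<i>) / fact k * (deriv ^^ k) (\<lambda>x. ?E x * H x) z)) (circlepath z r)"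
    proof (rule Cauchy_has_contour_integral_higher_derivative_circlepath)
      show "continuous_on (cball z r) (\<lambda>x. ?E x * H x)"
        using holomorphic_on_imp_continuous_on[OF EH] r(2) continuous_on_subset unfolding z_def by blast
      show "(\<lambda>x. ?E x * H x) holomorphic_on ball z r"
        using EH r(2) ball_subset_cball holomorphic_on_subset unfolding z_def by blast
      show "z \<in> ball z r" using r(1) by simp
    qed
    moreover have "(?E x * H x) / (x - z) ^ Suc k = ?E x * F x" if "x \<in> path_image (circlepath z r)" for x
    proof -
      have "norm (x - z) = r" using that r(1) by (simp add: path_image_circlepath dist_norm norm_minus_commute)
      hence "x \<noteq> z" "x \<in> cball z r" using r(1) by (auto simp: dist_norm norm_minus_commute)
      hence "H x = (x - z) ^ Suc k * F x" using r(2) by (intro H(2)) (auto simp: z_def)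
      thus ?thesis using \<open>x \<noteq> z\<close> by simp
    qed
    ultimately have int: "((\<lambda>x. ?E x * F x) has_contour_integral
        ((2 * pi * \<i>) / fact k * (deriv ^^ k) (\<lambda>x. ?E x * H x) z)) (circlepath z r)"
      by (rule has_contour_integral_eq)
    have "(deriv ^^ k) (\<lambda>x. ?E x * H x) z
        = (\<Sum>i=0..k. of_nat (k choose i) * (deriv ^^ i) ?E z * (deriv ^^ (k - i)) H z)"
      by (rule higher_deriv_mult[of _ T]) (use E T H(1) zT in \<open>auto simp: z_def intro: holomorphic_on_subset\<close>)
    also have "\<dots> = (\<Sum>i\<le>k. of_nat (k choose i) * (poly (falling_poly i) u * exp ((u - of_nat i) * s)) * (deriv ^^ (k - i)) H z)"
    proof (rule sum.cong)
      fix i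
      have "(deriv ^^ i) ?E z = poly (falling_poly i) u * exp ((u - of_nat i) * s)"
        using higher_deriv_along_branch[OF powhol, of z s i] by (simp add: z_def xderiv_funpow_power)
      thus "of_nat (k choose i) * (deriv ^^ i) ?E z * (deriv ^^ (k - i)) H z
          = of_nat (k choose i) * (poly (falling_poly i) u * exp ((u - of_nat i) * s)) * (deriv ^^ (k - i)) H z"
        by simp
    qed auto
    also have "(2 * pi * \<i>) / fact k * \<dots> = exp (u * s) * poly p u"
      unfolding p_def poly_sum sum_distrib_left
    proof (intro sum.cong refl)
      fix i
      have "exp ((u - of_nat i) * s) = exp (u * s) * exp (- of_nat i * s)"
        by (simp add: exp_add[symmetric] algebra_simps)
      thus "(2 * pi * \<i>) / fact k * (of_nat (k choose i) * (poly (falling_poly i) u * exp ((u - of_nat i) * s)) * (deriv ^^ (k - i)) H z)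
          = exp (u * s) * poly (Polynomial.smult (w i) (falling_poly i)) u"
        by (simp only: w_def poly_smult) (simp add: mult_ac)
    qed
    finally show ?thesis using contour_integral_unique[OF int] by simp
  qed
  ultimately show ?thesis using that unfolding z_def by blast
qed

context fuchsian_space
begin

text \<open>Over this set the branch of the logarithm at \<open>z\<^sub>a\<close> is defined and the equation is regular.\<close>

definition regular_disc :: "nat \<Rightarrow> complex set" where
  "regular_disc a = ball (exp (l a)) (norm (exp (l a))) - Z"

lemma open_regular_disc: "open (regular_disc a)"
  unfolding regular_disc_def using finite_Z by (intro open_Diff finite_imp_closed) auto

lemma regular_discD:
  assumes "x \<in> regular_disc a"
  shows "x \<in> ball (exp (l a)) (norm (exp (l a)))" "x \<noteq> 0" "x \<notin> Z" "exp (ln_branch (l a) x) = x"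
  using assms nonzero_in_disc exp_ln_branch unfolding regular_disc_def by blast+

lemma wronskian_holomorphic:
  assumes "\<And>i. i \<in> {1..k} \<Longrightarrow> f i \<in> V"
  shows "(\<lambda>x. wronskian k f (ln_branch (l a) x)) holomorphic_on regular_disc a"
  unfolding wronskian_eq_sqdet
proof (rule holomorphic_sqdet)
  fix i j assume "i < k" "j < k"
  hence "f (Suc i) holomorphic_on UNIV" using assms by (intro entire) auto
  thus "(\<lambda>x. (xderiv ^^ j) (f (Suc i)) (ln_branch (l a) x)) holomorphic_on regular_disc a"
    using holomorphic_on_subset[OF holomorphic_along_branch] unfolding regular_disc_def by blast
qed

text \<open>Variation of constants: for \<open>\<phi> = x\<^sup>u\<close> and \<open>h = Wr(f\<^sub>1, \<dots>, f\<^sub>d\<^sub>-\<^sub>1) / Wr\<^sub>V\<close>, the function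
  \<open>Wr(f\<^sub>1, \<dots>, f\<^sub>d\<^sub>-\<^sub>1, \<phi>) / Wr\<^sub>V\<close> is a primitive of \<open>D\<phi> \<cdot> h\<close>.\<close>

lemma star_space_primitive:
  assumes h: "h \<in> star_space d V" and a: "a \<in> {1..m}"
  shows "(\<lambda>x. h (ln_branch (l a) x)) holomorphic_on regular_disc a \<and>
    (\<forall>u. \<exists>c. \<forall>x\<in>regular_disc a. (c has_field_derivative
        monic_diff_op d b (\<lambda>t. exp (u * t)) (ln_branch (l a) x) * h (ln_branch (l a) x)) (at x))"
    (is "?P h")
proof (rule cfun.span_induct[OF h[unfolded star_space_def]])
  show "cfun.subspace {h. ?P h}"
  proof (rule cfun.subspaceI; (unfold mem_Collect_eq)?)
    show "?P 0" by (auto intro!: exI[of _ "\<lambda>_. 0"])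
    fix h assume h: "?P h"
    show "?P (\<lambda>t. k * h t)" for k
    proof (intro conjI allI)
      fix u
      obtain c where "\<forall>x\<in>regular_disc a. (c has_field_derivative
        monic_diff_op d b (\<lambda>t. exp (u * t)) (ln_branch (l a) x) * h (ln_branch (l a) x)) (at x)" using h by blast
      thus "\<exists>c. \<forall>x\<in>regular_disc a. (c has_field_derivative
        monic_diff_op d b (\<lambda>t. exp (u * t)) (ln_branch (l a) x) * (k * h (ln_branch (l a) x))) (at x)"
        by (intro exI[of _ "\<lambda>x. k * c x"]) (auto intro!: derivative_eq_intros)
    qed (use h in \<open>auto intro!: holomorphic_intros\<close>)
    fix h' assume h': "?P h'"
    show "?P (h + h')"
    proof (intro conjI allI)
      fix u
      obtain c where c: "\<forall>x\<in>regular_disc a. (c has_field_derivative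
        monic_diff_op d b (\<lambda>t. exp (u * t)) (ln_branch (l a) x) * h (ln_branch (l a) x)) (at x)" using h by blast
      obtain c' where c': "\<forall>x\<in>regular_disc a. (c' has_field_derivative
        monic_diff_op d b (\<lambda>t. exp (u * t)) (ln_branch (l a) x) * h' (ln_branch (l a) x)) (at x)" using h' by blast
      show "\<exists>c. \<forall>x\<in>regular_disc a. (c has_field_derivative
        monic_diff_op d b (\<lambda>t. exp (u * t)) (ln_branch (l a) x) * (h + h') (ln_branch (l a) x)) (at x)"
        using c c' by (intro exI[of _ "\<lambda>x. c x + c' x"]) (auto intro!: derivative_eq_intros simp: distrib_left)
    qed (use h h' in \<open>auto intro!: holomorphic_intros\<close>)
  qed
next
  fix h assume "h \<in> {\<lambda>t. wronskian (d - 1) f t / wronskian d g t |f g. (\<forall>i\<in>{1..d - 1}. f i \<in> V) \<and> basis_of d g V}"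
  then obtain f g where h: "h = (\<lambda>t. wronskian (d - 1) f t / wronskian d g t)"
    and f: "\<And>i. i \<in> {1..d - 1} \<Longrightarrow> f i \<in> V" and g: "basis_of d g V" by blast
  have gV: "g i \<in> V" if "i \<in> {1..d}" for i
    using g that cfun.span_superset unfolding basis_of_def by blast
  have Wg: "wronskian d g (ln_branch (l a) x) \<noteq> 0" if "x \<in> regular_disc a" for x
    using wronskian_nonzero_if_basis[OF g] regular_discD[OF that] by (simp add: singular_points_eq)
  have "(\<lambda>x. h (ln_branch (l a) x)) holomorphic_on regular_disc a"
    unfolding h using f gV Wg by (intro holomorphic_on_divide wronskian_holomorphic) auto
  moreover have "\<exists>c. \<forall>x\<in>regular_disc a. (c has_field_derivative
        monic_diff_op d b (\<lambda>t. exp (u * t)) (ln_branch (l a) x) * h (ln_branch (l a) x)) (at x)" for u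
  proof -
    have "1 \<le> M a" "M a \<le> d" using sing a by (auto simp: singular_data_def)
    then obtain n where d: "d = Suc n" by (cases d) auto
    define F where "F i = (if i = n then (\<lambda>t. exp (u * t)) else f (Suc i))" for i
    have F: "F i holomorphic_on UNIV" if "i \<le> n" for i
    proof (cases "i = n")
      case True
      thus ?thesis unfolding F_def by (auto intro!: holomorphic_intros)
    next
      case False
      thus ?thesis using f[of "Suc i"] that by (simp add: F_def d entire)
    qed
    define G where "G F i j x = (xderiv ^^ j) (F i) (ln_branch (l a) x)" for F :: "nat \<Rightarrow> complex \<Rightarrow> complex" and i j x
    let ?A = "\<lambda>x. sqdet (Suc n) (\<lambda>i j. G F i j x)"
    let ?B = "\<lambda>x. sqdet (Suc n) (\<lambda>i j. G (\<lambda>i. g (Suc i)) i j x)"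
    show ?thesis
    proof (intro exI[of _ "\<lambda>x. ?A x / ?B x"] ballI)
      fix x assume x: "x \<in> regular_disc a"
      define \<beta>' where "\<beta>' k = b k (ln_branch (l a) x)" for k
      note x' = regular_discD[OF x]
      have sol: "G F' i (Suc n) x + (\<Sum>k\<le>n. \<beta>' k * G F' i k x) = 0" if "F' i \<in> V" for F' i
        using equation[OF that, of "ln_branch (l a) x"] x'
        by (simp add: G_def \<beta>'_def d lessThan_Suc_atMost del: funpow.simps)
      have A: "(?A has_field_derivative (G F n (Suc n) x + (\<Sum>k\<le>n. \<beta>' k * G F n k x)) * sqdet n (\<lambda>i j. G F i j x)
             - \<beta>' n * ?A x) (at x)"
      proof (rule wronskian_determinant_derivative)
        show "(G F i j has_field_derivative G F i (Suc j) x) (at x)" if "i \<le> n" "j \<le> n" for i j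
          unfolding G_def by (rule has_field_derivative_along_branch[OF F[OF that(1)] x'(1)])
        show "G F i (Suc n) x + (\<Sum>k\<le>n. \<beta>' k * G F i k x) = 0" if "i < n" for i
          using f[of "Suc i"] that by (intro sol) (simp add: F_def d)
      qed
      have "G F n (Suc n) x + (\<Sum>k\<le>n. \<beta>' k * G F n k x) = monic_diff_op d b (\<lambda>t. exp (u * t)) (ln_branch (l a) x)"
        by (simp add: monic_diff_op_def G_def F_def \<beta>'_def d lessThan_Suc_atMost del: funpow.simps)
      moreover have "sqdet n (\<lambda>i j. G F i j x) = wronskian (d - 1) f (ln_branch (l a) x)"
        unfolding wronskian_eq_sqdet d by (simp, rule sqdet_cong) (simp add: G_def F_def)
      moreover have "(?B has_field_derivative (G (\<lambda>i. g (Suc i)) n (Suc n) x + (\<Sum>k\<le>n. \<beta>' k * G (\<lambda>i. g (Suc i)) n k x))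
            * sqdet n (\<lambda>i j. G (\<lambda>i. g (Suc i)) i j x) - \<beta>' n * ?B x) (at x)"
      proof (rule wronskian_determinant_derivative)
        show "(G (\<lambda>i. g (Suc i)) i j has_field_derivative G (\<lambda>i. g (Suc i)) i (Suc j) x) (at x)" if "i \<le> n" "j \<le> n" for i j
          unfolding G_def using gV[of "Suc i"] that
          by (intro has_field_derivative_along_branch entire x'(1)) (simp add: d)
        show "G (\<lambda>i. g (Suc i)) i (Suc n) x + (\<Sum>k\<le>n. \<beta>' k * G (\<lambda>i. g (Suc i)) i k x) = 0" if "i < n" for i
          using gV[of "Suc i"] that by (intro sol) (simp add: d)
      qed
      moreover have "G (\<lambda>i. g (Suc i)) n (Suc n) x + (\<Sum>k\<le>n. \<beta>' k * G (\<lambda>i. g (Suc i)) n k x) = 0"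
        using gV[of "Suc n"] by (intro sol) (simp add: d)
      ultimately have A': "(?A has_field_derivative monic_diff_op d b (\<lambda>t. exp (u * t)) (ln_branch (l a) x)
            * wronskian (d - 1) f (ln_branch (l a) x) - \<beta>' n * ?A x) (at x)"
        and B': "(?B has_field_derivative - \<beta>' n * ?B x) (at x)"
        using A by simp_all
      have B: "?B x = wronskian d g (ln_branch (l a) x)"
        unfolding wronskian_eq_sqdet d by (simp add: G_def)
      hence "?B x \<noteq> 0" using Wg[OF x] by simp
      from DERIV_divide[OF A' B' this]
      show "((\<lambda>x. ?A x / ?B x) has_field_derivative
        monic_diff_op d b (\<lambda>t. exp (u * t)) (ln_branch (l a) x) * h (ln_branch (l a) x)) (at x)"
        unfolding h B[symmetric] using \<open>?B x \<noteq> 0\<close> by (simp add: field_simps)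
    qed
  qed
  ultimately show "?P h" by blast
qed

lemma dagger_eq:
  assumes f: "f \<in> dagger_space d V m l M"
  obtains h where "h \<in> star_space d V" "\<And>t. f t = h t / (exp t ^ d * poly R (exp t))"
  using f unfolding dagger_space_def by (auto simp: poly_R)

lemma circle_in_regular_disc:
  assumes r: "0 < r" "r < norm (exp (l a))"
    and sep: "\<forall>a'\<in>{1..m}. a' \<noteq> a \<longrightarrow> exp (l a') \<notin> cball (exp (l a)) r"
  shows "cball (exp (l a)) r \<subseteq> insert (exp (l a)) (regular_disc a)"
    and "path_image (circlepath (exp (l a)) r) \<subseteq> regular_disc a"
proof -
  show *: "cball (exp (l a)) r \<subseteq> insert (exp (l a)) (regular_disc a)"
  proof
    fix x assume x: "x \<in> cball (exp (l a)) r"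
    show "x \<in> insert (exp (l a)) (regular_disc a)"
    proof (cases "x = exp (l a)")
      case False
      have "x \<notin> Z" using sep x False by (auto simp: Z_def)
      moreover have "x \<in> ball (exp (l a)) (norm (exp (l a)))" using x r(2) by simp
      ultimately show ?thesis unfolding regular_disc_def by blast
    qed simp
  qed
  show "path_image (circlepath (exp (l a)) r) \<subseteq> regular_disc a"
  proof
    fix x assume "x \<in> path_image (circlepath (exp (l a)) r)"
    hence "dist (exp (l a)) x = r" using r(1) by simp
    hence "x \<in> cball (exp (l a)) r" "x \<noteq> exp (l a)" using r(1) by auto
    thus "x \<in> regular_disc a" using * by blast
  qed
qed

text \<open>The combination is the integral over a closed curve of \<open>D x\<^sup>u \<cdot> h\<close> with \<open>h \<in> V\<^sup>\<star>\<close>, which has a primitive: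
  the factor \<open>x\<^sup>d R\<close> by which \<open>V\<^sup>\<dagger>\<close> differs from \<open>V\<^sup>\<star>\<close> is the one that makes the coefficients of the operator
  polynomials.\<close>

lemma integral_annihilated:
  assumes a: "a \<in> {1..m}" and r: "0 < r" "r < norm (exp (l a))"
    and sep: "\<forall>a'\<in>{1..m}. a' \<noteq> a \<longrightarrow> exp (l a') \<notin> cball (exp (l a)) r"
    and f: "f \<in> dagger_space d V m l M"
  defines "J \<equiv> \<lambda>u. contour_integral (circlepath (exp (l a)) r) (\<lambda>x. exp (u * ln_branch (l a) x) * f (ln_branch (l a) x))"
  shows "(\<Sum>j\<le>D. poly (\<beta> j) u * J (u + of_nat j)) = 0"
proof -
  let ?\<gamma> = "circlepath (exp (l a)) r"
  obtain h where h: "h \<in> star_space d V" "\<And>t. f t = h t / (exp t ^ d * poly R (exp t))"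
    using dagger_eq[OF f] by blast
  have hol: "(\<lambda>x. h (ln_branch (l a) x)) holomorphic_on regular_disc a"
    and prim: "\<exists>c. \<forall>x\<in>regular_disc a. (c has_field_derivative
        monic_diff_op d b (\<lambda>t. exp (u * t)) (ln_branch (l a) x) * h (ln_branch (l a) x)) (at x)"
    using star_space_primitive[OF h(1) a] by blast+
  note path = circle_in_regular_disc(2)[OF r sep]
  have f_eq: "f (ln_branch (l a) x) = h (ln_branch (l a) x) / (x ^ d * poly R x)" if "x \<in> regular_disc a" for x
    by (simp only: h(2) regular_discD(4)[OF that])
  have "(\<lambda>x. h (ln_branch (l a) x) / (x ^ d * poly R x)) holomorphic_on regular_disc a"
    using regular_discD poly_R_nonzero by (intro holomorphic_intros hol) auto
  hence f_hol: "(\<lambda>x. f (ln_branch (l a) x)) holomorphic_on regular_disc a"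
    by (rule holomorphic_transform) (simp add: f_eq)
  have int: "(\<lambda>x. exp (v * ln_branch (l a) x) * f (ln_branch (l a) x)) contour_integrable_on ?\<gamma>" for v
  proof (rule contour_integrable_holomorphic_simple[OF _ open_regular_disc _ path])
    have "(\<lambda>t. exp (v * t)) holomorphic_on UNIV" by (intro holomorphic_intros)
    hence "(\<lambda>x. exp (v * ln_branch (l a) x)) holomorphic_on ball (exp (l a)) (norm (exp (l a)))"
      using holomorphic_along_branch[of _ 0 "l a"] by simp
    hence "(\<lambda>x. exp (v * ln_branch (l a) x)) holomorphic_on regular_disc a"
      by (rule holomorphic_on_subset) (auto simp: regular_disc_def)
    thus "(\<lambda>x. exp (v * ln_branch (l a) x) * f (ln_branch (l a) x)) holomorphic_on regular_disc a"
      using f_hol by (rule holomorphic_on_mult)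
  qed simp
  obtain c where c: "\<And>x. x \<in> regular_disc a \<Longrightarrow> (c has_field_derivative
        monic_diff_op d b (\<lambda>t. exp (u * t)) (ln_branch (l a) x) * h (ln_branch (l a) x)) (at x)"
    using prim by blast
  have "((\<lambda>x. monic_diff_op d b (\<lambda>t. exp (u * t)) (ln_branch (l a) x) * h (ln_branch (l a) x)) has_contour_integral 0) ?\<gamma>"
    by (rule Cauchy_theorem_primitive[OF has_field_derivative_at_within[OF c]]) (use path in auto)
  moreover have "monic_diff_op d b (\<lambda>t. exp (u * t)) (ln_branch (l a) x) * h (ln_branch (l a) x)
      = (\<Sum>j\<le>D. poly (\<beta> j) u * (exp ((u + of_nat j) * ln_branch (l a) x) * f (ln_branch (l a) x)))"
    if x: "x \<in> path_image ?\<gamma>" for x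
  proof -
    have x': "x \<in> regular_disc a" using path x by blast
    note xD = regular_discD[OF x']
    define E where "E = (\<Sum>j\<le>D. poly (\<beta> j) u * exp ((u + of_nat j) * ln_branch (l a) x))"
    have "x ^ d * poly R x * monic_diff_op d b (\<lambda>t. exp (u * t)) (ln_branch (l a) x) = E"
      using operator_on_powers[of "ln_branch (l a) x" u] xD by (simp add: E_def)
    moreover have "x ^ d * poly R x \<noteq> 0" using xD poly_R_nonzero by simp
    ultimately have "monic_diff_op d b (\<lambda>t. exp (u * t)) (ln_branch (l a) x) = E / (x ^ d * poly R x)"
      by (metis nonzero_mult_div_cancel_left)
    moreover have "(\<Sum>j\<le>D. poly (\<beta> j) u * (exp ((u + of_nat j) * ln_branch (l a) x) * f (ln_branch (l a) x)))
        = E * f (ln_branch (l a) x)"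
      unfolding E_def sum_distrib_right by (simp only: mult.assoc)
    ultimately show ?thesis by (simp only: f_eq[OF x']) simp
  qed
  ultimately have "((\<lambda>x. \<Sum>j\<le>D. poly (\<beta> j) u * (exp ((u + of_nat j) * ln_branch (l a) x) * f (ln_branch (l a) x)))
      has_contour_integral 0) ?\<gamma>"
    by (rule has_contour_integral_eq)
  moreover have "((\<lambda>x. \<Sum>j\<le>D. poly (\<beta> j) u * (exp ((u + of_nat j) * ln_branch (l a) x) * f (ln_branch (l a) x)))
      has_contour_integral (\<Sum>j\<le>D. poly (\<beta> j) u * J (u + of_nat j))) ?\<gamma>"
    unfolding J_def by (intro has_contour_integral_sum has_contour_integral_lmul has_contour_integral_integral int) auto
  ultimately show ?thesis by (rule has_contour_integral_unique[symmetric])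
qed

lemma mellin_dual_annihilated:
  assumes U: "mellin_dual m l (dagger_space d V m l M) U" and f: "f \<in> U"
  shows "(\<Sum>j\<le>D. poly (\<beta> j) u * f (u + of_nat j)) = 0"
proof -
  obtain r where r: "\<forall>a\<in>{1..m}. 0 < r a \<and> r a < norm (exp (l a)) \<and>
             (\<forall>a'\<in>{1..m}. a' \<noteq> a \<longrightarrow> exp (l a') \<notin> cball (exp (l a)) (r a))"
    and U': "U = cfun.span {(\<lambda>u. contour_integral (circlepath (exp (l a)) (r a))
                            (\<lambda>x. exp (u * ln_branch (l a) x) * f (ln_branch (l a) x))) | a f.
                a \<in> {1..m} \<and> f \<in> dagger_space d V m l M}"
    using U unfolding mellin_dual_def by blast
  show ?thesis
  proof (rule cfun.span_induct[OF f[unfolded U']])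
    show "cfun.subspace {f. (\<Sum>j\<le>D. poly (\<beta> j) u * f (u + of_nat j)) = 0}"
    proof (rule cfun.subspaceI; unfold mem_Collect_eq)
      show "(\<Sum>j\<le>D. poly (\<beta> j) u * 0 (u + of_nat j)) = 0" by simp
      fix f assume f: "(\<Sum>j\<le>D. poly (\<beta> j) u * f (u + of_nat j)) = 0"
      have "(\<Sum>j\<le>D. poly (\<beta> j) u * (k * f (u + of_nat j))) = k * (\<Sum>j\<le>D. poly (\<beta> j) u * f (u + of_nat j))" for k
        by (simp add: sum_distrib_left mult_ac)
      thus "(\<Sum>j\<le>D. poly (\<beta> j) u * (k * f (u + of_nat j))) = 0" for k using f by simp
      fix g assume "(\<Sum>j\<le>D. poly (\<beta> j) u * g (u + of_nat j)) = 0"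
      thus "(\<Sum>j\<le>D. poly (\<beta> j) u * (f + g) (u + of_nat j)) = 0"
        using f by (simp add: distrib_left sum.distrib)
    qed
  next
    fix g assume "g \<in> {(\<lambda>u. contour_integral (circlepath (exp (l a)) (r a))
                            (\<lambda>x. exp (u * ln_branch (l a) x) * f (ln_branch (l a) x))) | a f.
                a \<in> {1..m} \<and> f \<in> dagger_space d V m l M}"
    then obtain a f where g: "g = (\<lambda>u. contour_integral (circlepath (exp (l a)) (r a))
                            (\<lambda>x. exp (u * ln_branch (l a) x) * f (ln_branch (l a) x)))"
      and a: "a \<in> {1..m}" and f: "f \<in> dagger_space d V m l M" by blast
    show "(\<Sum>j\<le>D. poly (\<beta> j) u * g (u + of_nat j)) = 0"
      unfolding g using r a by (intro integral_annihilated[OF a _ _ _ f]) blast+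
  qed
qed

text \<open>The dual of a solution with multiplicity \<open>e\<close> at \<open>z\<^sub>a\<close>, in the basis of \<open>V\<^sup>\<star>\<close> dual to an adapted basis
  of \<open>V\<close>, has multiplicity \<open>d - 1 - e\<close>. The last \<open>M\<^sub>a\<close> solutions thus give elements of \<open>V\<^sup>\<dagger>\<close> with poles of
  order \<open>m\<^sub>a\<^sub>b + 1\<close>.\<close>

lemma dagger_space_pole:
  assumes a: "a \<in> {1..m}" and bb: "bb \<in> {1..M a}"
  obtains f c where "f \<in> dagger_space d V m l M" "c \<noteq> 0"
    "(\<lambda>x. f (ln_branch (l a) x)) holomorphic_on regular_disc a"
    "((\<lambda>x. (x - exp (l a)) ^ Suc (mm a bb) * f (ln_branch (l a) x)) \<longlongrightarrow> c) (at (exp (l a)))"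
proof -
  define z where "z = exp (l a)"
  define e where "e = local_exponent a"
  have Ma: "1 \<le> M a" "M a \<le> d" using sing a by (auto simp: singular_data_def)
  then obtain n where d: "d = Suc n" by (cases d) auto
  define i0 where "i0 = d - M a + (bb - 1)"
  have i0: "i0 < d" "e i0 = d - M a + mm a bb" using Ma bb by (auto simp: i0_def e_def local_exponent_def)
  obtain f where f: "\<And>i. i < d \<Longrightarrow> f i \<in> V" "\<And>i. i < d \<Longrightarrow> root_order (f i) (l a) (e i)"
    using adapted_family[OF a] unfolding e_def by blast
  have e_inj: "inj_on e {..<d}" unfolding e_def by (rule local_exponent_inj[OF a])
  \<comment> \<open>\<open>sk\<close> enumerates the indices other than \<open>i0\<close>; the dual element is the quotient of the Wronskian of
     the remaining solutions by that of all solutions.\<close>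
  define sk where "sk k = (if k < i0 then k else Suc k)" for k
  have sk: "sk k < d" if "k < n" for k using that by (auto simp: sk_def d)
  have sk_bij: "bij_betw sk {..<n} ({..<d} - {i0})"
    by (rule bij_betw_byWitness[where f' = "\<lambda>k. if k < i0 then k else k - 1"])
      (use i0(1) in \<open>auto simp: sk_def d split: if_splits\<close>)
  define g where "g i = f (i - 1)" for i
  define f' where "f' i = f (sk (i - 1))" for i
  define W where "W x = sqdet d (\<lambda>i k. (xderiv ^^ k) (f i) (ln_branch (l a) x))" for x
  define W' where "W' x = sqdet n (\<lambda>i k. (xderiv ^^ k) (f (sk i)) (ln_branch (l a) x))" for x
  obtain c1 where c1: "c1 \<noteq> 0" "((\<lambda>x. W x * (x - z) ^ (\<Sum>k<d. k) / (x - z) ^ (\<Sum>i<d. e i)) \<longlongrightarrow> c1) (at z)"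
    using wronskian_tendsto[of d f "l a" e] f(2) e_inj unfolding W_def z_def by blast
  have "inj_on (\<lambda>i. e (sk i)) {..<n}"
    using comp_inj_on[of sk "{..<n}" e] sk_bij e_inj unfolding bij_betw_def
    by (auto simp: comp_def intro: inj_on_subset)
  moreover have "root_order (f (sk i)) (l a) (e (sk i))" if "i < n" for i
    using f(2)[OF sk[OF that]] .
  ultimately obtain c2 where c2: "c2 \<noteq> 0"
      "((\<lambda>x. W' x * (x - z) ^ (\<Sum>k<n. k) / (x - z) ^ (\<Sum>i<n. e (sk i))) \<longlongrightarrow> c2) (at z)"
    using wronskian_tendsto[of n "\<lambda>i. f (sk i)" "l a" "\<lambda>i. e (sk i)"] unfolding W'_def z_def by blast
  have W_eq: "W x = wronskian d g (ln_branch (l a) x)" for x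
    by (simp add: W_def wronskian_eq_sqdet g_def)
  have W'_eq: "W' x = wronskian (d - 1) f' (ln_branch (l a) x)" for x
    by (simp add: W'_def wronskian_eq_sqdet f'_def d)
  have gV: "g i \<in> V" if "i \<in> {1..d}" for i using f(1)[of "i - 1"] that by (auto simp: g_def)
  have f'V: "f' i \<in> V" if "i \<in> {1..d - 1}" for i
    unfolding f'_def by (rule f(1)[OF sk]) (use that d in auto)
  have sum_e: "(\<Sum>i<d. e i) = e i0 + (\<Sum>i<n. e (sk i))"
    using i0(1) sum.reindex_bij_betw[OF sk_bij, of e] by (simp add: sum.remove[of "{..<d}" i0])
  have W_nz: "\<forall>\<^sub>F x in at z. W x \<noteq> 0"
    using tendsto_imp_eventually_ne[OF c1(2) c1(1)] by eventually_elim auto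
  then obtain x0 where "W x0 \<noteq> 0"
    using eventually_happens[OF W_nz] by (auto simp: trivial_limit_at)
  hence "wronskian d g (ln_branch (l a) x0) \<noteq> 0" unfolding W_eq .
  with gV have basis: "basis_of d g V" by (rule basis_if_wronskian_nonzero)
  define h where "h = (\<lambda>t. wronskian (d - 1) f' t / wronskian d g t)"
  have h: "h \<in> star_space d V"
    unfolding h_def star_space_def using f'V basis by (intro cfun.span_base) blast
  define F where "F = (\<lambda>t. h t / (exp t ^ d * (\<Prod>a=1..m. (exp t - exp (l a)) ^ M a)))"
  have F: "F \<in> dagger_space d V m l M"
    unfolding F_def dagger_space_def using h by (rule imageI)
  have F_eq: "F (ln_branch (l a) x) = h (ln_branch (l a) x) / (x ^ d * poly R x)" if "x \<in> regular_disc a" for x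
    by (simp only: F_def poly_R regular_discD(4)[OF that])
  have hol: "(\<lambda>x. h (ln_branch (l a) x)) holomorphic_on regular_disc a"
    using star_space_primitive[OF h a] by blast
  have "(\<lambda>x. h (ln_branch (l a) x) / (x ^ d * poly R x)) holomorphic_on regular_disc a"
    using regular_discD poly_R_nonzero by (intro holomorphic_intros hol) auto
  hence F_hol: "(\<lambda>x. F (ln_branch (l a) x)) holomorphic_on regular_disc a"
    by (rule holomorphic_transform) (simp add: F_eq)
  define Q where "Q x = (\<Prod>a'\<in>{1..m} - {a}. (x - exp (l a')) ^ M a')" for x
  have R_eq: "poly R x = (x - z) ^ M a * Q x" for x
    unfolding poly_R Q_def z_def by (rule prod.remove) (use a in auto)
  have "z \<noteq> exp (l a')" if "a' \<in> {1..m} - {a}" for a'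
    using sing that a unfolding singular_data_def z_def inj_on_def by blast
  hence Qz: "Q z \<noteq> 0" unfolding Q_def by (subst prod_zero_iff) (simp, fastforce)
  have Q_lim: "(Q \<longlongrightarrow> Q z) (at z)"
    unfolding Q_def by (intro tendsto_prod tendsto_power tendsto_diff tendsto_ident_at tendsto_const)
  have ev_reg: "\<forall>\<^sub>F x in at z. x \<in> regular_disc a"
  proof -
    have "\<forall>\<^sub>F x in at z. x \<in> ball z (norm z) - {z}"
      by (intro eventually_at_in_open) (auto simp: z_def)
    moreover have "\<forall>\<^sub>F x in at z. x \<notin> Z" by (rule eventually_at_not_in_finite[OF finite_Z])
    ultimately show ?thesis by eventually_elim (auto simp: regular_disc_def z_def)
  qed
  have "((\<lambda>x. (W' x * (x - z) ^ (\<Sum>k<n. k) / (x - z) ^ (\<Sum>i<n. e (sk i)))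
        / (W x * (x - z) ^ (\<Sum>k<d. k) / (x - z) ^ (\<Sum>i<d. e i)) / (x ^ d * Q x))
      \<longlongrightarrow> c2 / c1 / (z ^ d * Q z)) (at z)"
    by (intro tendsto_divide c1(2) c2(2) tendsto_mult tendsto_power tendsto_ident_at Q_lim c1(1))
      (use Qz in \<open>simp_all add: z_def\<close>)
  moreover have "\<forall>\<^sub>F x in at z. (W' x * (x - z) ^ (\<Sum>k<n. k) / (x - z) ^ (\<Sum>i<n. e (sk i)))
        / (W x * (x - z) ^ (\<Sum>k<d. k) / (x - z) ^ (\<Sum>i<d. e i)) / (x ^ d * Q x)
      = (x - z) ^ Suc (mm a bb) * F (ln_branch (l a) x)"
    using ev_reg W_nz eventually_neq_at_within[of z]
  proof eventually_elim
    case (elim x)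
    have J: "(\<Sum>k<d. k) = n + (\<Sum>k<n. k)" by (simp add: d)
    define A where "A = (x - z) ^ (\<Sum>k<n. k)"
    define B where "B = (x - z) ^ (\<Sum>i<n. e (sk i))"
    have nz: "A \<noteq> 0" "B \<noteq> 0" "x - z \<noteq> 0" using elim(3) by (simp_all add: A_def B_def)
    have "(W' x * A / B) / (W x * ((x - z) ^ n * A) / ((x - z) ^ e i0 * B)) / (x ^ d * Q x)
        = W' x / W x * ((x - z) ^ e i0 / (x - z) ^ n) / (x ^ d * Q x)"
      using nz by (simp add: field_simps)
    also have "(x - z) ^ e i0 / (x - z) ^ n = (x - z) ^ Suc (mm a bb) / (x - z) ^ M a"
    proof -
      have "e i0 + M a = Suc (mm a bb) + n" using i0(2) Ma d by simp
      hence "(x - z) ^ e i0 * (x - z) ^ M a = (x - z) ^ Suc (mm a bb) * (x - z) ^ n"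
        by (simp only: power_add[symmetric])
      thus ?thesis using nz by (simp add: frac_eq_eq del: power_Suc)
    qed
    also have "W' x / W x * ((x - z) ^ Suc (mm a bb) / (x - z) ^ M a) / (x ^ d * Q x)
        = (x - z) ^ Suc (mm a bb) * (W' x / W x / (x ^ d * poly R x))"
      by (simp add: R_eq mult_ac)
    also have "W' x / W x / (x ^ d * poly R x) = F (ln_branch (l a) x)"
      using F_eq[OF elim(1)] by (simp add: h_def W_eq W'_eq)
    finally show ?case by (simp only: A_def B_def J sum_e power_add)
  qed
  ultimately have "((\<lambda>x. (x - z) ^ Suc (mm a bb) * F (ln_branch (l a) x)) \<longlongrightarrow> c2 / c1 / (z ^ d * Q z)) (at z)"
    by (rule Lim_transform_eventually)
  moreover have "c2 / c1 / (z ^ d * Q z) \<noteq> 0" using c1(1) c2(1) Qz by (simp add: z_def)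
  ultimately show ?thesis using that[OF F _ F_hol] unfolding z_def by blast
qed

lemma mellin_dual_summand:
  assumes U: "mellin_dual m l (dagger_space d V m l M) U" and a: "a \<in> {1..m}" and bb: "bb \<in> {1..M a}"
  obtains p where "Polynomial.degree p = mm a bb" "p \<noteq> 0" "(\<lambda>u. exp (u * l a) * poly p u) \<in> U"
proof -
  obtain r where r: "\<forall>a\<in>{1..m}. 0 < r a \<and> r a < norm (exp (l a)) \<and>
             (\<forall>a'\<in>{1..m}. a' \<noteq> a \<longrightarrow> exp (l a') \<notin> cball (exp (l a)) (r a))"
    and U': "U = cfun.span {(\<lambda>u. contour_integral (circlepath (exp (l a)) (r a))
                            (\<lambda>x. exp (u * ln_branch (l a) x) * f (ln_branch (l a) x))) | a f.
                a \<in> {1..m} \<and> f \<in> dagger_space d V m l M}"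
    using U unfolding mellin_dual_def by blast
  have r': "0 < r a" "r a < norm (exp (l a))"
    "\<forall>a'\<in>{1..m}. a' \<noteq> a \<longrightarrow> exp (l a') \<notin> cball (exp (l a)) (r a)"
    using r a by blast+
  obtain f c where f: "f \<in> dagger_space d V m l M" "c \<noteq> 0"
    "(\<lambda>x. f (ln_branch (l a) x)) holomorphic_on regular_disc a"
    "((\<lambda>x. (x - exp (l a)) ^ Suc (mm a bb) * f (ln_branch (l a) x)) \<longlongrightarrow> c) (at (exp (l a)))"
    using dagger_space_pole[OF a bb] by blast
  let ?T = "ball (exp (l a)) (norm (exp (l a))) - (Z - {exp (l a)})"
  have aZ: "exp (l a) \<in> Z" using a by (auto simp: Z_def)
  have T: "?T - {exp (l a)} = regular_disc a" "open ?T" "?T \<subseteq> ball (exp (l a)) (norm (exp (l a)))"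
    "cball (exp (l a)) (r a) \<subseteq> ?T"
  proof -
    show T1: "?T - {exp (l a)} = regular_disc a" using aZ by (auto simp: regular_disc_def)
    show "open ?T" using finite_Z by (intro open_Diff finite_imp_closed) auto
    show "cball (exp (l a)) (r a) \<subseteq> ?T"
      using circle_in_regular_disc(1)[OF r'] T1 by fastforce
  qed blast
  obtain p where p: "Polynomial.degree p = mm a bb" "p \<noteq> 0"
    "\<And>u. contour_integral (circlepath (exp (l a)) (r a)) (\<lambda>x. exp (u * ln_branch (l a) x) * f (ln_branch (l a) x))
        = exp (u * l a) * poly p u"
    using pole_integral[OF r'(1) T(4) T(2,3), of "\<lambda>x. f (ln_branch (l a) x)" "mm a bb" c] f T(1) by metis
  have "(\<lambda>u. contour_integral (circlepath (exp (l a)) (r a))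
        (\<lambda>x. exp (u * ln_branch (l a) x) * f (ln_branch (l a) x))) \<in> U"
    unfolding U' using a f(1) by (intro cfun.span_base) blast
  with p that show ?thesis by simp
qed

end

section \<open>The two Baker--Akhiezer functions\<close>

locale dual_pair =
  Q: quasi_polynomials n N nn lam p +
  F: fuchsian_space "\<Sum>i=1..n. N i" "qpoly_space n N lam p" b m l M mm "quasi_polynomials.rho n N nn lam" +
  E: quasi_exponentials m l M' mm' q
  for n N nn lam p b m l M mm M' mm' q +
  fixes B :: "nat \<Rightarrow> complex poly"
  assumes B: "fundamental_shift_op (\<Sum>a=1..m. M' a) (qexp_space m l M' q) B"
    and dual: "mellin_dual m l (dagger_space (\<Sum>i=1..n. N i) (qpoly_space n N lam p) m l M) (qexp_space m l M' q)"
begin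

lemma leading_nonzero: "F.\<beta> F.D \<noteq> 0"
  unfolding F.leading_coefficient by (simp add: prod_zero_iff)

text \<open>The poles of \<open>V\<^sup>\<dagger>\<close> at \<open>z\<^sub>a\<close> give elements of \<open>U\<close> of the degrees \<open>mm a 1, mm a 2, \<dots>\<close>, which must occur among
  the \<open>mm' a\<close>; so \<open>M a \<le> M' a\<close>. If one of these inequalities were strict, \<open>\<beta>\<close> would annihilate \<open>U\<close> with
  order less than \<open>dim U\<close>.\<close>

lemma multiplicities_equal:
  assumes a: "a \<in> {1..m}"
  shows "M a = M' a"
proof (rule ccontr)
  have le: "M a \<le> M' a" if a: "a \<in> {1..m}" for a
  proof -
    have "mm a ` {1..M a} \<subseteq> mm' a ` {1..M' a}"
    proof
      fix e assume "e \<in> mm a ` {1..M a}"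
      then obtain bb where bb: "bb \<in> {1..M a}" "e = mm a bb" by blast
      obtain p where p: "Polynomial.degree p = mm a bb" "p \<noteq> 0"
          "(\<lambda>u. exp (u * l a) * poly p u) \<in> qexp_space m l M' q"
        using F.mellin_dual_summand[OF dual a bb(1)] by blast
      obtain b' where "b' \<in> {1..M' a}" "Polynomial.degree p = mm' a b'"
        using E.degree_of_summand[OF p(3) a p(2)] by blast
      with p(1) bb(2) show "e \<in> mm' a ` {1..M' a}" by (intro image_eqI[of _ _ b']) simp_all
    qed
    hence "card (mm a ` {1..M a}) \<le> card (mm' a ` {1..M' a})" by (intro card_mono) auto
    moreover have "strict_mono_on {1..M a} (mm a)"
      using F.sing a unfolding singular_data_def by blast
    hence "card (mm a ` {1..M a}) = M a"
      using card_image[OF strict_mono_on_imp_inj_on] by fastforce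
    moreover have "card (mm' a ` {1..M' a}) \<le> M' a"
      using card_image_le[of "{1..M' a}" "mm' a"] by simp
    ultimately show ?thesis by simp
  qed
  assume "M a \<noteq> M' a"
  hence "F.D < (\<Sum>a=1..m. M' a)"
    unfolding F.D_def using le a by (intro sum_strict_mono_ex1) (auto intro!: bexI[of _ a] le_neq_implies_less)
  hence "F.\<beta> F.D = 0"
    using F.mellin_dual_annihilated[OF dual] by (intro E.short_annihilator_zero[where J = F.D and \<gamma> = F.\<beta>]) auto
  with leading_nonzero show False by contradiction
qed

lemma order_equal: "(\<Sum>a=1..m. M' a) = F.D"
  unfolding F.D_def using multiplicities_equal by simp

lemma shift_operator_form:
  assumes f: "f \<in> qexp_space m l M' q"
  shows "(\<Sum>j\<le>F.D. poly (B (F.D - j)) u * f (u + of_nat j)) = 0"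
proof -
  have "(\<Sum>k\<le>F.D. poly (B k) u * f (u + of_nat (F.D - k))) = 0"
    using B f unfolding fundamental_shift_op_def annihilates_shift_def order_equal by blast
  moreover have "(\<Sum>k\<le>F.D. poly (B k) u * f (u + of_nat (F.D - k)))
      = (\<Sum>j\<le>F.D. poly (B (F.D - j)) u * f (u + of_nat j))"
    by (rule sum.reindex_bij_witness[of _ "\<lambda>j. F.D - j" "\<lambda>k. F.D - k"]) auto
  ultimately show ?thesis by simp
qed

text \<open>Eliminating the leading terms of two annihilators of order \<open>dim U\<close> leaves an annihilator of smaller
  order, which is zero.\<close>

lemma operators_proportional:
  assumes j: "j \<le> F.D"
  shows "F.\<beta> F.D * B (F.D - j) = B 0 * F.\<beta> j"
proof (cases "j = F.D")
  case False
  define \<gamma> where "\<gamma> j = F.\<beta> F.D * B (F.D - j) - B 0 * F.\<beta> j" for j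
  have "(\<Sum>j\<le>F.D - 1. poly (\<gamma> j) u * f (u + of_nat j)) = 0" if f: "f \<in> qexp_space m l M' q" for f u
  proof -
    have "(\<Sum>j\<le>F.D. poly (\<gamma> j) u * f (u + of_nat j))
        = poly (F.\<beta> F.D) u * (\<Sum>j\<le>F.D. poly (B (F.D - j)) u * f (u + of_nat j))
          - poly (B 0) u * (\<Sum>j\<le>F.D. poly (F.\<beta> j) u * f (u + of_nat j))"
      unfolding sum_distrib_left sum_subtractf[symmetric]
      by (intro sum.cong refl) (simp add: \<gamma>_def algebra_simps)
    also have "\<dots> = 0"
      using shift_operator_form[OF f] F.mellin_dual_annihilated[OF dual f] by simp
    finally have "(\<Sum>j\<le>F.D. poly (\<gamma> j) u * f (u + of_nat j)) = 0" .
    moreover have "{..F.D} = insert F.D {..F.D - 1}" using j False by auto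
    moreover have "\<gamma> F.D = 0" by (simp add: \<gamma>_def mult.commute)
    ultimately show ?thesis using j False by (simp add: sum.insert)
  qed
  moreover have "F.D - 1 < (\<Sum>a=1..m. M' a)" unfolding order_equal using j False by simp
  moreover have "j \<le> F.D - 1" using j False by simp
  ultimately have "\<gamma> j = 0" by (rule E.short_annihilator_zero)
  thus ?thesis by (simp add: \<gamma>_def)
qed (simp add: mult.commute)

lemma leading_value: "poly (F.\<beta> F.D) u = (\<Prod>i=1..n. \<Prod>j=1..N i. u - lam i - of_nat (nn i j))"
  unfolding F.leading_coefficient Q.prod_rho[symmetric] by (simp add: poly_prod)

lemma Baker_Akhiezer_functions_agree:
  assumes t: "exp t \<notin> (\<lambda>a. exp (l a)) ` {1..m}"
    and u: "\<forall>i\<in>{1..n}. \<forall>j\<in>{1..N i}. u \<noteq> lam i + of_nat (nn i j)"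
    and u': "poly (B 0) u \<noteq> 0"
  shows "gaudin_BA n N nn lam b t u = xxx_BA m l M' B u t"
proof -
  let ?d = "\<Sum>i=1..n. N i" and ?P = "\<Prod>i=1..n. \<Prod>j=1..N i. u - lam i - of_nat (nn i j)"
  have tZ: "exp t \<notin> F.Z" using t by (simp add: F.Z_def)
  have R: "poly F.R (exp t) \<noteq> 0" by (rule F.poly_R_nonzero[OF tZ])
  have R_eq: "poly F.R (exp t) = (\<Prod>a=1..m. (exp t - exp (l a)) ^ M' a)"
    unfolding F.poly_R using multiplicities_equal by (intro prod.cong refl) simp
  have P: "?P \<noteq> 0"
    using u by (auto simp: prod_zero_iff algebra_simps)
  have "(\<Prod>i=1..n. \<Prod>j=1..N i. exp t / (u - lam i - of_nat (nn i j))) = exp t ^ ?d / ?P"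
    by (simp add: prod_dividef power_sum)
  hence lhs: "gaudin_BA n N nn lam b t u = exp t ^ ?d / ?P * monic_diff_op ?d b (\<lambda>s. exp (u * s)) t"
    by (simp add: gaudin_BA_def)
  have "monic_shift_op F.D B (\<lambda>v. exp (v * t)) u
      = (\<Sum>j\<le>F.D. poly (B (F.D - j)) u / poly (B 0) u * exp ((u + of_nat j) * t))"
    unfolding monic_shift_op_def
    by (rule sum.reindex_bij_witness[of _ "\<lambda>j. F.D - j" "\<lambda>k. F.D - k"]) auto
  also have "\<dots> = (\<Sum>j\<le>F.D. poly (F.\<beta> j) u * exp ((u + of_nat j) * t) / ?P)"
  proof (intro sum.cong refl)
    fix j assume "j \<in> {..F.D}"
    hence "F.\<beta> F.D * B (F.D - j) = B 0 * F.\<beta> j" by (intro operators_proportional) auto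
    hence "?P * poly (B (F.D - j)) u = poly (B 0) u * poly (F.\<beta> j) u"
      using leading_value[of u] by (metis poly_mult)
    hence "poly (B (F.D - j)) u / poly (B 0) u = poly (F.\<beta> j) u / ?P"
      using P u' by (simp add: field_simps)
    thus "poly (B (F.D - j)) u / poly (B 0) u * exp ((u + of_nat j) * t)
        = poly (F.\<beta> j) u * exp ((u + of_nat j) * t) / ?P" by simp
  qed
  also have "\<dots> = exp t ^ ?d * poly F.R (exp t) * monic_diff_op ?d b (\<lambda>s. exp (u * s)) t / ?P"
    unfolding F.operator_on_powers[OF tZ] by (simp only: sum_divide_distrib)
  finally have shift: "monic_shift_op F.D B (\<lambda>v. exp (v * t)) u
      = exp t ^ ?d * poly F.R (exp t) * monic_diff_op ?d b (\<lambda>s. exp (u * s)) t / ?P" .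
  have "(\<Prod>a=1..m. 1 / (exp t - exp (l a)) ^ M' a) = 1 / poly F.R (exp t)"
    by (simp add: R_eq prod_dividef)
  hence rhs: "xxx_BA m l M' B u t
      = 1 / poly F.R (exp t) * (exp t ^ ?d * poly F.R (exp t) * monic_diff_op ?d b (\<lambda>s. exp (u * s)) t / ?P)"
    unfolding xxx_BA_def order_equal shift by (simp only:)
  show ?thesis unfolding lhs rhs using R by simp
qed

end

theorem theorem11p1:
  fixes n m n' :: nat
    and N M N' M' :: "nat \<Rightarrow> nat"
    and nn mm nn' mm' :: "nat \<Rightarrow> nat \<Rightarrow> nat"
    and lam mu l :: "nat \<Rightarrow> complex"
    and p q :: "nat \<Rightarrow> nat \<Rightarrow> complex poly"
    and V U :: "(complex \<Rightarrow> complex) set"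
    and X Y :: "complex poly set"
    and b :: "nat \<Rightarrow> complex \<Rightarrow> complex"
    and B :: "nat \<Rightarrow> complex poly"
    and dV dU :: nat
  defines "dV \<equiv> (\<Sum>i=1..n. N i)"
    and "dU \<equiv> (\<Sum>a=1..m. M' a)"
  assumes V: "qpoly_data n N nn lam p" "V = qpoly_space n N lam p"
    and V_nondegenerate: "qpoly_nondegenerate n N nn lam p"
    and V_singular: "singular_data dV V m l M mm"
    and V_operator: "fundamental_diff_op dV V b"
    and U: "qexp_data m l M' mm' q" "U = qexp_space m l M' q"
    and U_discrete: "discrete_data dU U n' N' nn' mu"
    and U_operator: "fundamental_shift_op dU U B"
    and U_nondegenerate: "qexp_nondegenerate m M' mm' n' N' nn' B"
    and U_dual_to_V: "mellin_dual m l (dagger_space dV V m l M) U"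
    and V_dual_to_U: "fourier_dual n' N' nn' mu (ddagger_space dU U B) V"
    and X: "X = gaudin_subspace n N nn lam p"
    and Y: "xxx_subspace m l M' mm' q Y"
  shows "bispectral_correspondent X Y \<and>
    (\<forall>t u. exp t \<notin> (\<lambda>a. exp (l a)) ` {1..m} \<and>
           (\<forall>i\<in>{1..n}. \<forall>j\<in>{1..N i}. u \<noteq> lam i + of_nat (nn i j)) \<and>
           poly (B 0) u \<noteq> 0 \<longrightarrow>
       gaudin_BA n N nn lam b t u = xxx_BA m l M' B u t)"
proof -
  interpret Q: quasi_polynomials n N nn lam p
    using V(1) V_nondegenerate by unfold_locales
  interpret F: fuchsian_space "\<Sum>i=1..n. N i" "qpoly_space n N lam p" b m l M mm Q.rho
    by (rule Q.fuchsian) (use V_operator V_singular in \<open>simp_all only: dV_def V(2)\<close>)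
  interpret E: quasi_exponentials m l M' mm' q
    using U(1) by unfold_locales
  interpret dual_pair n N nn lam p b m l M mm M' mm' q B
    by unfold_locales (use U_operator U_dual_to_V in \<open>simp_all only: dV_def dU_def V(2) U(2)\<close>)
  have agree: "gaudin_BA n N nn lam b t u = xxx_BA m l M' B u t"
    if "exp t \<notin> (\<lambda>a. exp (l a)) ` {1..m}" "\<forall>i\<in>{1..n}. \<forall>j\<in>{1..N i}. u \<noteq> lam i + of_nat (nn i j)"
      "poly (B 0) u \<noteq> 0" for t u
    by (rule Baker_Akhiezer_functions_agree[OF that])
  have gaudin: "is_gaudin_BA X (gaudin_BA n N nn lam b)"
    unfolding is_gaudin_BA_def
    by (rule exI[of _ n], rule exI[of _ N], rule exI[of _ nn], rule exI[of _ lam], rule exI[of _ p],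
        rule exI[of _ b])
      (intro conjI V(1) V_nondegenerate X refl V_operator[unfolded dV_def V(2)])
  have xxx: "is_xxx_BA Y (xxx_BA m l M' B)"
    unfolding is_xxx_BA_def
    by (rule exI[of _ m], rule exI[of _ l], rule exI[of _ M'], rule exI[of _ mm'], rule exI[of _ q],
        rule exI[of _ n'], rule exI[of _ N'], rule exI[of _ nn'], rule exI[of _ mu], rule exI[of _ B])
      (intro conjI U(1) U_discrete[unfolded dU_def U(2)] U_operator[unfolded dU_def U(2)]
        U_nondegenerate Y refl)
  define S where "S = (\<lambda>a. exp (l a)) ` {1..m}"
  define T where "T = (\<Union>i\<in>{1..n}. (\<lambda>j. lam i + of_nat (nn i j)) ` {1..N i}) \<union> {u. poly (B 0) u = 0}"
  have "B 0 \<noteq> 0" using U_operator by (auto simp: fundamental_shift_op_def)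
  hence "finite S" "finite T" by (auto simp: S_def T_def intro: poly_roots_finite)
  moreover have "gaudin_BA n N nn lam b t u = xxx_BA m l M' B u t" if "exp t \<notin> S" "u \<notin> T" for t u
    by (rule agree) (use that in \<open>auto simp: S_def T_def\<close>)
  ultimately have "bispectral_correspondent X Y"
    unfolding bispectral_correspondent_def using gaudin xxx by blast
  with agree show ?thesis by blast
qed

end
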